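(* Let $r = \frac{p}{q}$ be a complex rational function of degree $n \ge 2$, with $p, q$ coprime polynomials, and set $f(z) = r(z) - \overline{z}$. If (i) $f$ has $5(n-1)$ zeros, or (ii) $\deg(p) > \deg(q)$ and $f$ has $5(n-1)-1$ zeros, then none of the zeros of $f$ are singular.
   Context: The degree of a rational function $r = \frac{p}{q}$, with $p, q$ coprime complex polynomials, is $\deg(r) = \max\{\deg(p), \deg(q)\}$. A zero of $f(z) = r(z) - \overline{z}$ is a point $z_0 \in \mathbb{C}$, not a pole of $r$, with $r(z_0) = \overline{z_0}$. A zero $z_0$ of $f$ is called singular if $|r'(z_0)| = 1$. Numbers of zeros count distinct points of $\mathbb{C}$. *)

theory Defs
  imports
    "HOL-Complex_Analysis.Complex_Analysis"
    "HOL-Computational_Algebra.Computational_Algebra"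
begin

text \<open>
  A rational function is given by a numerator \<open>p\<close> and a denominator \<open>q\<close>. By the convention
  \<open>x / 0 = 0\<close>, the function below takes the junk value \<open>0\<close> at the zeros of \<open>q\<close>.
\<close>

definition rat_fun :: "complex poly \<Rightarrow> complex poly \<Rightarrow> complex \<Rightarrow> complex" where
  "rat_fun p q z = poly p z / poly q z"

text \<open>This is the degree of the rational function only if \<open>p\<close> and \<open>q\<close> are coprime.\<close>

definition rat_degree :: "complex poly \<Rightarrow> complex poly \<Rightarrow> nat" where
  "rat_degree p q = max (degree p) (degree q)"

text \<open>
  The zeros of \<open>f z = r z - cnj z\<close>. Excluding the poles of \<open>r\<close> is essential: if \<open>0\<close> is a pole of
  \<open>r = rat_fun p q\<close>, then the junk value there satisfies \<open>r 0 = cnj 0\<close>.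
\<close>

definition harmonic_zeros :: "(complex \<Rightarrow> complex) \<Rightarrow> complex set" where
  "harmonic_zeros r = {z. \<not> is_pole r z \<and> r z - cnj z = 0}"

definition singular_zero :: "(complex \<Rightarrow> complex) \<Rightarrow> complex \<Rightarrow> bool" where
  "singular_zero r z \<longleftrightarrow> z \<in> harmonic_zeros r \<and> cmod (deriv r z) = 1"

end

theory Submission
  imports Defs
begin

text \<open>
  Zeros of \<open>f\<close> are fixed points of the antiholomorphic map \<open>R z = cnj (r z)\<close>.

  Suppose first that \<open>degree p \<le> degree q = n\<close> and that no zero is singular. The winding number of
  \<open>f\<close> on a large circle gives \<open>N\<^sub>+ = N\<^sub>- + n - 1\<close> for the numbers of zeros with \<open>|r'| > 1\<close> and
  \<open>|r'| < 1\<close>. In particular some zero is repelling; a Moebius change of coordinate sends it to infinity,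
  and then no attracting basin contains infinity. By Fatou's argument every attracting basin contains a
  critical point of \<open>r\<close>: otherwise \<open>R\<close> would be a covering of the basin, and the inverse branches of its
  iterates would form a normal family with unbounded derivatives at the fixed point. So
  \<open>N\<^sub>- \<le> 2 n - 2\<close>, and \<open>f\<close> has at most \<open>5 n - 5\<close> zeros.

  If some zero \<open>z\<^sub>1\<close> is singular, replace \<open>r\<close> by \<open>a r + b\<close>, where \<open>a = 1 \<plusminus> \<epsilon> \<alpha>\<close> and \<open>b\<close> is chosen such
  that \<open>z\<^sub>1\<close> remains a zero. Near each zero the equation reduces to one real equation \<open>g x = 0\<close>, and sign
  changes of \<open>g\<close> show that the two perturbations together have at least four zeros near \<open>z\<^sub>1\<close> and at least
  two near every other zero. Hence one of them has more zeros than \<open>f\<close>, and so has a nearby map without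
  singular zeros, whence \<open>f\<close> has less than \<open>5 n - 5\<close> zeros. If \<open>degree p > degree q\<close>, then infinity is a
  further fixed point of \<open>R\<close>; moving it to a finite point adds one to the number of zeros.
\<close>

subsection \<open>Rational functions and Wronskians\<close>

text \<open>The two bounds combine as 2 (2 n - 2) + n - 1 = 5 n - 5. A singular zero breaks this
  count: it contributes an unknown index and is not isolated for any general reason. So singular
  maps are compared with regular ones instead of being counted directly. A single perturbation would
  not do, since it may destroy zeros at which the real equation has no sign change; but what one of
  two opposite perturbations loses the other gains, so the sum of both counts is controlled.
  Counting sign changes rather than zeros makes the counts stable in the parameters
  \<open>(a, b)\<close>, which leaves room to move to a parameter without singular zeros; those with
  one form a null set.

  The condition \<open>degree p \<le> degree q\<close> keeps infinity from being fixed, so that the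
  zeros are bounded and the growth of f on large circles is known. For critical points the opposite
  condition \<open>degree q < degree p\<close> is convenient: every finite point then has all its
  preimages in the plane. The Moebius coordinate passes between the two normalisations.\<close>

definition wronskian :: "complex poly \<Rightarrow> complex poly \<Rightarrow> complex poly" where
  "wronskian p q = pderiv p * q - p * pderiv q"

definition rat_deriv :: "complex poly \<Rightarrow> complex poly \<Rightarrow> complex \<Rightarrow> complex" where
  "rat_deriv p q z = poly (wronskian p q) z / (poly q z)\<^sup>2"

text \<open>Coprimality over the complex numbers in pointwise form, which is readily checked after
  affine and Moebius changes of the map.\<close>

definition no_common_root :: "complex poly \<Rightarrow> complex poly \<Rightarrow> bool" where
  "no_common_root p q \<longleftrightarrow> (\<forall>z. poly p z \<noteq> 0 \<or> poly q z \<noteq> 0)"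

definition cnj_fixed :: "complex poly \<Rightarrow> complex poly \<Rightarrow> complex set" where
  "cnj_fixed p q = {z. poly q z \<noteq> 0 \<and> rat_fun p q z = cnj z}"

lemma rat_fun_has_field_derivative:
  assumes "poly q z \<noteq> 0"
  shows "(rat_fun p q has_field_derivative rat_deriv p q z) (at z within S)"
  unfolding rat_fun_def rat_deriv_def wronskian_def
  by (rule derivative_eq_intros poly_DERIV[THEN has_field_derivative_at_within] assms refl)+
     (simp add: power2_eq_square mult.commute)

lemma rat_deriv_eq_0_iff: "poly q z \<noteq> 0 \<Longrightarrow> rat_deriv p q z = 0 \<longleftrightarrow> poly (wronskian p q) z = 0"
  by (simp add: rat_deriv_def)

lemma open_poly_nonzero: "open {z::complex. poly q z \<noteq> 0}"
  by (intro open_Collect_neq continuous_intros)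

lemma continuous_on_rat_fun: "S \<subseteq> {z. poly q z \<noteq> 0} \<Longrightarrow> continuous_on S (rat_fun p q)"
  unfolding rat_fun_def by (intro continuous_intros) auto

lemma holomorphic_on_rat_fun: "S \<subseteq> {z. poly q z \<noteq> 0} \<Longrightarrow> rat_fun p q holomorphic_on S"
  unfolding rat_fun_def by (intro holomorphic_intros) auto

lemma wronskian_smult_sub: "wronskian (p - smult c q) q = wronskian p q"
  by (simp add: wronskian_def pderiv_diff pderiv_smult algebra_simps)

lemma degree_wronskian_le_sum: "degree (wronskian p q) \<le> degree p + degree q - 1"
proof -
  have "degree (pderiv p * q) \<le> degree p + degree q - 1"
  proof (cases "degree p = 0")
    case True
    then have "pderiv p = 0" by (simp add: pderiv_eq_0_iff)
    then show ?thesis by simp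
  next
    case False
    then show ?thesis using degree_mult_le[of "pderiv p" q] by (simp add: degree_pderiv)
  qed
  moreover have "degree (p * pderiv q) \<le> degree p + degree q - 1"
  proof (cases "degree q = 0")
    case True
    then have "pderiv q = 0" by (simp add: pderiv_eq_0_iff)
    then show ?thesis by simp
  next
    case False
    then show ?thesis using degree_mult_le[of p "pderiv q"] by (simp add: degree_pderiv)
  qed
  ultimately show ?thesis unfolding wronskian_def by (rule degree_diff_le)
qed

text \<open>If \<open>degree q = n\<close>, replacing \<open>p\<close> by
  \<open>p - smult c q\<close> keeps the Wronskian and, for the right \<open>c\<close>, cancels the
  coefficient at \<open>n\<close>. This gains the 1 by which the sum bound 2 n - 1 is too
  large.\<close>

lemma degree_wronskian_le:
  assumes "degree p \<le> n" "degree q \<le> n"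
  shows "degree (wronskian p q) \<le> 2 * n - 2"
proof (cases "degree q < n")
  case True
  then show ?thesis using assms degree_wronskian_le_sum[of p q] by linarith
next
  case False
  then have dq: "degree q = n" using assms by simp
  define c where "c = coeff p n / coeff q n"
  have "degree (p - smult c q) < n" if "n > 0"
  proof -
    have "coeff q n \<noteq> 0" using dq that by (metis degree_0 leading_coeff_0_iff less_irrefl)
    then have "coeff (p - smult c q) n = 0" by (simp add: c_def)
    moreover have "degree (p - smult c q) \<le> n"
      using assms by (intro degree_diff_le) (auto intro: order_trans[OF degree_smult_le])
    ultimately show ?thesis using that
      by (metis coeff_0_degree_minus_1 diff_is_0_eq' eq_zero_or_degree_less degree_0)
  qed
  then show ?thesis using degree_wronskian_le_sum[of "p - smult c q" q] dq assms
    degree_wronskian_le_sum[of p q]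
    by (cases "n = 0") (auto simp: wronskian_smult_sub)
qed

text \<open>The top coefficients of the two products carry the factors \<open>degree p\<close> and
  \<open>degree q\<close>. These differ, so the terms do not cancel, and there are only finitely
  many critical points.\<close>

lemma wronskian_nonzero:
  assumes "degree q < degree p" "q \<noteq> 0"
  shows "wronskian p q \<noteq> 0"
proof (cases "degree q = 0")
  case True
  then have "pderiv q = 0" "pderiv p \<noteq> 0" using assms by (auto simp: pderiv_eq_0_iff)
  then show ?thesis using assms by (simp add: wronskian_def)
next
  case False
  have "coeff (pderiv p * q) (degree p + degree q - 1) = of_nat (degree p) * lead_coeff p * lead_coeff q"
    using coeff_mult_degree_sum[of "pderiv p" q] assms by (simp add: degree_pderiv coeff_pderiv)
  moreover have "coeff (p * pderiv q) (degree p + degree q - 1) = of_nat (degree q) * lead_coeff p * lead_coeff q"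
    using coeff_mult_degree_sum[of p "pderiv q"] assms False by (simp add: degree_pderiv coeff_pderiv)
  ultimately have "coeff (wronskian p q) (degree p + degree q - 1)
      = (of_nat (degree p) - of_nat (degree q)) * lead_coeff p * lead_coeff q"
    by (simp add: wronskian_def algebra_simps)
  moreover have "p \<noteq> 0" using assms by auto
  ultimately have "coeff (wronskian p q) (degree p + degree q - 1) \<noteq> 0"
    using assms by simp
  then show ?thesis by auto
qed

lemma card_roots_rsquarefree:
  fixes P :: "complex poly"
  assumes "rsquarefree P"
  shows "card {z. poly P z = 0} = degree P"
proof -
  have "P \<noteq> 0" using assms by (simp add: rsquarefree_def)
  have "degree P = degree (smult (lead_coeff P) (\<Prod>z|poly P z = 0. [:-z, 1:]))"
    using complex_poly_decompose_rsquarefree[OF assms] by simp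
  also have "\<dots> = card {z. poly P z = 0}"
    using \<open>P \<noteq> 0\<close> by (simp add: degree_prod_eq_sum_degree)
  finally show ?thesis by simp
qed

subsection \<open>The index formula for regular maps\<close>

text \<open>\<open>z powi k\<close> winds k times around 0, which a function with a continuous
  logarithm cannot do unless k = 0. In \<open>h\<close> the logarithm is compared with the angle:
  \<open>exp (h t)\<close> is constant, so distinct values of \<open>h\<close> are at least 2 pi
  apart and \<open>h\<close> is constant; its two end values belong to the same point of the circle
  and differ by the linear term alone.\<close>

lemma powi_log_on_circle_imp_0:
  fixes k :: int
  assumes M: "M > 0" and cont: "continuous_on (sphere (0::complex) M) g"
    and eq: "\<And>z. z \<in> sphere 0 M \<Longrightarrow> z powi k = exp (g z)"
  shows "k = 0"
proof -
  define h where "h = (\<lambda>t::real. g (of_real M * cis t) - \<i> * of_int k * of_real t)"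
  have conth: "continuous_on {0..2*pi} h"
    unfolding h_def
    by (intro continuous_intros continuous_on_compose2[OF cont]) (auto simp: norm_mult M less_imp_le)
  have exph: "exp (h t) = of_real M powi k" for t
  proof -
    have "exp (h t) = (of_real M * cis t) powi k / exp (\<i> * of_int k * of_real t)"
      using eq[of "of_real M * cis t"] M by (simp add: h_def exp_diff norm_mult)
    also have "exp (\<i> * of_int k * of_real t) = cis t powi k"
      unfolding cis_power_int by (simp add: cis_conv_exp mult_ac)
    also have "(of_real M * cis t) powi k / (cis t powi k) = of_real M powi k"
      by (simp add: power_int_mult_distrib)
    finally show ?thesis .
  qed
  have "h constant_on {0..2*pi}"
  proof (rule continuous_discrete_range_constant[OF _ conth])
    show "\<exists>e>0. \<forall>y. y \<in> {0..2*pi} \<and> h y \<noteq> h x \<longrightarrow> e \<le> norm (h y - h x)" if "x \<in> {0..2*pi}" for x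
    proof (intro exI[of _ "2*pi"] conjI allI impI)
      fix y assume y: "y \<in> {0..2*pi} \<and> h y \<noteq> h x"
      have "exp (h y) = exp (h x)" by (simp add: exph)
      then obtain m :: int where m: "h y = h x + of_int (2 * m) * of_real pi * \<i>"
        by (auto simp: exp_eq)
      then have "m \<noteq> 0" using y by auto
      then have "\<bar>real_of_int m\<bar> \<ge> 1" by linarith
      moreover have "norm (h y - h x) = 2 * \<bar>real_of_int m\<bar> * pi"
        using m by (simp add: norm_mult)
      ultimately show "2 * pi \<le> norm (h y - h x)" by simp
    qed simp
  qed simp
  then obtain c where c: "\<And>t. t \<in> {0..2*pi} \<Longrightarrow> h t = c" by (auto simp: constant_on_def)
  have "h 0 = h (2*pi)" using c[of 0] c[of "2*pi"] by simp
  then have "\<i> * of_int k * of_real (2*pi) = 0" by (simp add: h_def)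
  then show ?thesis by simp
qed

text \<open>\<open>H\<close> need not have a limit at a point of \<open>Z\<close>, but nearby its
  values lie in a disc around \<open>A\<close> that misses 0. Discs are convex, so interpolating
  between \<open>A\<close> at the centre and \<open>H\<close> at the rim of a small ball introduces
  no zero and fills the puncture. On \<open>C\<close>, later a large circle, the values are
  kept.\<close>

lemma nonvanishing_extension:
  fixes H :: "complex \<Rightarrow> complex"
  assumes "finite Z" "closed C" "C \<inter> Z = {}"
    and "continuous_on (S - Z) H" "\<And>z. z \<in> S - Z \<Longrightarrow> H z \<noteq> 0"
    and "\<And>z0. z0 \<in> Z \<Longrightarrow> \<exists>A. \<forall>\<^sub>F z in at z0. dist (H z) A < norm A"
  shows "\<exists>G. continuous_on S G \<and> (\<forall>z\<in>S. G z \<noteq> 0) \<and> (\<forall>z\<in>C. G z = H z)"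
  using assms
proof (induction Z arbitrary: H rule: finite_induct)
  case empty
  then show ?case by auto
next
  case (insert z0 Z)
  obtain A where A: "\<forall>\<^sub>F z in at z0. dist (H z) A < norm A" using insert.prems(5) by blast
  \<comment> \<open>The ball to be modified must avoid \<open>C\<close>, where the values are
    prescribed, and the remaining points of \<open>Z\<close>, whose discs have to survive the
    induction.\<close>
  have cl: "closed (C \<union> Z)" using insert.prems(1) insert.hyps(1) by (blast intro: closed_Un finite_imp_closed)
  have "z0 \<notin> C \<union> Z" using insert.prems(2) insert.hyps(2) by auto
  then have "\<forall>\<^sub>F z in nhds z0. z \<in> - (C \<union> Z)" using eventually_nhds_in_open[OF open_Compl[OF cl]] by blast
  then obtain e where e: "e > 0" "\<And>z. dist z z0 < e \<Longrightarrow> z \<notin> C \<union> Z"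
    by (auto simp: eventually_nhds_metric)
  obtain d where d: "d > 0" "\<And>z. z \<noteq> z0 \<Longrightarrow> dist z z0 < d \<Longrightarrow> dist (H z) A < norm A"
    using A by (auto simp: eventually_at)
  define \<delta> where "\<delta> = min d e / 2"
  have \<delta>: "\<delta> > 0" "\<delta> < d" "\<delta> < e" using e d by (auto simp: \<delta>_def)
  define cut where "cut = (\<lambda>z. min 1 (dist z z0 / \<delta>))"
  define H1 where "H1 = (\<lambda>z. A + of_real (cut z) * (H z - A))"
  have cut: "0 \<le> cut z" "cut z \<le> 1" for z using \<delta> by (auto simp: cut_def)
  have out: "H1 z = H z" if "dist z z0 \<ge> \<delta>" for z
    using that \<delta> by (simp add: H1_def cut_def min_absorb1)
  have near: "dist (H z) A < norm A" if "z \<noteq> z0" "dist z z0 < \<delta>" for z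
    using d that \<delta> by auto
  have A0: "A \<noteq> 0"
  proof -
    have "dist (z0 + of_real (\<delta>/2)) z0 < \<delta>" "z0 + of_real (\<delta>/2) \<noteq> z0"
      using \<delta> by (auto simp: dist_norm)
    then show ?thesis using near by fastforce
  qed
  have est: "norm (H1 z - A) \<le> cut z * norm A" if "dist z z0 < \<delta>" for z
  proof (cases "z = z0")
    case True
    then show ?thesis by (simp add: H1_def cut_def)
  next
    case False
    have "norm (H1 z - A) = cut z * dist (H z) A"
      using cut by (simp add: H1_def norm_mult dist_norm)
    also have "\<dots> \<le> cut z * norm A"
      using near[OF False that] cut by (intro mult_left_mono) auto
    finally show ?thesis .
  qed
  have contcut: "continuous_on T cut" for T
    unfolding cut_def using \<delta> by (intro continuous_intros) auto
  have contH1: "continuous_on (S - insert z0 Z) H1"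
    unfolding H1_def using insert.prems(3) contcut by (intro continuous_intros) auto
  have "continuous_on (S - Z) H1"
    unfolding continuous_on_eq_continuous_within
  proof
    fix x assume x: "x \<in> S - Z"
    show "continuous (at x within S - Z) H1"
    proof (cases "x = z0")
      case False
      have "at x within (S - Z) = at x within (S - insert z0 Z)"
        using False by (intro at_within_nhd[of _ "- {z0}"]) auto
      then show ?thesis using contH1 x False
        by (auto simp: continuous_on_eq_continuous_within continuous_within)
    next
      case True
      have "((\<lambda>z. cut z * norm A) \<longlongrightarrow> cut z0 * norm A) (at z0 within S - Z)"
        using contcut[of UNIV] by (intro tendsto_intros)
          (auto simp: continuous_on_def intro: tendsto_within_subset)
      then have "((\<lambda>z. cut z * norm A) \<longlongrightarrow> 0) (at z0 within S - Z)"
        using \<delta> by (simp add: cut_def)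
      moreover have "\<forall>\<^sub>F z in at z0 within S - Z. norm (H1 z - A) \<le> cut z * norm A"
        using est \<delta> unfolding eventually_at by (intro exI[of _ \<delta>]) auto
      ultimately have "((\<lambda>z. H1 z - A) \<longlongrightarrow> 0) (at z0 within S - Z)"
        by (rule Lim_null_comparison[rotated])
      then have "(H1 \<longlongrightarrow> A) (at z0 within S - Z)"
        by (simp add: LIM_zero_iff)
      moreover have "H1 z0 = A" by (simp add: H1_def cut_def)
      ultimately show ?thesis using True by (simp add: continuous_within)
    qed
  qed
  moreover have "H1 z \<noteq> 0" if "z \<in> S - Z" for z
  proof (cases "dist z z0 < \<delta>")
    case False
    then have "z \<noteq> z0" using \<delta> by auto
    then show ?thesis using insert.prems(4)[of z] that out[of z] False by auto
  next
    case True
    have "cut z < 1" using True \<delta> by (simp add: cut_def min_def field_simps)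
    then have "cut z * norm A < norm A" using A0 by simp
    then have "norm (H1 z - A) < norm A" using est[OF True] by linarith
    then show ?thesis by auto
  qed
  moreover have "\<exists>B. \<forall>\<^sub>F z in at z1. dist (H1 z) B < norm B" if z1: "z1 \<in> Z" for z1
  proof -
    obtain B where B: "\<forall>\<^sub>F z in at z1. dist (H z) B < norm B" using insert.prems(5) z1 by blast
    have "dist z1 z0 > \<delta>" using e(2)[of z1] z1 \<delta> by force
    moreover have "open {z. dist z z0 > \<delta>}" by (intro open_Collect_less continuous_intros)
    ultimately have "\<forall>\<^sub>F z in at z1. dist z z0 > \<delta>"
      using eventually_at_in_open'[of "{z. dist z z0 > \<delta>}" z1] by auto
    then have "\<forall>\<^sub>F z in at z1. dist (H1 z) B < norm B"
      using B by eventually_elim (use out in auto)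
    then show ?thesis by blast
  qed
  ultimately obtain G where G: "continuous_on S G" "\<forall>z\<in>S. G z \<noteq> 0" "\<forall>z\<in>C. G z = H1 z"
    using insert.IH[of H1] insert.prems(1,2) by auto
  have "\<forall>z\<in>C. H1 z = H z"
  proof
    fix z assume "z \<in> C"
    then have "dist z z0 \<ge> e" using e(2)[of z] by force
    then show "H1 z = H z" using out \<delta> by auto
  qed
  then show ?case using G by auto
qed

section \<open>Reversed polynomials and behaviour at infinity\<close>

definition rev_poly :: "nat \<Rightarrow> complex poly \<Rightarrow> complex poly" where
  "rev_poly n u = monom 1 (n - degree u) * reflect_poly u"

text \<open>\<open>reflect_poly\<close> reverses at the actual degree; the monomial raises this to
  the formal degree \<open>n\<close>, so that numerator and denominator of a map can be reversed
  with the same power of \<open>w\<close>.\<close>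

lemma poly_rev_poly:
  assumes "degree u \<le> n" "w \<noteq> 0"
  shows "poly (rev_poly n u) w = w ^ n * poly u (inverse w)"
proof -
  have "poly (rev_poly n u) w = w ^ (n - degree u) * (w ^ degree u * poly u (inverse w))"
    using assms by (simp add: rev_poly_def poly_monom poly_reflect_poly_nz)
  also have "\<dots> = w ^ (n - degree u + degree u) * poly u (inverse w)"
    by (simp only: power_add mult.assoc)
  finally show ?thesis using assms by simp
qed

lemma poly_rev_poly_0:
  assumes "degree u \<le> n"
  shows "poly (rev_poly n u) 0 = coeff u n"
  using assms by (cases "degree u = n") (auto simp: rev_poly_def poly_monom coeff_eq_0 zero_power)

lemma poly_over_power_tendsto:
  fixes u :: "complex poly"
  assumes "degree u \<le> n"
  shows "((\<lambda>z. poly u z / z ^ n) \<longlongrightarrow> coeff u n) at_infinity"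
proof -
  have "((\<lambda>z. poly (rev_poly n u) (inverse z)) \<longlongrightarrow> poly (rev_poly n u) 0) at_infinity"
    by (intro tendsto_intros tendsto_inverse_0)
  moreover have "\<forall>\<^sub>F z in at_infinity. poly (rev_poly n u) (inverse z) = poly u z / z ^ n"
    using eventually_not_equal_at_infinity[of 0]
  proof eventually_elim
    case (elim z)
    then show ?case using poly_rev_poly[OF assms, of "inverse z"]
      by (simp add: field_simps)
  qed
  ultimately show ?thesis
    by (simp add: poly_rev_poly_0[OF assms] tendsto_cong)
qed

lemma rat_fun_tendsto_infinity:
  assumes "degree p \<le> degree q" "q \<noteq> 0"
  shows "(rat_fun p q \<longlongrightarrow> coeff p (degree q) / lead_coeff q) at_infinity"
proof -
  have "((\<lambda>z. (poly p z / z ^ degree q) / (poly q z / z ^ degree q))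
          \<longlongrightarrow> coeff p (degree q) / lead_coeff q) at_infinity"
    using assms by (intro tendsto_intros poly_over_power_tendsto) auto
  moreover have "\<forall>\<^sub>F z in at_infinity. (poly p z / z ^ degree q) / (poly q z / z ^ degree q) = rat_fun p q z"
    using eventually_not_equal_at_infinity[of 0]
    by eventually_elim (simp add: rat_fun_def)
  ultimately show ?thesis by (simp add: tendsto_cong)
qed

section \<open>Isolation, boundedness and finiteness of the zeros\<close>

lemma rat_fun_difference_quotient:
  assumes "poly q a \<noteq> 0"
  shows "((\<lambda>z. (rat_fun p q z - rat_fun p q a) / (z - a)) \<longlongrightarrow> rat_deriv p q a) (at a)"
  using rat_fun_has_field_derivative[OF assms, of p UNIV] by (simp add: has_field_derivative_iff)

lemma eventually_poly_nonzero:
  fixes q :: "complex poly"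
  assumes "poly q a \<noteq> 0"
  shows "\<forall>\<^sub>F z in at a. poly q z \<noteq> 0"
  using open_poly_nonzero[of q] assms by (intro eventually_at_in_open'[of "{z. poly q z \<noteq> 0}", simplified]) auto

text \<open>Conjugation is an isometry, so between two zeros the difference quotient of the map has
  modulus exactly 1. Near a regular zero it is close to the derivative there, whose modulus is
  different.\<close>

lemma cnj_fixed_isolated:
  assumes a: "a \<in> cnj_fixed p q" and reg: "norm (rat_deriv p q a) \<noteq> 1"
  shows "\<forall>\<^sub>F z in at a. z \<notin> cnj_fixed p q"
proof -
  have q: "poly q a \<noteq> 0" and ra: "rat_fun p q a = cnj a" using a by (auto simp: cnj_fixed_def)
  have "((\<lambda>z. norm ((rat_fun p q z - rat_fun p q a) / (z - a))) \<longlongrightarrow> norm (rat_deriv p q a)) (at a)"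
    by (intro tendsto_norm rat_fun_difference_quotient q)
  then have "\<forall>\<^sub>F z in at a. norm ((rat_fun p q z - rat_fun p q a) / (z - a)) \<noteq> 1"
    using reg by (rule tendsto_imp_eventually_ne)
  moreover have "\<forall>\<^sub>F z in at a. z \<noteq> a" by (rule eventually_neq_at_within)
  ultimately show ?thesis
  proof eventually_elim
    case (elim z)
    then show ?case using ra
      by (auto simp: cnj_fixed_def norm_divide simp flip: complex_cnj_diff)
  qed
qed

text \<open>Clearing the denominator gives an equation that is continuous on the whole plane, whence
  the set is closed. At a root of \<open>q\<close> this equation would force a common root.\<close>

lemma cnj_fixed_eq_zeros:
  assumes "no_common_root p q"
  shows "cnj_fixed p q = {z. poly p z - poly q z * cnj z = 0}"
  using assms by (force simp: cnj_fixed_def rat_fun_def no_common_root_def field_simps)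

lemma cnj_fixed_bounded:
  assumes "degree p \<le> degree q" "q \<noteq> 0"
  shows "bounded (cnj_fixed p q)"
proof -
  let ?L = "coeff p (degree q) / lead_coeff q"
  have "\<forall>\<^sub>F z in at_infinity. dist (rat_fun p q z) ?L < 1"
    using rat_fun_tendsto_infinity[OF assms] by (rule tendstoD) simp
  then obtain B where B: "\<And>z. norm z \<ge> B \<Longrightarrow> dist (rat_fun p q z) ?L < 1"
    by (auto simp: eventually_at_infinity)
  show ?thesis
  proof (rule boundedI[of _ "max B (norm ?L + 1)"])
    fix z assume z: "z \<in> cnj_fixed p q"
    show "norm z \<le> max B (norm ?L + 1)"
    proof (rule ccontr)
      assume n: "\<not> ?thesis"
      then have "dist (cnj z) ?L < 1" using B[of z] z by (auto simp: cnj_fixed_def)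
      then have "norm z < norm ?L + 1"
        using norm_triangle_sub[of "cnj z" ?L] by (simp add: dist_norm)
      then show False using n by simp
    qed
  qed
qed

lemma cnj_fixed_finite:
  assumes "no_common_root p q" "degree p \<le> degree q" "q \<noteq> 0"
    and "\<And>a. a \<in> cnj_fixed p q \<Longrightarrow> norm (rat_deriv p q a) \<noteq> 1"
  shows "finite (cnj_fixed p q)"
proof (rule ccontr)
  assume inf: "infinite (cnj_fixed p q)"
  have "closed (cnj_fixed p q)"
    unfolding cnj_fixed_eq_zeros[OF assms(1)] by (intro closed_Collect_eq continuous_intros)
  then have "compact (cnj_fixed p q)"
    using cnj_fixed_bounded[OF assms(2,3)] by (simp add: compact_eq_bounded_closed)
  then obtain a where a: "a \<in> cnj_fixed p q" "a islimpt cnj_fixed p q"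
    using inf by (meson compact_eq_Bolzano_Weierstrass order_refl)
  then show False using cnj_fixed_isolated[OF a(1) assms(4)[OF a(1)]]
    by (simp add: islimpt_iff_eventually)
qed

text \<open>Here \<open>e\<close> is the dominant term and \<open>c\<close> bounds the remainder. At
  a repelling zero the holomorphic term dominates, at an attracting zero the conjugate one; the two
  applications exchange the roles.\<close>

lemma eventually_dist_lt_norm:
  fixes c e :: "complex \<Rightarrow> complex"
  assumes "(c \<longlongrightarrow> c0) F" "(e \<longlongrightarrow> A) F" "norm c0 < norm A" "\<forall>\<^sub>F z in F. norm (H z - e z) \<le> norm (c z)"
  shows "\<forall>\<^sub>F z in F. dist (H z) A < norm A"
proof -
  have "((\<lambda>z. norm (c z) + norm (e z - A)) \<longlongrightarrow> norm c0 + norm (A - A)) F"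
    by (intro tendsto_intros assms)
  then have "\<forall>\<^sub>F z in F. norm (c z) + norm (e z - A) < norm A"
    using assms(3) by (intro order_tendstoD) auto
  with assms(4) show ?thesis
  proof eventually_elim
    case (elim z)
    then show ?case using norm_triangle_ineq[of "H z - e z" "e z - A"] by (simp add: dist_norm)
  qed
qed

text \<open>Dividing \<open>poly p z - poly q z * cnj z\<close> by \<open>z - a\<close> at each repelling and by \<open>cnj (z - a)\<close> at each
  attracting zero \<open>a\<close> leaves a function whose values near each \<open>a\<close> lie in a disc avoiding \<open>0\<close>. It extends to a
  nonvanishing function and thus has a logarithm; comparing with its growth at infinity yields the formula.\<close>

theorem cnj_fixed_index:
  assumes ncr: "no_common_root p q" and deg: "degree p \<le> degree q" and q0: "q \<noteq> 0"
    and reg: "\<And>a. a \<in> cnj_fixed p q \<Longrightarrow> norm (rat_deriv p q a) \<noteq> 1"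
  shows "int (card {a \<in> cnj_fixed p q. norm (rat_deriv p q a) > 1})
       = int (card {a \<in> cnj_fixed p q. norm (rat_deriv p q a) < 1}) + int (degree q) - 1"
proof -
  define Z where "Z = cnj_fixed p q"
  define P where "P = {a \<in> Z. norm (rat_deriv p q a) > 1}"
  define N where "N = {a \<in> Z. norm (rat_deriv p q a) < 1}"
  define n where "n = degree q"
  have fin: "finite Z" unfolding Z_def using cnj_fixed_finite[OF ncr deg q0 reg] .
  have finP: "finite P" and finN: "finite N" using fin by (auto simp: P_def N_def)
  have ZPN: "Z = P \<union> N" using reg by (force simp: P_def N_def Z_def)
  have disj: "P \<inter> N = {}" by (auto simp: P_def N_def)
  define F where "F = (\<lambda>z. poly p z - poly q z * cnj z)"
  have Z_eq: "Z = {z. F z = 0}" using cnj_fixed_eq_zeros[OF ncr] by (simp add: Z_def F_def)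
  have F_eq: "F z = poly q z * (rat_fun p q z - cnj z)" if "poly q z \<noteq> 0" for z
    using that by (simp add: F_def rat_fun_def field_simps)
  define H where "H = (\<lambda>z. F z / ((\<Prod>a\<in>P. z - a) * (\<Prod>a\<in>N. cnj (z - a))))"
  have contH: "continuous_on (- Z) H"
    unfolding H_def F_def using finP finN ZPN by (intro continuous_intros) auto
  have Hnz: "H z \<noteq> 0" if "z \<notin> Z" for z
    using that ZPN finP finN by (auto simp: H_def Z_eq)
  have local: "\<exists>A. \<forall>\<^sub>F z in at b. dist (H z) A < norm A" if b: "b \<in> Z" for b
  proof -
    have qb: "poly q b \<noteq> 0" and rb: "rat_fun p q b = cnj b" using b by (auto simp: Z_def cnj_fixed_def)
    define D where "D = (\<lambda>z. (rat_fun p q z - rat_fun p q b) / (z - b))"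
    have D: "(D \<longlongrightarrow> rat_deriv p q b) (at b)"
      unfolding D_def by (rule rat_fun_difference_quotient[OF qb])
    have Fb: "\<forall>\<^sub>F z in at b. z \<noteq> b \<and> F z = poly q z * (D z * (z - b) - cnj (z - b))"
      using eventually_poly_nonzero[OF qb] eventually_neq_at_within[of b b]
    proof eventually_elim
      case (elim z)
      then show ?case by (simp add: F_eq D_def rb)
    qed
    \<comment> \<open>The factors that do not vanish at \<open>b\<close>. Up to them,
      \<open>H\<close> is \<open>D z * (z - b) - cnj (z - b)\<close> divided by \<open>z - b\<close>
      or by its conjugate; the quotient of \<open>z - b\<close> and its conjugate oscillates but has
      modulus 1.\<close>
    define c where "c = (\<lambda>z. poly q z / ((\<Prod>a\<in>P - {b}. z - a) * (\<Prod>a\<in>N - {b}. cnj (z - a))))"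
    have nz: "(\<Prod>a\<in>P - {b}. b - a) * (\<Prod>a\<in>N - {b}. cnj (b - a)) \<noteq> 0"
      using finP finN by simp
    then have c: "(c \<longlongrightarrow> c b) (at b)"
      unfolding c_def by (intro tendsto_intros)
    have cb: "c b \<noteq> 0" unfolding c_def using nz qb by simp
    show ?thesis
    proof (cases "b \<in> P")
      case True
      then have NB: "N - {b} = N" using disj by auto
      have prodP: "(\<Prod>a\<in>P. z - a) = (z - b) * (\<Prod>a\<in>P - {b}. z - a)" for z
        using finP True by (simp add: prod.remove)
      have "\<forall>\<^sub>F z in at b. norm (H z - c z * D z) \<le> norm (c z)"
        using Fb
      proof eventually_elim
        case (elim z)
        have "H z = c z * (D z * (z - b) - cnj (z - b)) / (z - b)"
          using elim by (simp add: H_def c_def prodP NB)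
        also have "\<dots> = c z * D z - c z * (cnj (z - b) / (z - b))"
          using elim by (simp add: field_simps)
        finally have "norm (H z - c z * D z) = norm (c z * (cnj (z - b) / (z - b)))" by simp
        also have "\<dots> = norm (c z)" using elim by (simp add: norm_mult norm_divide del: complex_cnj_diff)
        finally show ?case by simp
      qed
      moreover have "norm (c b) < norm (c b * rat_deriv p q b)"
        using True cb by (simp add: norm_mult P_def)
      ultimately show ?thesis
        using eventually_dist_lt_norm[OF c tendsto_mult[OF c D]] by blast
    next
      case False
      then have bN: "b \<in> N" using b ZPN by auto
      have PB: "P - {b} = P" using False by auto
      have prodN: "(\<Prod>a\<in>N. cnj (z - a)) = cnj (z - b) * (\<Prod>a\<in>N - {b}. cnj (z - a))" for z
        using finN bN by (simp add: prod.remove)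
      have "\<forall>\<^sub>F z in at b. norm (H z - (- c z)) \<le> norm (c z * D z)"
        using Fb
      proof eventually_elim
        case (elim z)
        have "H z = c z * (D z * (z - b) - cnj (z - b)) / cnj (z - b)"
          using elim by (simp add: H_def c_def prodN PB del: complex_cnj_diff)
        also have "\<dots> = c z * D z * ((z - b) / cnj (z - b)) - c z"
          using elim by (simp add: field_simps)
        finally have "norm (H z - (- c z)) = norm (c z * D z * ((z - b) / cnj (z - b)))" by simp
        also have "\<dots> = norm (c z * D z)"
          using elim by (simp add: norm_mult norm_divide del: complex_cnj_diff)
        finally show ?case by simp
      qed
      moreover have "norm (c b * rat_deriv p q b) < norm (- c b)"
        using bN cb by (simp add: norm_mult N_def)
      ultimately show ?thesis
        using eventually_dist_lt_norm[OF tendsto_mult[OF c D] tendsto_minus[OF c]] by blast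
    qed
  qed
  define l where "l = lead_coeff q"
  have l0: "l \<noteq> 0" using q0 by (simp add: l_def)
  \<comment> \<open>\<open>H\<close> divided by its growth
    \<open>z ^ n * cnj z / (z ^ card P * cnj z ^ card N)\<close>. It tends to \<open>- l\<close>, so
    on a large circle \<open>E z / (- l)\<close> stays in \<open>ball 1 1\<close>, where the
    principal logarithm is continuous.\<close>
  define E where "E = (\<lambda>z. - (poly q z / z ^ n) * (1 - rat_fun p q z * cnj (inverse z))
                     / ((\<Prod>a\<in>P. 1 - a * inverse z) * (\<Prod>a\<in>N. cnj (1 - a * inverse z))))"
  have "(E \<longlongrightarrow> - l * (1 - coeff p n / lead_coeff q * cnj 0)
                     / ((\<Prod>a\<in>P. 1 - a * 0) * (\<Prod>a\<in>N. cnj (1 - a * 0)))) at_infinity"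
    unfolding E_def l_def n_def
    by (intro tendsto_intros poly_over_power_tendsto rat_fun_tendsto_infinity deg q0 tendsto_inverse_0) auto
  then have "(E \<longlongrightarrow> - l) at_infinity" by simp
  then have "\<forall>\<^sub>F z in at_infinity. dist (E z) (- l) < norm l"
    using l0 by (intro tendstoD) auto
  then obtain B where B: "\<And>z. norm z \<ge> B \<Longrightarrow> dist (E z) (- l) < norm l"
    by (auto simp: eventually_at_infinity)
  have "bounded (Z \<union> {z. poly q z = 0})"
    using fin poly_roots_finite[OF q0] by (simp add: finite_imp_bounded)
  then obtain B' where B': "B' > 0" "\<And>z. z \<in> Z \<union> {z. poly q z = 0} \<Longrightarrow> norm z \<le> B'"
    by (auto simp: bounded_pos)
  define M where "M = max B B' + 1"
  have M: "M > 0" "M \<ge> B" "M > B'" using B' by (auto simp: M_def)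
  have MZ: "z \<notin> Z" "poly q z \<noteq> 0" if "norm z \<ge> M" for z
    using that B'(2)[of z] M by auto
  obtain G where G: "continuous_on (cball 0 M) G" "\<And>z. z \<in> cball 0 M \<Longrightarrow> G z \<noteq> 0"
    "\<And>z. z \<in> sphere 0 M \<Longrightarrow> G z = H z"
    using nonvanishing_extension[OF fin closed_sphere[of 0 M], of "cball 0 M" H] MZ(1) Hnz local
      continuous_on_subset[OF contH, of "cball 0 M - Z"] by fastforce
  obtain g where g: "continuous_on (cball 0 M) g" "\<And>z. z \<in> cball 0 M \<Longrightarrow> G z = exp (g z)"
    using continuous_logarithm_on_cball[OF G(1,2)] by blast
  have Eball: "E z / (- l) \<in> ball 1 1" if "z \<in> sphere 0 M" for z
  proof -
    have "dist (E z) (- l) < norm l" using B[of z] that M by auto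
    then have "norm (E z + l) / norm l < 1" using l0 by (simp add: dist_norm)
    moreover have "1 - E z / (- l) = (E z + l) / l" using l0 by (simp add: field_simps)
    ultimately show ?thesis by (simp only: mem_ball dist_norm norm_divide)
  qed
  have Enonpos: "E z / (- l) \<notin> \<real>\<^sub>\<le>\<^sub>0" if "z \<in> sphere 0 M" for z
  proof
    assume "E z / (- l) \<in> \<real>\<^sub>\<le>\<^sub>0"
    then have "Re (E z / (- l)) \<le> 0" by (simp only: complex_nonpos_Reals_iff)
    moreover have "\<bar>Re (1 - E z / (- l))\<bar> < 1"
      using Eball[OF that] abs_Re_le_cmod[of "1 - E z / (- l)"] by (simp add: dist_norm)
    ultimately show False by simp
  qed
  have P1: "(\<Prod>a\<in>P. z - a) = z ^ card P * (\<Prod>a\<in>P. 1 - a * inverse z)" if "z \<noteq> 0" for z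
  proof -
    have "(\<Prod>a\<in>P. z - a) = (\<Prod>a\<in>P. z * (1 - a * inverse z))"
      using that by (intro prod.cong) (auto simp: field_simps)
    then show ?thesis by (simp add: prod.distrib)
  qed
  have N1: "(\<Prod>a\<in>N. cnj (z - a)) = cnj z ^ card N * (\<Prod>a\<in>N. cnj (1 - a * inverse z))" if "z \<noteq> 0" for z
  proof -
    have "(\<Prod>a\<in>N. cnj (z - a)) = (\<Prod>a\<in>N. cnj (z * (1 - a * inverse z)))"
      using that by (intro prod.cong) (auto simp: field_simps)
    then show ?thesis by (simp add: prod.distrib)
  qed
  have Hform: "H z = z ^ n * cnj z / (z ^ card P * cnj z ^ card N) * E z" if "z \<in> sphere 0 M" for z
  proof -
    have z: "z \<noteq> 0" "poly q z \<noteq> 0" using that M MZ(2)[of z] by auto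
    have "F z = z ^ n * cnj z * (- (poly q z / z ^ n) * (1 - rat_fun p q z * cnj (inverse z)))"
      using z by (simp add: F_eq field_simps)
    moreover have "m * e / ((a * x) * (b * y)) = m / (a * b) * (e / (x * y))" for m e a b x y :: complex
      by (simp add: mult_ac)
    ultimately show ?thesis
      unfolding H_def P1[OF z(1)] N1[OF z(1)] E_def by metis
  qed
  \<comment> \<open>On the circle \<open>cnj z\<close> equals \<open>C / z\<close>, so conjugate
    factors count with the opposite sign. \<open>k\<close> is the resulting total exponent of
    \<open>z\<close>, and \<open>k = 0\<close> is the index formula.\<close>
  define k where "k = int n - int (card P) - 1 + int (card N)"
  define C where "C = complex_of_real (M\<^sup>2)"
  have C0: "C \<noteq> 0" using M by (simp add: C_def)
  have zk: "z powi k = exp (g z - Ln (E z / (- l)) - Ln (- l) - Ln (C powi (1 - int (card N))))"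
    if z: "z \<in> sphere 0 M" for z
  proof -
    have z0: "z \<noteq> 0" using z M by auto
    have E0: "E z \<noteq> 0" using Enonpos[OF z] by auto
    have "z * cnj z = C" using z complex_norm_square[of z] by (simp add: C_def)
    then have cz: "cnj z = C / z" using z0 by (simp add: field_simps)
    have "z ^ n * cnj z / (z ^ card P * cnj z ^ card N)
        = z powi (int n) * (cnj z powi 1) / (z powi int (card P) * cnj z powi int (card N))" by simp
    also have "\<dots> = z powi (int n - int (card P)) * cnj z powi (1 - int (card N))"
      using z0 by (simp add: power_int_diff)
    also have "\<dots> = z powi (int n - int (card P)) * C powi (1 - int (card N)) / z powi (1 - int (card N))"
      unfolding cz by (simp add: power_int_divide_distrib)
    also have "\<dots> = z powi ((int n - int (card P)) - (1 - int (card N))) * C powi (1 - int (card N))"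
      using z0 by (subst power_int_diff) auto
    also have "(int n - int (card P)) - (1 - int (card N)) = k" by (simp add: k_def)
    finally have "H z = z powi k * C powi (1 - int (card N)) * E z"
      using Hform[OF z] by simp
    then have "exp (g z) = z powi k * C powi (1 - int (card N)) * E z"
      using g(2)[of z] G(3)[OF z] z by auto
    moreover have "exp (g z - Ln (E z / (- l)) - Ln (- l) - Ln (C powi (1 - int (card N))))
       = exp (g z) / (E z / (- l)) / (- l) / C powi (1 - int (card N))"
      using E0 l0 C0 by (simp add: exp_diff exp_Ln)
    ultimately show ?thesis using E0 l0 C0 by (simp add: field_simps)
  qed
  have contE: "continuous_on (sphere 0 M) E"
  proof -
    have E_eq: "H z / (z ^ n * cnj z / (z ^ card P * cnj z ^ card N)) = E z" if "z \<in> sphere 0 M" for z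
      using Hform[OF that] that M by auto
    have "continuous_on (sphere 0 M) (\<lambda>z. H z / (z ^ n * cnj z / (z ^ card P * cnj z ^ card N)))"
      using MZ M by (intro continuous_intros continuous_on_subset[OF contH]) auto
    then show ?thesis using E_eq by (rule continuous_on_eq)
  qed
  have "k = 0"
  proof (rule powi_log_on_circle_imp_0[OF M(1) _ zk])
    show "continuous_on (sphere 0 M) (\<lambda>z. g z - Ln (E z / (- l)) - Ln (- l) - Ln (C powi (1 - int (card N))))"
      using Enonpos l0
      by (intro continuous_intros contE continuous_on_subset[OF g(1)] continuous_on_Ln) auto
  qed
  then show ?thesis by (simp add: k_def P_def N_def Z_def n_def)
qed

subsection \<open>Critical points in attracting basins\<close>

text \<open>Locally \<open>u\<close> is a holomorphic inverse of \<phi> applied to the holomorphic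
  function \<phi>(u z). This upgrades lifts through a covering, which are a priori only
  continuous.\<close>

lemma holomorphic_lift:
  assumes "open S" "\<phi> holomorphic_on S" "\<And>z. z \<in> S \<Longrightarrow> deriv \<phi> z \<noteq> 0"
    and "open D" "continuous_on D u" "u ` D \<subseteq> S" "(\<lambda>z. \<phi> (u z)) holomorphic_on D"
  shows "u holomorphic_on D"
proof (subst holomorphic_on_open[OF \<open>open D\<close>], intro ballI)
  fix z0 assume z0: "z0 \<in> D"
  then have uz0: "u z0 \<in> S" using assms by auto
  obtain r where r: "r > 0" "ball (u z0) r \<subseteq> S" "open (\<phi> ` ball (u z0) r)" "inj_on \<phi> (ball (u z0) r)"
    using has_complex_derivative_locally_invertible[OF assms(2) uz0 assms(1) assms(3)[OF uz0]] by metis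
  obtain g where g: "g holomorphic_on (\<phi> ` ball (u z0) r)" "\<And>z. z \<in> ball (u z0) r \<Longrightarrow> g (\<phi> z) = z"
    using holomorphic_has_inverse[OF holomorphic_on_subset[OF assms(2) r(2)] open_ball r(4)] by metis
  define D' where "D' = D \<inter> u -` ball (u z0) r"
  have D': "open D'" "z0 \<in> D'" "D' \<subseteq> D"
    unfolding D'_def using assms z0 r by (auto intro: continuous_open_preimage)
  have "(g \<circ> (\<lambda>z. \<phi> (u z))) holomorphic_on D'"
    using g(1) by (intro holomorphic_on_compose holomorphic_on_subset[OF assms(7) D'(3)])
      (auto simp: D'_def elim!: holomorphic_on_subset)
  then have "u holomorphic_on D'"
    by (rule holomorphic_transform) (auto simp: D'_def g(2))
  then show "\<exists>f'. (u has_field_derivative f') (at z0)"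
    using D' holomorphic_on_open by blast
qed

text \<open>A quantitative substitute for normality. As \<open>h\<close> stays away from
  \<open>b\<close>, the function 1 / (h - b) is bounded and the Schwarz lemma controls its
  increments. The bound depends on \<open>h\<close> only through \<open>h a\<close>, so it is
  uniform over all inverse branches that fix \<open>a\<close>.\<close>

lemma holomorphic_omitting_disc_bound:
  assumes "\<rho> > 0" "h holomorphic_on ball a \<rho>" "\<sigma> > 0" "\<And>z. z \<in> ball a \<rho> \<Longrightarrow> norm (h z - b) \<ge> \<sigma>"
    and "dist z a < \<rho>" "6 * norm (h a - b) * dist z a \<le> \<sigma> * \<rho>"
  shows "norm (h z - h a) \<le> 6 * (norm (h a - b))\<^sup>2 / (\<sigma> * \<rho>) * dist z a"
proof -
  define G where "G = (\<lambda>z. 1 / (h z - b))"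
  have hb: "h z \<noteq> b" if "z \<in> ball a \<rho>" for z using assms(4)[OF that] \<open>\<sigma> > 0\<close> by auto
  have Gb: "norm (G z) \<le> 1 / \<sigma>" if "z \<in> ball a \<rho>" for z
    using assms(4)[OF that] \<open>\<sigma> > 0\<close> by (simp add: G_def norm_divide frac_le)
  \<comment> \<open>Two values of \<open>G\<close> differ by at most \<open>2 / \<sigma>\<close>, so
    the factor \<open>\<sigma> / 3\<close> brings the norm strictly below 1.\<close>
  define f where "f = (\<lambda>w. (G (a + of_real \<rho> * w) - G a) * of_real (\<sigma> / 3))"
  have in_ball: "a + of_real \<rho> * w \<in> ball a \<rho>" if "norm w < 1" for w
    using that \<open>\<rho> > 0\<close> by (simp add: dist_norm norm_mult)
  have aa: "a \<in> ball a \<rho>" using \<open>\<rho> > 0\<close> by simp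
  have "norm (f w) \<le> norm w" if w: "norm w < 1" for w
  proof (rule Schwarz_Lemma(1)[OF _ _ _ w])
    have "G holomorphic_on ball a \<rho>"
      unfolding G_def using hb by (intro holomorphic_intros assms(2)) auto
    then have "(G \<circ> (\<lambda>w. a + of_real \<rho> * w)) holomorphic_on ball 0 1"
      using in_ball by (intro holomorphic_on_compose holomorphic_intros) (auto elim!: holomorphic_on_subset)
    then show "f holomorphic_on ball 0 1"
      unfolding f_def o_def by (intro holomorphic_intros)
    show "f 0 = 0" by (simp add: f_def)
    show "norm (f w) < 1" if "norm w < 1" for w
    proof -
      have "norm (G (a + of_real \<rho> * w) - G a) \<le> 1 / \<sigma> + 1 / \<sigma>"
        using norm_triangle_ineq4[of "G (a + of_real \<rho> * w)" "G a"] Gb[OF in_ball[OF that]] Gb[OF aa] by linarith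
      then have "norm (f w) \<le> (1 / \<sigma> + 1 / \<sigma>) * (\<sigma> / 3)"
        using \<open>\<sigma> > 0\<close> unfolding f_def norm_mult by (intro mult_mono) auto
      then show ?thesis using \<open>\<sigma> > 0\<close> by (simp add: field_simps)
    qed
  qed
  moreover define w where "w = (z - a) / of_real \<rho>"
  moreover have nw: "norm w = dist z a / \<rho>" using \<open>\<rho> > 0\<close> by (simp add: w_def norm_divide dist_norm)
  moreover have "norm w < 1" using assms(1,5) nw by simp
  moreover have aw: "a + of_real \<rho> * w = z" using \<open>\<rho> > 0\<close> by (simp add: w_def)
  ultimately have "norm (G z - G a) * (\<sigma> / 3) \<le> dist z a / \<rho>"
    using \<open>\<sigma> > 0\<close> by (fastforce simp: f_def norm_mult)
  then have GG: "norm (G z - G a) \<le> 3 * dist z a / (\<sigma> * \<rho>)"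
    using \<open>\<sigma> > 0\<close> \<open>\<rho> > 0\<close> by (simp add: field_simps)
  define t c s where "t = norm (h z - h a)" and "c = norm (h a - b)" and "s = 3 * dist z a / (\<sigma> * \<rho>)"
  have zb: "z \<in> ball a \<rho>" using assms(5) by (simp add: dist_commute)
  have "- (1 / x - 1 / y) * x * y = x - y" if "x \<noteq> 0" "y \<noteq> 0" for x y :: complex
    using that by (simp add: field_simps)
  from this[of "h z - b" "h a - b"] have "h z - h a = - (G z - G a) * (h z - b) * (h a - b)"
    using hb[OF zb] hb[OF aa] by (simp add: G_def)
  then have "t = norm (G z - G a) * norm (h z - b) * c"
    by (simp add: t_def c_def norm_mult norm_minus_commute)
  also have "\<dots> \<le> s * (t + c) * c"
    using GG norm_triangle_ineq[of "h z - h a" "h a - b"]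
    using \<open>\<sigma> > 0\<close> \<open>\<rho> > 0\<close> by (intro mult_right_mono mult_mono) (auto simp: s_def t_def c_def)
  finally have 1: "t \<le> s * c * t + s * c\<^sup>2" by (simp add: algebra_simps power2_eq_square)
  \<comment> \<open>Undoing the inversion produced \<open>t\<close> on the right as well; the
    smallness of \<open>dist z a\<close> makes its coefficient at most 1/2, so it can be
    absorbed.\<close>
  have "s * c \<le> 1/2"
    using assms(6) \<open>\<sigma> > 0\<close> \<open>\<rho> > 0\<close> by (simp add: s_def c_def field_simps)
  then have "s * c * t \<le> 1/2 * t" by (intro mult_right_mono) (auto simp: t_def)
  then have "t \<le> 2 * (s * c\<^sup>2)" using 1 by linarith
  also have "\<dots> = 6 * c\<^sup>2 / (\<sigma> * \<rho>) * dist z a" by (simp add: s_def)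
  finally show ?thesis by (simp add: t_def c_def)
qed

section \<open>Attracting basins\<close>

definition refl_map :: "complex poly \<Rightarrow> complex poly \<Rightarrow> complex \<Rightarrow> complex" where
  "refl_map p q z = cnj (rat_fun p q z)"

text \<open>The pole condition is imposed at every step, because \<open>refl_map\<close> would
  continue an orbit through a pole with the junk value 0.\<close>

primrec basin_approx :: "complex poly \<Rightarrow> complex poly \<Rightarrow> complex set \<Rightarrow> nat \<Rightarrow> complex set" where
  "basin_approx p q D 0 = D"
| "basin_approx p q D (Suc k) = {z. poly q z \<noteq> 0 \<and> refl_map p q z \<in> basin_approx p q D k}"

locale attractor =
  fixes p q :: "complex poly" and a :: complex and \<rho> \<kappa> :: real
  assumes \<rho>: "\<rho> > 0" and \<kappa>: "0 < \<kappa>" "\<kappa> < 1"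
    and disc_nonpole: "\<And>z. dist z a < \<rho> \<Longrightarrow> poly q z \<noteq> 0"
    and disc_contract: "\<And>z. dist z a < \<rho> \<Longrightarrow> dist (refl_map p q z) a \<le> \<kappa> * dist z a"
begin

abbreviation "R \<equiv> refl_map p q"
definition "basin = (\<Union>k. basin_approx p q (ball a \<rho>) k)"

lemma R_fixed: "R a = a"
  using disc_contract[of a] \<rho> by simp

lemma R_disc: "dist z a < \<rho> \<Longrightarrow> dist (R z) a < \<rho>"
proof -
  assume z: "dist z a < \<rho>"
  have "\<kappa> * dist z a \<le> 1 * dist z a" using \<kappa> by (intro mult_right_mono) auto
  then show "dist (R z) a < \<rho>" using disc_contract[OF z] z by linarith
qed

lemma continuous_on_R: "S \<subseteq> {z. poly q z \<noteq> 0} \<Longrightarrow> continuous_on S R"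
  unfolding refl_map_def by (intro continuous_intros continuous_on_rat_fun)

lemma open_basin_approx: "open (basin_approx p q (ball a \<rho>) k)"
proof (induction k)
  case (Suc k)
  have "basin_approx p q (ball a \<rho>) (Suc k) = {z. poly q z \<noteq> 0} \<inter> R -` basin_approx p q (ball a \<rho>) k"
    by auto
  then show ?case
    by (metis continuous_open_preimage[OF continuous_on_R open_poly_nonzero Suc.IH] order_refl)
qed simp

lemma open_basin: "open basin"
  unfolding basin_def using open_basin_approx by auto

lemma disc_subset_basin: "ball a \<rho> \<subseteq> basin"
  unfolding basin_def using basin_approx.simps(1) by blast

text \<open>Total invariance. The backward direction puts the entire fibre of a basin point into the
  basin, so preimages inside the basin can be counted by a polynomial degree.\<close>

lemma basin_iff: "z \<in> basin \<longleftrightarrow> poly q z \<noteq> 0 \<and> R z \<in> basin"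
proof
  assume "z \<in> basin"
  then obtain k where k: "z \<in> basin_approx p q (ball a \<rho>) k" by (auto simp: basin_def)
  show "poly q z \<noteq> 0 \<and> R z \<in> basin"
  proof (cases k)
    case 0
    then have "dist z a < \<rho>" using k by (simp add: dist_commute)
    then show ?thesis using disc_nonpole R_disc disc_subset_basin by (auto simp: dist_commute subset_iff)
  next
    case (Suc j)
    then show ?thesis using k by (auto simp: basin_def)
  qed
next
  assume "poly q z \<noteq> 0 \<and> R z \<in> basin"
  then obtain k where "z \<in> basin_approx p q (ball a \<rho>) (Suc k)" by (auto simp: basin_def)
  then show "z \<in> basin" unfolding basin_def by blast
qed

lemma nonpole_in_basin: "z \<in> basin \<Longrightarrow> poly q z \<noteq> 0"
  and R_in_basin: "z \<in> basin \<Longrightarrow> R z \<in> basin"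
  using basin_iff[of z] by simp_all

lemma in_basinI: "poly q z \<noteq> 0 \<Longrightarrow> R z \<in> basin \<Longrightarrow> z \<in> basin"
  using basin_iff[of z] by simp

lemma disc_iterate: "dist z a < \<rho> \<Longrightarrow> dist ((R ^^ k) z) a \<le> \<kappa> ^ k * dist z a"
proof (induction k)
  case (Suc k)
  have "\<kappa> ^ k * dist z a \<le> 1 * dist z a" using \<kappa> by (intro mult_right_mono power_le_one) auto
  then have "dist ((R ^^ k) z) a < \<rho>" using Suc by linarith
  then have "dist (R ((R ^^ k) z)) a \<le> \<kappa> * dist ((R ^^ k) z) a" by (rule disc_contract)
  also have "\<dots> \<le> \<kappa> * (\<kappa> ^ k * dist z a)" using Suc \<kappa> by (intro mult_left_mono) auto
  finally show ?case by (simp add: mult_ac)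
qed simp

lemma basin_tendsto:
  assumes "z \<in> basin"
  shows "(\<lambda>k. (R ^^ k) z) \<longlonglongrightarrow> a"
proof -
  have disc: "(\<lambda>k. (R ^^ k) z) \<longlonglongrightarrow> a" if "dist z a < \<rho>" for z
  proof (rule tendsto_dist_iff[THEN iffD2], rule Lim_null_comparison)
    show "\<forall>\<^sub>F k in sequentially. norm (dist ((R ^^ k) z) a) \<le> \<kappa> ^ k * dist z a"
      using disc_iterate[OF that] by simp
    have "(\<lambda>k. \<kappa> ^ k * dist z a) \<longlonglongrightarrow> 0 * dist z a"
      using \<kappa> by (intro tendsto_intros LIMSEQ_power_zero) auto
    then show "(\<lambda>k. \<kappa> ^ k * dist z a) \<longlonglongrightarrow> 0" by simp
  qed
  obtain k where "z \<in> basin_approx p q (ball a \<rho>) k" using assms by (auto simp: basin_def)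
  then show ?thesis
  proof (induction k arbitrary: z)
    case 0
    then show ?case using disc by (simp add: dist_commute)
  next
    case (Suc k)
    then have "(\<lambda>j. (R ^^ j) (R z)) \<longlonglongrightarrow> a" by simp
    then have "(\<lambda>j. (R ^^ Suc j) z) \<longlonglongrightarrow> a" by (simp add: funpow_swap1)
    then show ?case by (rule LIMSEQ_imp_Suc)
  qed
qed

end

section \<open>Basins without critical points\<close>

locale uncritical_attractor = attractor +
  assumes ncr: "no_common_root p q" and deg: "degree q < degree p"
    and uncritical: "\<And>z. z \<in> basin \<Longrightarrow> poly (wronskian p q) z \<noteq> 0"
begin

definition "fibre v = {z. poly (p - smult (cnj v) q) z = 0}"

lemma fibre_iff: "z \<in> fibre v \<longleftrightarrow> poly q z \<noteq> 0 \<and> R z = v"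
proof (cases "poly q z = 0")
  case True
  then show ?thesis using ncr by (auto simp: fibre_def no_common_root_def)
next
  case False
  have "R z = v \<longleftrightarrow> rat_fun p q z = cnj v" unfolding refl_map_def by (metis complex_cnj_cnj)
  then show ?thesis using False by (simp add: fibre_def rat_fun_def field_simps)
qed

text \<open>This is where \<open>degree q < degree p\<close> enters: the map sends infinity to
  itself, so no preimage of a finite point is lost at infinity.\<close>

lemma degree_fibre_poly: "degree (p - smult v q) = degree p"
proof -
  have "degree (smult v q) < degree p" using deg degree_smult_le[of v q] by linarith
  then show ?thesis using degree_add_eq_left[of "- smult v q" p] by simp
qed

lemma fibre_subset_basin: "v \<in> basin \<Longrightarrow> fibre v \<subseteq> basin"
  using in_basinI fibre_iff by auto

lemma finite_fibre: "finite (fibre v)" and card_fibre_le: "card (fibre v) \<le> degree p"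
proof -
  have "p - smult (cnj v) q \<noteq> 0" using degree_fibre_poly[of "cnj v"] deg by (metis degree_0 not_less0)
  then show "finite (fibre v)" "card (fibre v) \<le> degree p"
    unfolding fibre_def using poly_roots_finite[of "p - smult (cnj v) q"] card_poly_roots_bound[of "p - smult (cnj v) q"]
    by (simp_all add: degree_fibre_poly del: poly_diff poly_smult)
qed

text \<open>A multiple root of the fibre polynomial is a root of the Wronskian, and it lies in the
  basin.\<close>

lemma card_fibre:
  assumes "v \<in> basin"
  shows "card (fibre v) = degree p"
proof -
  let ?P = "p - smult (cnj v) q"
  have "poly (pderiv ?P) z \<noteq> 0" if z: "poly ?P z = 0" for z
  proof
    assume d: "poly (pderiv ?P) z = 0"
    have "z \<in> basin" using z fibre_subset_basin[OF assms] by (auto simp: fibre_def)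
    moreover have "poly (wronskian p q) z = 0"
      using z d by (simp add: wronskian_def pderiv_diff pderiv_smult)
    ultimately show False using uncritical by blast
  qed
  then have "rsquarefree ?P" by (auto simp: rsquarefree_roots)
  then show ?thesis unfolding fibre_def using card_roots_rsquarefree degree_fibre_poly by metis
qed

lemma deriv_rat_fun_basin:
  assumes "z \<in> basin"
  shows "deriv (rat_fun p q) z \<noteq> 0"
proof -
  have q: "poly q z \<noteq> 0" using assms by (rule nonpole_in_basin)
  then have "deriv (rat_fun p q) z = rat_deriv p q z"
    by (intro DERIV_imp_deriv rat_fun_has_field_derivative)
  then show ?thesis using rat_deriv_eq_0_iff[OF q] uncritical[OF assms] by simp
qed

lemma basin_nonpole: "basin \<subseteq> {z. poly q z \<noteq> 0}"
  using nonpole_in_basin by blast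

text \<open>Fibres of constant finite size make a local homeomorphism a covering. Around the points
  of the fibre of \<open>v\<close> there are disjoint balls on which the map is injective. Every
  \<open>w\<close> in the common part \<open>T\<close> of their images has a preimage in each ball;
  these are already \<open>degree p\<close> points, so no preimage of \<open>w\<close> lies outside
  the balls.\<close>

lemma covering_basin: "covering_space basin R basin"
proof
  show contR: "continuous_on basin R" by (rule continuous_on_R[OF basin_nonpole])
  have ne: "fibre v \<noteq> {}" if "v \<in> basin" for v using card_fibre[OF that] deg by auto
  show "R ` basin = basin"
  proof
    show "R ` basin \<subseteq> basin" using R_in_basin by blast
    show "basin \<subseteq> R ` basin"
    proof
      fix v assume v: "v \<in> basin"
      obtain z where z: "z \<in> fibre v" using ne[OF v] by auto
      then have "R z = v" "z \<in> basin" using fibre_subset_basin[OF v] fibre_iff by auto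
      then show "v \<in> R ` basin" by auto
    qed
  qed
  fix v assume v: "v \<in> basin"
  let ?X = "fibre v"
  have "\<forall>x\<in>?X. \<exists>d>0. \<forall>y\<in>?X. y \<noteq> x \<longrightarrow> d \<le> dist x y"
    using finite_set_avoid[OF finite_fibre] by blast
  then obtain d where d: "\<And>x. x \<in> ?X \<Longrightarrow> d x > 0" "\<And>x y. x \<in> ?X \<Longrightarrow> y \<in> ?X \<Longrightarrow> y \<noteq> x \<Longrightarrow> d x \<le> dist x y"
    by metis
  have "\<exists>e>0. ball x e \<subseteq> ball x (d x / 2) \<inter> basin \<and> open (rat_fun p q ` ball x e) \<and> inj_on (rat_fun p q) (ball x e)"
    if x: "x \<in> ?X" for x
  proof -
    have xB: "x \<in> ball x (d x / 2) \<inter> basin" using x d(1) fibre_subset_basin[OF v] by auto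
    have "rat_fun p q holomorphic_on ball x (d x / 2) \<inter> basin"
      using basin_nonpole by (intro holomorphic_on_rat_fun) auto
    moreover have "open (ball x (d x / 2) \<inter> basin)" using open_basin by auto
    ultimately show ?thesis
      using has_complex_derivative_locally_invertible[of "rat_fun p q" "ball x (d x / 2) \<inter> basin" x]
        xB deriv_rat_fun_basin by (metis IntD2)
  qed
  then obtain e where e: "\<And>x. x \<in> ?X \<Longrightarrow> e x > 0" "\<And>x. x \<in> ?X \<Longrightarrow> ball x (e x) \<subseteq> ball x (d x / 2) \<inter> basin"
    "\<And>x. x \<in> ?X \<Longrightarrow> open (rat_fun p q ` ball x (e x))" "\<And>x. x \<in> ?X \<Longrightarrow> inj_on (rat_fun p q) (ball x (e x))"
    by metis
  have disj: "ball x (e x) \<inter> ball y (e y) = {}" if "x \<in> ?X" "y \<in> ?X" "x \<noteq> y" for x y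
  proof -
    have "ball x (d x / 2) \<inter> ball y (d y / 2) = {}"
    proof (rule ccontr)
      assume "\<not> ?thesis"
      then obtain z where "dist x z < d x / 2" "dist y z < d y / 2" by auto
      then have "dist x y < d x / 2 + d y / 2" using dist_triangle2[of x y z] by linarith
      moreover have "d x \<le> dist x y" "d y \<le> dist x y" using d(2)[of x y] d(2)[of y x] that by (simp_all add: dist_commute)
      ultimately show False by linarith
    qed
    then show ?thesis using e(2) that by blast
  qed
  define T where "T = basin \<inter> (\<Inter>x\<in>?X. cnj -` (rat_fun p q ` ball x (e x)))"
  have openT: "open T"
    unfolding T_def using finite_fibre e(3) open_basin
    by (intro open_Int open_INT ballI open_vimage continuous_intros) auto
  have vT: "v \<in> T"
    unfolding T_def using v e(1) by (force simp: fibre_iff refl_map_def)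
  define U where "U = (\<lambda>x. ball x (e x) \<inter> (basin \<inter> R -` T))"
  have openBT: "open (basin \<inter> R -` T)"
    using continuous_open_preimage[OF contR open_basin openT] .
  have pre: "\<exists>y. y \<in> ball x (e x) \<and> R y = w" if "w \<in> T" "x \<in> ?X" for w x
  proof -
    have "cnj w \<in> rat_fun p q ` ball x (e x)" using that by (auto simp: T_def)
    then obtain y where "y \<in> ball x (e x)" "cnj w = rat_fun p q y" by auto
    then show ?thesis by (metis complex_cnj_cnj refl_map_def)
  qed
  have "\<Union> (U ` ?X) = basin \<inter> R -` T"
  proof
    show "\<Union> (U ` ?X) \<subseteq> basin \<inter> R -` T" by (auto simp: U_def)
    show "basin \<inter> R -` T \<subseteq> \<Union> (U ` ?X)"
    proof
      fix z assume z: "z \<in> basin \<inter> R -` T"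
      define w where "w = R z"
      have w: "w \<in> T" using z by (simp add: w_def)
      obtain y where y: "\<And>x. x \<in> ?X \<Longrightarrow> y x \<in> ball x (e x)" "\<And>x. x \<in> ?X \<Longrightarrow> R (y x) = w"
        using pre[OF w] by metis
      have "inj_on y ?X"
      proof (rule inj_onI, rule ccontr)
        fix s t assume st: "s \<in> ?X" "t \<in> ?X" "y s = y t" "s \<noteq> t"
        then have "y s \<in> ball s (e s) \<inter> ball t (e t)" using y(1)[of s] y(1)[of t] by simp
        then show False using disj[OF st(1,2,4)] by blast
      qed
      then have "card (y ` ?X) = degree p" using card_fibre[OF v] by (simp add: card_image)
      moreover have "y ` ?X \<subseteq> fibre w"
      proof
        fix u assume "u \<in> y ` ?X"
        then obtain x where x: "x \<in> ?X" "u = y x" by auto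
        then have "u \<in> basin" using y(1) e(2) by blast
        then show "u \<in> fibre w" using x y(2) basin_nonpole by (auto simp: fibre_iff)
      qed
      ultimately have "y ` ?X = fibre w"
        using card_fibre_le[of w] finite_fibre[of w] by (intro card_seteq) auto
      moreover have "z \<in> fibre w" using z basin_nonpole by (auto simp: fibre_iff w_def)
      ultimately obtain x where "x \<in> ?X" "z = y x" by auto
      then show "z \<in> \<Union> (U ` ?X)" using y(1) z by (auto simp: U_def)
    qed
  qed
  moreover have "openin (top_of_set basin) (U x)" for x
    unfolding U_def using openBT by (auto simp: openin_open_eq[OF open_basin])
  moreover have "pairwise disjnt (U ` ?X)"
  proof (clarsimp simp: pairwise_def disjnt_def)
    fix x y assume xy: "x \<in> ?X" "y \<in> ?X" "U x \<noteq> U y"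
    then have "ball x (e x) \<inter> ball y (e y) = {}" using disj[of x y] by auto
    then show "U x \<inter> U y = {}" unfolding U_def by blast
  qed
  moreover have "\<exists>g. homeomorphism (U x) T R g" if x: "x \<in> ?X" for x
  proof -
    have "inj_on R (ball x (e x))"
      using e(4)[OF x] by (auto simp: inj_on_def refl_map_def)
    then have "inj_on R (U x)" by (auto simp: U_def inj_on_def)
    moreover have "continuous_on (U x) R" by (rule continuous_on_subset[OF contR]) (auto simp: U_def)
    moreover have "open (U x)" unfolding U_def using openBT by auto
    ultimately obtain g where "homeomorphism (U x) (R ` U x) R g"
      using invariance_of_domain_homeomorphism[of "U x" R] by auto
    moreover have "R ` U x = T"
    proof
      show "R ` U x \<subseteq> T" by (auto simp: U_def)
      show "T \<subseteq> R ` U x"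
      proof
        fix w assume w: "w \<in> T"
        then obtain y where "y \<in> ball x (e x)" "R y = w" using pre x by blast
        then show "w \<in> R ` U x" using w e(2)[OF x] by (auto simp: U_def)
      qed
    qed
    ultimately show ?thesis by auto
  qed
  ultimately show "\<exists>T. v \<in> T \<and> openin (top_of_set basin) T \<and>
     (\<exists>V. \<Union>V = basin \<inter> R -` T \<and> (\<forall>u\<in>V. openin (top_of_set basin) u) \<and>
       pairwise disjnt V \<and> (\<forall>u\<in>V. \<exists>g. homeomorphism u T R g))"
    using vT openT by (intro exI[of _ T] conjI exI[of _ "U ` ?X"]) (auto simp: T_def openin_open_eq[OF open_basin])
qed

end

context uncritical_attractor
begin

text \<open>The map is antiholomorphic, so inverse branches of its iterates are alternately holomorphic and
  antiholomorphic.\<close>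

lemma inverse_branch:
  "\<exists>h. (h holomorphic_on ball a \<rho> \<or> (cnj \<circ> h) holomorphic_on ball a \<rho>) \<and> continuous_on (ball a \<rho>) h
     \<and> h ` ball a \<rho> \<subseteq> basin \<and> h a = a \<and> (\<forall>z\<in>ball a \<rho>. (R ^^ k) (h z) = z)"
proof (induction k)
  case 0
  have "(\<lambda>z. z) holomorphic_on ball a \<rho>" by (rule holomorphic_on_ident)
  then show ?case
    using disc_subset_basin by (intro exI[of _ "\<lambda>z. z"] conjI disjI1 continuous_on_id) simp_all
next
  case (Suc k)
  then obtain h where hol: "h holomorphic_on ball a \<rho> \<or> (cnj \<circ> h) holomorphic_on ball a \<rho>"
    and conth: "continuous_on (ball a \<rho>) h" and hB: "h ` ball a \<rho> \<subseteq> basin" and ha: "h a = a"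
    and inv: "\<And>z. z \<in> ball a \<rho> \<Longrightarrow> (R ^^ k) (h z) = z" by blast
  have aD: "a \<in> ball a \<rho>" using \<rho> by simp
  then have aB: "a \<in> basin" using disc_subset_basin by auto
  obtain g where g: "continuous_on (ball a \<rho>) g" "g \<in> ball a \<rho> \<rightarrow> basin" "g a = a"
    "\<And>z. z \<in> ball a \<rho> \<Longrightarrow> R (g z) = h z"
  proof (rule covering_space_lift_strong[OF covering_basin aB aD])
    show "simply_connected (ball a \<rho>)" by (simp add: convex_imp_simply_connected)
    show "locally path_connected (ball a \<rho>)" by (simp add: convex_imp_locally_path_connected)
    show "h \<in> ball a \<rho> \<rightarrow> basin" using hB by auto
    show "h a = R a" by (simp add: ha R_fixed)
  qed (use conth in auto)
  have gB: "g ` ball a \<rho> \<subseteq> basin" using g(2) by auto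
  have rg: "rat_fun p q (g z) = cnj (h z)" if "z \<in> ball a \<rho>" for z
    using g(4)[OF that] by (metis complex_cnj_cnj refl_map_def)
  have holr: "rat_fun p q holomorphic_on basin" by (rule holomorphic_on_rat_fun[OF basin_nonpole])
  have "g holomorphic_on ball a \<rho> \<or> (cnj \<circ> g) holomorphic_on ball a \<rho>"
    using hol
  proof
    assume "(cnj \<circ> h) holomorphic_on ball a \<rho>"
    then have "(\<lambda>z. rat_fun p q (g z)) holomorphic_on ball a \<rho>"
      by (rule holomorphic_transform) (simp add: rg)
    then have "g holomorphic_on ball a \<rho>"
      using holomorphic_lift[where u = g, OF open_basin holr deriv_rat_fun_basin open_ball g(1) gB] by simp
    then show ?thesis ..
  next
    assume h: "h holomorphic_on ball a \<rho>"
    \<comment> \<open>Now \<open>rat_fun p q \<circ> g\<close> is antiholomorphic. Precomposing with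
      \<open>cnj\<close> makes it holomorphic on the reflected disc, where the lifting lemma
      applies.\<close>
    let ?D = "cnj ` ball a \<rho>"
    have D: "?D = ball (cnj a) \<rho>"
    proof
      show "?D \<subseteq> ball (cnj a) \<rho>" by (auto simp: dist_norm simp flip: complex_cnj_diff)
      show "ball (cnj a) \<rho> \<subseteq> ?D"
      proof
        fix z assume "z \<in> ball (cnj a) \<rho>"
        then have "cnj z \<in> ball a \<rho>"
          using complex_mod_cnj[of "a - cnj z"] by (simp add: dist_norm)
        then have "cnj (cnj z) \<in> ?D" by (rule imageI)
        then show "z \<in> ?D" by simp
      qed
    qed
    have openD: "open ?D" by (simp add: D)
    have DD: "cnj ` ?D = ball a \<rho>" by (simp add: image_image)
    have "(cnj \<circ> h \<circ> cnj) holomorphic_on ?D"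
      using h openD by (intro holomorphic_on_compose_cnj_cnj) (simp_all only: DD)
    then have "(\<lambda>z. rat_fun p q ((g \<circ> cnj) z)) holomorphic_on ?D"
      by (rule holomorphic_transform) (auto simp: rg)
    moreover have "continuous_on ?D (g \<circ> cnj)"
      using g(1) by (intro continuous_on_compose continuous_intros) (simp only: DD)
    moreover have "(g \<circ> cnj) ` ?D \<subseteq> basin" unfolding image_comp[symmetric] DD by (rule gB)
    ultimately have "(g \<circ> cnj) holomorphic_on ?D"
      using holomorphic_lift[where u = "g \<circ> cnj" and D = ?D, OF open_basin holr deriv_rat_fun_basin openD] by simp
    then have "(cnj \<circ> (g \<circ> cnj) \<circ> cnj) holomorphic_on ball a \<rho>"
      by (rule holomorphic_on_compose_cnj_cnj[OF _ open_ball])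
    moreover have "cnj \<circ> (g \<circ> cnj) \<circ> cnj = cnj \<circ> g" by (simp add: fun_eq_iff)
    ultimately show ?thesis by simp
  qed
  moreover have "(R ^^ Suc k) (g z) = z" if "z \<in> ball a \<rho>" for z
    using inv[OF that] g(4)[OF that] by (simp add: funpow_swap1)
  ultimately show ?case using g(1,3) gB by (intro exI[of _ g] conjI ballI)
qed

text \<open>If the basin missed a disc, all inverse branches fixing \<open>a\<close> would satisfy
  the same linear estimate with constant \<open>C\<close> near \<open>a\<close>. But the k-th
  iterate contracts the disc by \<open>\<kappa> ^ k\<close>, so its inverse must expand:
  \<open>1 \<le> \<kappa> ^ k * C\<close> for all k, which is impossible.\<close>

lemma basin_dense:
  assumes \<sigma>: "\<sigma> > 0"
  shows "ball b \<sigma> \<inter> basin \<noteq> {}"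
proof
  assume disj: "ball b \<sigma> \<inter> basin = {}"
  define c where "c = norm (a - b)"
  define C where "C = 6 * c\<^sup>2 / (\<sigma> * \<rho>)"
  have C: "C \<ge> 0" using \<sigma> \<rho> by (simp add: C_def)
  have bound: "norm (h z - a) \<le> C * dist z a"
    if hol: "h holomorphic_on ball a \<rho> \<or> (cnj \<circ> h) holomorphic_on ball a \<rho>"
      and hB: "h ` ball a \<rho> \<subseteq> basin" and ha: "h a = a"
      and z: "dist z a < \<rho>" "6 * c * dist z a \<le> \<sigma> * \<rho>" for h z
  proof -
    have away: "norm (h w - b) \<ge> \<sigma>" if "w \<in> ball a \<rho>" for w
    proof -
      have "h w \<in> basin" using hB that by blast
      then have "h w \<notin> ball b \<sigma>" using disj by blast
      then show ?thesis by (simp add: dist_norm norm_minus_commute)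
    qed
    show ?thesis using hol
    proof
      assume 1: "h holomorphic_on ball a \<rho>"
      have "norm (h z - h a) \<le> 6 * (norm (h a - b))\<^sup>2 / (\<sigma> * \<rho>) * dist z a"
        using away z by (intro holomorphic_omitting_disc_bound[OF \<rho> 1 \<sigma>]) (simp_all add: c_def ha)
      then show ?thesis by (simp add: c_def C_def ha)
    next
      assume 1: "(cnj \<circ> h) holomorphic_on ball a \<rho>"
      have cn: "norm (cnj x - cnj y) = norm (x - y)" for x y
        by (metis complex_cnj_diff complex_mod_cnj)
      have "norm ((cnj \<circ> h) z - (cnj \<circ> h) a)
          \<le> 6 * (norm ((cnj \<circ> h) a - cnj b))\<^sup>2 / (\<sigma> * \<rho>) * dist z a"
        using away z by (intro holomorphic_omitting_disc_bound[OF \<rho> 1 \<sigma>]) (simp_all add: cn c_def ha del: complex_cnj_diff)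
      then show ?thesis by (simp add: cn c_def C_def ha)
    qed
  qed
  have c0: "c \<ge> 0" by (simp add: c_def)
  \<comment> \<open>The first bound keeps \<open>h z\<close> in the disc of contraction, the second
    is the smallness condition of the Schwarz estimate. The summands 1 keep the denominators
    positive.\<close>
  define \<epsilon> where "\<epsilon> = min (\<rho> / (2 * (C + 1))) (\<sigma> * \<rho> / (6 * c + 1))"
  have \<epsilon>: "\<epsilon> > 0" using \<sigma> \<rho> C c0 by (simp add: \<epsilon>_def add_nonneg_pos)
  have "(C + 1) * \<epsilon> \<le> (C + 1) * (\<rho> / (2 * (C + 1)))" using C by (intro mult_left_mono) (auto simp: \<epsilon>_def)
  also have "\<dots> = \<rho> / 2" using C by (simp add: field_simps)
  finally have "(C + 1) * \<epsilon> \<le> \<rho> / 2" .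
  then have C\<epsilon>: "C * \<epsilon> < \<rho>" "\<epsilon> < \<rho>" using \<epsilon> C \<rho> mult_nonneg_nonneg[OF C less_imp_le[OF \<epsilon>]] by (simp_all only: distrib_right)
  have "(6 * c + 1) * \<epsilon> \<le> (6 * c + 1) * (\<sigma> * \<rho> / (6 * c + 1))" using c0 by (intro mult_left_mono) (auto simp: \<epsilon>_def)
  also have "\<dots> = \<sigma> * \<rho>" using c0 by simp
  finally have c\<epsilon>: "6 * c * \<epsilon> \<le> \<sigma> * \<rho>" using \<epsilon> unfolding distrib_right by linarith
  define z where "z = a + of_real \<epsilon>"
  have dz: "dist z a = \<epsilon>" using \<epsilon> by (simp add: z_def dist_norm)
  have "1 \<le> \<kappa> ^ k * C" for k
  proof -
    obtain h where h: "h holomorphic_on ball a \<rho> \<or> (cnj \<circ> h) holomorphic_on ball a \<rho>"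
      "h ` ball a \<rho> \<subseteq> basin" "h a = a" "\<And>z. z \<in> ball a \<rho> \<Longrightarrow> (R ^^ k) (h z) = z"
      using inverse_branch[of k] by (elim exE conjE) blast
    have 1: "norm (h z - a) \<le> C * \<epsilon>" using bound[OF h(1-3), of z] dz C\<epsilon> c\<epsilon> by simp
    then have "dist (h z) a < \<rho>" using C\<epsilon> by (simp add: dist_norm)
    then have "dist ((R ^^ k) (h z)) a \<le> \<kappa> ^ k * dist (h z) a" by (rule disc_iterate)
    also have "\<dots> \<le> \<kappa> ^ k * (C * \<epsilon>)" using 1 \<kappa> by (intro mult_left_mono) (auto simp: dist_norm)
    finally have "\<epsilon> \<le> \<kappa> ^ k * (C * \<epsilon>)"
      using h(4)[of z] dz C\<epsilon> by (simp add: dist_commute)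
    then show ?thesis using \<epsilon> by (simp add: field_simps)
  qed
  moreover have "(\<lambda>k. \<kappa> ^ k * C) \<longlonglongrightarrow> 0 * C"
    using \<kappa> by (intro tendsto_intros LIMSEQ_power_zero) auto
  ultimately have "(1::real) \<le> 0 * C" by (intro LIMSEQ_le_const) auto
  then show False by simp
qed

end

section \<open>Counting attracting fixed points\<close>

lemma attractor_exists:
  assumes a: "a \<in> cnj_fixed p q" and d: "norm (rat_deriv p q a) < 1"
  shows "\<exists>\<rho> \<kappa>. attractor p q a \<rho> \<kappa>"
proof -
  have qa: "poly q a \<noteq> 0" and ra: "rat_fun p q a = cnj a" using a by (auto simp: cnj_fixed_def)
  define \<kappa> where "\<kappa> = (norm (rat_deriv p q a) + 1) / 2"
  have \<kappa>: "0 < \<kappa> \<and> \<kappa> < 1 \<and> norm (rat_deriv p q a) < \<kappa>"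
    using d by (simp add: \<kappa>_def add_nonneg_pos)
  have "((\<lambda>z. norm ((rat_fun p q z - rat_fun p q a) / (z - a))) \<longlongrightarrow> norm (rat_deriv p q a)) (at a)"
    using rat_fun_has_field_derivative[OF qa, of p UNIV] by (intro tendsto_norm) (simp add: has_field_derivative_iff)
  then have "\<forall>\<^sub>F z in at a. norm ((rat_fun p q z - rat_fun p q a) / (z - a)) < \<kappa>"
    using \<kappa> by (auto intro: order_tendstoD)
  moreover have "\<forall>\<^sub>F z in at a. poly q z \<noteq> 0"
    using open_poly_nonzero[of q] qa by (intro eventually_at_in_open'[of "{z. poly q z \<noteq> 0}", simplified]) auto
  ultimately have "\<forall>\<^sub>F z in at a. norm ((rat_fun p q z - rat_fun p q a) / (z - a)) < \<kappa> \<and> poly q z \<noteq> 0"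
    by (rule eventually_conj)
  then obtain \<rho> where \<rho>: "\<rho> > 0"
    "\<And>z. z \<noteq> a \<Longrightarrow> dist z a < \<rho> \<Longrightarrow> norm ((rat_fun p q z - rat_fun p q a) / (z - a)) < \<kappa> \<and> poly q z \<noteq> 0"
    by (auto simp: eventually_at)
  have "attractor p q a \<rho> \<kappa>"
  proof
    show "poly q z \<noteq> 0" if "dist z a < \<rho>" for z using \<rho>(2)[of z] that qa by (cases "z = a") auto
    show "dist (refl_map p q z) a \<le> \<kappa> * dist z a" if "dist z a < \<rho>" for z
    proof (cases "z = a")
      case True
      then show ?thesis by (simp add: refl_map_def ra)
    next
      case False
      have "dist (refl_map p q z) a = norm (cnj (refl_map p q z - a))"
        unfolding dist_norm complex_mod_cnj ..
      also have "\<dots> = norm (rat_fun p q z - rat_fun p q a)"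
        by (simp add: refl_map_def ra)
      also have "\<dots> \<le> \<kappa> * norm (z - a)"
        using \<rho>(2)[OF False that] False by (simp add: norm_divide divide_less_eq)
      finally show ?thesis by (simp add: dist_norm)
    qed
  qed (use \<rho> \<kappa> in auto)
  then show ?thesis by blast
qed

text \<open>The open disc around a second attracting point is disjoint from the basin of the first,
  which is therefore not dense and contains a root of the Wronskian. Basins are disjoint because
  orbits have one limit, so these roots are distinct.\<close>

theorem card_attracting_le:
  assumes ncr: "no_common_root p q" and deg: "degree q < degree p" "degree p = n" "n \<ge> 2"
    and X: "finite X" "X \<subseteq> {a \<in> cnj_fixed p q. norm (rat_deriv p q a) < 1}"
  shows "card X \<le> 2 * n - 2"
proof (cases "card X \<le> 1")
  \<comment> \<open>Without a second attracting point no disc is known to be missed, but then the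
    bound is trivial as 2 n - 2 is at least 2.\<close>
  case True
  then show ?thesis using deg by simp
next
  case False
  have q0: "q \<noteq> 0" using X False by (auto simp: cnj_fixed_def)
  have "\<forall>a\<in>X. \<exists>\<rho> \<kappa>. attractor p q a \<rho> \<kappa>" using attractor_exists X(2) by blast
  then obtain \<rho> \<kappa> where att: "\<And>a. a \<in> X \<Longrightarrow> attractor p q a (\<rho> a) (\<kappa> a)" by metis
  define B where "B = (\<lambda>a. attractor.basin p q a (\<rho> a))"
  have conv: "(\<lambda>k. (refl_map p q ^^ k) z) \<longlonglongrightarrow> a" if "a \<in> X" "z \<in> B a" for a z
    using attractor.basin_tendsto[OF att[OF that(1)]] that(2) by (simp add: B_def)
  have disj: "B a \<inter> B b = {}" if "a \<in> X" "b \<in> X" "a \<noteq> b" for a b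
    using conv[OF that(1)] conv[OF that(2)] that(3) LIMSEQ_unique by (metis disjoint_iff)
  have "\<exists>w. w \<in> B a \<and> poly (wronskian p q) w = 0" if a: "a \<in> X" for a
  proof (rule ccontr)
    assume none: "\<not> ?thesis"
    interpret attractor p q a "\<rho> a" "\<kappa> a" by (rule att[OF a])
    interpret uncritical_attractor p q a "\<rho> a" "\<kappa> a"
      by unfold_locales (use ncr deg none in \<open>auto simp: B_def\<close>)
    obtain b where b: "b \<in> X" "b \<noteq> a"
      using False a X(1) by (metis One_nat_def card_le_Suc0_iff_eq)
    have "ball b (\<rho> b) \<subseteq> B b" using attractor.disc_subset_basin[OF att[OF b(1)]] by (simp add: B_def)
    moreover have "ball b (\<rho> b) \<inter> B a \<noteq> {}"
      using basin_dense[of "\<rho> b" b] attractor.\<rho>[OF att[OF b(1)]] by (simp add: B_def)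
    ultimately show False using disj[OF a b(1)] b(2) by auto
  qed
  then obtain w where w: "\<And>a. a \<in> X \<Longrightarrow> w a \<in> B a" "\<And>a. a \<in> X \<Longrightarrow> poly (wronskian p q) (w a) = 0"
    by metis
  have "inj_on w X"
  proof (rule inj_onI, rule ccontr)
    fix a b assume ab: "a \<in> X" "b \<in> X" "w a = w b" "a \<noteq> b"
    then have "w a \<in> B a \<inter> B b" using w(1)[of a] w(1)[of b] by auto
    then show False using disj[OF ab(1,2,4)] by auto
  qed
  have W0: "wronskian p q \<noteq> 0" by (rule wronskian_nonzero[OF deg(1) q0])
  have "card X = card (w ` X)" using \<open>inj_on w X\<close> by (simp add: card_image)
  also have "\<dots> \<le> card {z. poly (wronskian p q) z = 0}"
    using w(2) poly_roots_finite[OF W0] by (intro card_mono image_subsetI CollectI)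
  also have "\<dots> \<le> degree (wronskian p q)" by (rule card_poly_roots_bound[OF W0])
  also have "\<dots> \<le> 2 * n - 2" using deg by (intro degree_wronskian_le) auto
  finally show ?thesis .
qed

subsection \<open>Moving a point to infinity\<close>

lemma degree_rev_poly_le: "degree u \<le> n \<Longrightarrow> degree (rev_poly n u) \<le> n"
  using degree_mult_le[of "monom 1 (n - degree u)" "reflect_poly u"]
    degree_monom_le[of "1::complex" "n - degree u"] degree_reflect_poly_le[of u]
  by (simp add: rev_poly_def)

lemma coeff_rev_poly: "degree u \<le> n \<Longrightarrow> coeff (rev_poly n u) n = poly u 0"
  by (simp add: rev_poly_def coeff_monom_mult coeff_reflect_poly poly_0_coeff_0)

text \<open>In the coordinate \<open>w = 1 / (z - c)\<close> the map \<open>r\<close> becomes \<open>w \<mapsto> 1 / (r (c + 1 / w) - cnj c)\<close>; numerator and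
  denominator are multiplied by \<open>w ^ n\<close>.\<close>

definition moebius_num :: "nat \<Rightarrow> complex \<Rightarrow> complex poly \<Rightarrow> complex poly \<Rightarrow> complex poly" where
  "moebius_num n c p q = rev_poly n (q \<circ>\<^sub>p [:c, 1:])"

definition moebius_den :: "nat \<Rightarrow> complex \<Rightarrow> complex poly \<Rightarrow> complex poly \<Rightarrow> complex poly" where
  "moebius_den n c p q = rev_poly n ((p - smult (cnj c) q) \<circ>\<^sub>p [:c, 1:])"

lemma degree_shift: "degree (u \<circ>\<^sub>p [:c, 1:]) = degree (u :: complex poly)"
  by (simp add: degree_pcompose)

lemma coeff_shift:
  fixes u :: "complex poly"
  assumes "degree u \<le> n"
  shows "coeff (u \<circ>\<^sub>p [:c, 1:]) n = coeff u n"
proof (cases "degree u = n")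
  case True
  then show ?thesis using lead_coeff_comp[of "[:c, 1:]" u] by (simp add: degree_shift)
next
  case False
  then show ?thesis using assms by (simp add: coeff_eq_0 degree_shift)
qed

locale moebius =
  fixes p q :: "complex poly" and n :: nat and c :: complex
  assumes ncr: "no_common_root p q" and dp: "degree p \<le> n" and dq: "degree q \<le> n"
    and max_deg: "degree p = n \<or> degree q = n" and n0: "n > 0" and qc: "poly q c \<noteq> 0"
begin

definition "u = p - smult (cnj c) q"
definition "P = moebius_num n c p q"
definition "Q = moebius_den n c p q"

lemma deg_u: "degree u \<le> n"
  unfolding u_def using dp dq by (intro degree_diff_le) (auto intro: order_trans[OF degree_smult_le])

lemma poly_P: "w \<noteq> 0 \<Longrightarrow> poly P w = w ^ n * poly q (c + inverse w)"
  and poly_Q: "w \<noteq> 0 \<Longrightarrow> poly Q w = w ^ n * poly u (c + inverse w)"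
  using dq deg_u by (simp_all add: P_def Q_def moebius_num_def moebius_den_def poly_rev_poly degree_shift
    poly_pcompose flip: u_def)

lemma poly_P_0: "poly P 0 = coeff q n" and poly_Q_0: "poly Q 0 = coeff u n"
  using dq deg_u by (simp_all add: P_def Q_def moebius_num_def moebius_den_def poly_rev_poly_0 degree_shift
    coeff_shift flip: u_def)

lemma coeff_P: "coeff P n = poly q c" and coeff_Q: "coeff Q n = poly u c"
  using dq deg_u by (simp_all add: P_def Q_def moebius_num_def moebius_den_def coeff_rev_poly degree_shift
    poly_pcompose flip: u_def)

lemma degree_P: "degree P = n"
proof (rule antisym)
  show "degree P \<le> n" unfolding P_def moebius_num_def by (intro degree_rev_poly_le) (simp add: degree_shift dq)
  show "n \<le> degree P" using coeff_P qc by (intro le_degree) simp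
qed

lemma degree_Q_le: "degree Q \<le> n"
  unfolding Q_def moebius_den_def u_def[symmetric] by (intro degree_rev_poly_le) (simp add: degree_shift deg_u)

text \<open>\<open>coeff Q n\<close> is \<open>poly u c\<close>, so infinity is fixed in the new
  coordinate exactly when \<open>c\<close> was fixed. Both cases occur: \<open>c\<close> repelling
  for the critical point argument, \<open>c\<close> not fixed for making infinity a finite
  zero.\<close>

lemma degree_Q_eq: "rat_fun p q c \<noteq> cnj c \<Longrightarrow> degree Q = n"
  using coeff_Q qc degree_Q_le by (intro antisym le_degree) (auto simp: u_def rat_fun_def field_simps)

lemma degree_Q_less:
  assumes "rat_fun p q c = cnj c"
  shows "degree Q < n"
proof -
  have "coeff Q n = 0" using coeff_Q qc assms by (simp add: u_def rat_fun_def field_simps)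
  then have "degree Q \<noteq> n" using n0 by (metis degree_0 leading_coeff_0_iff less_irrefl)
  then show ?thesis using degree_Q_le by simp
qed

text \<open>At 0, the old infinity, a common root would mean that both \<open>p\<close> and
  \<open>q\<close> have degree below \<open>n\<close>.\<close>

lemma no_common_root_PQ: "no_common_root P Q"
  unfolding no_common_root_def
proof
  fix w
  show "poly P w \<noteq> 0 \<or> poly Q w \<noteq> 0"
  proof (cases "w = 0")
    case True
    have "coeff p n \<noteq> 0 \<or> coeff q n \<noteq> 0"
      using max_deg n0 by (metis degree_0 leading_coeff_neq_0 less_irrefl)
    then show ?thesis using True by (auto simp: poly_P_0 poly_Q_0 u_def)
  next
    case False
    then show ?thesis using ncr[unfolded no_common_root_def, rule_format, of "c + inverse w"]
      by (auto simp: poly_P poly_Q u_def)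
  qed
qed

lemma fixed_iff:
  assumes w: "w \<noteq> 0"
  shows "w \<in> cnj_fixed P Q \<longleftrightarrow> c + inverse w \<in> cnj_fixed p q"
proof -
  let ?z = "c + inverse w"
  have "w \<in> cnj_fixed P Q \<longleftrightarrow> poly u ?z \<noteq> 0 \<and> poly q ?z = cnj w * poly u ?z"
    using w by (auto simp: cnj_fixed_def rat_fun_def poly_P poly_Q field_simps)
  also have "\<dots> \<longleftrightarrow> poly q ?z \<noteq> 0 \<and> poly q ?z = cnj w * poly u ?z"
    using w by auto
  also have "\<dots> \<longleftrightarrow> poly q ?z \<noteq> 0 \<and> poly p ?z = cnj ?z * poly q ?z"
    using w by (auto simp: u_def field_simps)
  also have "\<dots> \<longleftrightarrow> ?z \<in> cnj_fixed p q"
    by (auto simp: cnj_fixed_def rat_fun_def field_simps)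
  finally show ?thesis .
qed

text \<open>The point 0 is the old infinity, so this is the source of the additional zero when
  \<open>degree p > degree q\<close>.\<close>

lemma fixed_0_iff: "0 \<in> cnj_fixed P Q \<longleftrightarrow> coeff q n = 0"
  using no_common_root_PQ[unfolded no_common_root_def, rule_format, of 0]
  by (auto simp: cnj_fixed_def rat_fun_def poly_P_0)

text \<open>The modulus of the multiplier does not depend on the coordinate: the chain rule gives a
  factor \<open>(inverse w)\<^sup>2\<close>, and at a fixed point \<open>poly q\<close> is
  \<open>cnj w\<close> times \<open>poly u\<close>, which absorbs it in modulus.\<close>

lemma norm_deriv:
  assumes w: "w \<noteq> 0" "w \<in> cnj_fixed P Q"
  shows "norm (rat_deriv P Q w) = norm (rat_deriv p q (c + inverse w))"
proof -
  let ?z = "c + inverse w"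
  have Qw: "poly Q w \<noteq> 0" and eq: "rat_fun P Q w = cnj w" using w by (auto simp: cnj_fixed_def)
  have uz: "poly u ?z \<noteq> 0" using Qw w by (simp add: poly_Q)
  have quz: "poly q ?z = cnj w * poly u ?z"
    using eq uz w by (simp add: rat_fun_def poly_P poly_Q field_simps)
  have chain: "((\<lambda>w. c + inverse w) has_field_derivative - (inverse w)\<^sup>2) (at w)"
    using w by (auto intro!: derivative_eq_intros simp: power2_eq_square)
  have "((\<lambda>w. rat_fun q u (c + inverse w)) has_field_derivative rat_deriv q u ?z * - (inverse w)\<^sup>2) (at w)"
    using DERIV_chain2[OF rat_fun_has_field_derivative[OF uz] chain] .
  then have "(rat_fun P Q has_field_derivative rat_deriv q u ?z * - (inverse w)\<^sup>2) (at w)"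
  proof (rule DERIV_cong_ev[OF refl _ refl, THEN iffD1, rotated])
    have "\<forall>\<^sub>F v in nhds w. v \<in> - {0}" using w by (intro eventually_nhds_in_open) auto
    then show "\<forall>\<^sub>F v in nhds w. rat_fun q u (c + inverse v) = rat_fun P Q v"
      by eventually_elim (simp add: rat_fun_def poly_P poly_Q)
  qed
  then have "rat_deriv P Q w = rat_deriv q u ?z * - (inverse w)\<^sup>2"
    using rat_fun_has_field_derivative[OF Qw] DERIV_unique by blast
  moreover have "wronskian q u = - wronskian p q"
    by (simp add: wronskian_def u_def pderiv_diff pderiv_smult algebra_simps)
  ultimately have "rat_deriv P Q w = poly (wronskian p q) ?z / (poly u ?z)\<^sup>2 * (inverse w)\<^sup>2"
    by (simp add: rat_deriv_def)
  then have "norm (rat_deriv P Q w) = norm (poly (wronskian p q) ?z) / (norm (poly u ?z))\<^sup>2 * (inverse (norm w))\<^sup>2"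
    by (simp add: norm_mult norm_divide norm_power norm_inverse)
  also have "\<dots> = norm (poly (wronskian p q) ?z) / (norm w * norm (poly u ?z))\<^sup>2"
    by (simp add: power_mult_distrib divide_inverse power_inverse)
  also have "\<dots> = norm (rat_deriv p q ?z)"
    unfolding rat_deriv_def quz by (simp add: norm_mult norm_divide norm_power)
  finally show ?thesis .
qed

end

theorem card_cnj_fixed_regular_le:
  assumes ncr: "no_common_root p q" and deg: "degree p \<le> degree q" "degree q = n" "n \<ge> 2"
    and reg: "\<And>a. a \<in> cnj_fixed p q \<Longrightarrow> norm (rat_deriv p q a) \<noteq> 1"
  shows "card (cnj_fixed p q) \<le> 5 * n - 5"
proof -
  define Zp where "Zp = {a \<in> cnj_fixed p q. norm (rat_deriv p q a) > 1}"
  define Zm where "Zm = {a \<in> cnj_fixed p q. norm (rat_deriv p q a) < 1}"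
  have q0: "q \<noteq> 0" using deg by auto
  have fin: "finite (cnj_fixed p q)" using cnj_fixed_finite[OF ncr deg(1) q0 reg] .
  have finp: "finite Zp" "finite Zm" using fin by (auto simp: Zp_def Zm_def)
  have index: "int (card Zp) = int (card Zm) + int n - 1"
    using cnj_fixed_index[OF ncr deg(1) q0 reg] deg(2) by (simp add: Zp_def Zm_def)
  \<comment> \<open>At least n - 1 zeros are repelling. Sending one of these to infinity removes no
    attracting point from the count.\<close>
  then have "card Zp > 0" using deg by linarith
  then obtain c where "c \<in> Zp" by (metis card_gt_0_iff ex_in_conv)
  then have c: "c \<in> cnj_fixed p q" "norm (rat_deriv p q c) > 1" by (auto simp: Zp_def)
  interpret moebius p q n c
    using ncr deg c by unfold_locales (auto simp: cnj_fixed_def)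
  define X where "X = (\<lambda>z. inverse (z - c)) ` Zm"
  have cz: "z \<noteq> c" if "z \<in> Zm" for z using that c(2) by (auto simp: Zm_def)
  have "card X \<le> 2 * n - 2"
  proof (rule card_attracting_le[OF no_common_root_PQ _ degree_P deg(3)])
    show "degree Q < degree P" using degree_Q_less c(1) by (simp add: degree_P cnj_fixed_def)
    show "finite X" using finp by (simp add: X_def)
    show "X \<subseteq> {a \<in> cnj_fixed P Q. norm (rat_deriv P Q a) < 1}"
    proof
      fix w assume "w \<in> X"
      then obtain z where z: "z \<in> Zm" "w = inverse (z - c)" by (auto simp: X_def)
      then have w: "w \<noteq> 0" "c + inverse w = z" using cz by auto
      then have "w \<in> cnj_fixed P Q" using z fixed_iff[OF w(1)] by (auto simp: Zm_def)
      then show "w \<in> {a \<in> cnj_fixed P Q. norm (rat_deriv P Q a) < 1}"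
        using norm_deriv[OF w(1)] w z by (auto simp: Zm_def)
    qed
  qed
  moreover have "card X = card Zm"
    unfolding X_def by (intro card_image inj_onI) (metis add_diff_cancel diff_add_cancel inverse_inverse_eq)
  moreover have "card (cnj_fixed p q) = card Zp + card Zm"
  proof -
    have "cnj_fixed p q = Zp \<union> Zm" "Zp \<inter> Zm = {}" using reg by (force simp: Zp_def Zm_def)+
    then show ?thesis using finp card_Un_disjoint by metis
  qed
  ultimately show ?thesis using index deg(3) by linarith
qed

subsection \<open>Zeros near a singular zero\<close>

text \<open>Monotonicity replaces differentiability: just below and just above the root at
  \<open>s0\<close> the signs of \<open>V\<close> persist for nearby \<open>s\<close>, and this
  traps the root at \<open>s\<close>.\<close>

lemma implicit_function_mono:
  fixes V :: "'s::t2_space \<Rightarrow> real \<Rightarrow> real"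
  assumes "\<delta> > 0" "open S"
    and cont: "continuous_on (S \<times> {-\<delta>..\<delta>}) (\<lambda>(s, y). V s y)"
    and mono: "\<And>s y1 y2. s \<in> S \<Longrightarrow> -\<delta> \<le> y1 \<Longrightarrow> y1 < y2 \<Longrightarrow> y2 \<le> \<delta> \<Longrightarrow> V s y1 < V s y2"
    and ends: "\<And>s. s \<in> S \<Longrightarrow> V s (-\<delta>) < 0 \<and> 0 < V s \<delta>"
  shows "\<exists>\<phi>. continuous_on S \<phi> \<and> (\<forall>s\<in>S. -\<delta> < \<phi> s \<and> \<phi> s < \<delta> \<and> V s (\<phi> s) = 0)"
proof -
  have "\<exists>y. -\<delta> < y \<and> y < \<delta> \<and> V s y = 0" if s: "s \<in> S" for s
  proof -
    have "continuous_on {-\<delta>..\<delta>} (\<lambda>y. (\<lambda>(s, y). V s y) (s, y))"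
      using s by (intro continuous_on_compose2[OF cont] continuous_intros) auto
    then have "continuous_on {-\<delta>..\<delta>} (V s)" by simp
    then obtain y where y: "-\<delta> \<le> y" "y \<le> \<delta>" "V s y = 0"
      using IVT'[of "V s" "-\<delta>" 0 \<delta>] ends[OF s] \<open>\<delta> > 0\<close> by auto
    moreover have "y \<noteq> -\<delta>" "y \<noteq> \<delta>" using y ends[OF s] by auto
    ultimately show ?thesis by (intro exI[of _ y]) auto
  qed
  then obtain \<phi> where \<phi>: "\<And>s. s \<in> S \<Longrightarrow> -\<delta> < \<phi> s \<and> \<phi> s < \<delta> \<and> V s (\<phi> s) = 0" by metis
  have "continuous_on S \<phi>"
    unfolding continuous_on_eq_continuous_at[OF \<open>open S\<close>] isCont_def
  proof (intro ballI tendstoI)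
    fix s0 and \<epsilon> :: real assume s0: "s0 \<in> S" and \<epsilon>: "\<epsilon> > 0"
    have contV: "continuous_on S (\<lambda>s. V s y)" if "y \<in> {-\<delta>..\<delta>}" for y
    proof -
      have "continuous_on S (\<lambda>s. (\<lambda>(s, y). V s y) (s, y))"
        using that by (intro continuous_on_compose2[OF cont] continuous_intros) auto
      then show ?thesis by simp
    qed
    have tend: "((\<lambda>s. V s y) \<longlongrightarrow> V s0 y) (at s0)" if "y \<in> {-\<delta>..\<delta>}" for y
      using contV[OF that] s0 continuous_on_eq_continuous_at[OF \<open>open S\<close>] isCont_def by blast
    define y1 y2 where "y1 = max (-\<delta>) (\<phi> s0 - \<epsilon> / 2)" and "y2 = min \<delta> (\<phi> s0 + \<epsilon> / 2)"
    have y: "-\<delta> \<le> y1" "y1 < \<phi> s0" "\<phi> s0 < y2" "y2 \<le> \<delta>" using \<phi>[OF s0] \<epsilon> by (auto simp: y1_def y2_def)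
    have "V s0 y1 < 0" "0 < V s0 y2"
      using mono[OF s0, of y1 "\<phi> s0"] mono[OF s0, of "\<phi> s0" y2] y \<phi>[OF s0] by auto
    then have "\<forall>\<^sub>F s in at s0. V s y1 < 0" "\<forall>\<^sub>F s in at s0. 0 < V s y2"
      using tend[of y1] tend[of y2] y by (auto intro: order_tendstoD)
    moreover have "\<forall>\<^sub>F s in at s0. s \<in> S" using \<open>open S\<close> s0 by (rule eventually_at_in_open')
    ultimately show "\<forall>\<^sub>F s in at s0. dist (\<phi> s) (\<phi> s0) < \<epsilon>"
    proof eventually_elim
      case (elim s)
      have "y1 < \<phi> s"
      proof (rule ccontr)
        assume "\<not> y1 < \<phi> s"
        then have "V s (\<phi> s) \<le> V s y1" using mono[OF elim(3), of "\<phi> s" y1] \<phi>[OF elim(3)] y by (cases "\<phi> s = y1") auto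
        then show False using elim \<phi>[OF elim(3)] by simp
      qed
      moreover have "\<phi> s < y2"
      proof (rule ccontr)
        assume "\<not> \<phi> s < y2"
        then have "V s y2 \<le> V s (\<phi> s)" using mono[OF elim(3), of y2 "\<phi> s"] \<phi>[OF elim(3)] y by (cases "\<phi> s = y2") auto
        then show False using elim \<phi>[OF elim(3)] by simp
      qed
      ultimately show ?case using \<epsilon> by (auto simp: y1_def y2_def dist_real_def)
    qed
  qed
  then show ?thesis using \<phi> by blast
qed

text \<open>\<open>H\<close> is the map \<open>r\<close> in coordinates centred at a zero, rotated such that its derivative there is a real
  number \<open>A \<ge> 0\<close>; then the imaginary part \<open>V\<close> of \<open>a * H \<zeta> + e - cnj \<zeta>\<close> increases with \<open>Im \<zeta>\<close>. The
  parameters \<open>(a, e)\<close> range over a neighbourhood of \<open>(1, 0)\<close>.\<close>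

locale local_model =
  fixes H :: "complex \<Rightarrow> complex" and A D :: real
  assumes D: "D > 0" and A: "A \<ge> 0" and H0: "H 0 = 0"
    and contH: "continuous_on (ball 0 D) H"
    and lip: "\<And>\<zeta> \<xi>. norm \<zeta> < D \<Longrightarrow> norm \<xi> < D \<Longrightarrow> norm (H \<zeta> - H \<xi> - of_real A * (\<zeta> - \<xi>)) \<le> norm (\<zeta> - \<xi>) / 4"
    and der: "\<And>\<tau>. \<tau> > 0 \<Longrightarrow> \<exists>d>0. \<forall>\<zeta>. norm \<zeta> < d \<longrightarrow> norm (H \<zeta> - of_real A * \<zeta>) \<le> \<tau> * norm \<zeta>"
    and isolated: "\<And>\<zeta>. norm \<zeta> < D \<Longrightarrow> H \<zeta> = cnj \<zeta> \<Longrightarrow> \<zeta> = 0"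
begin

definition "\<delta> = D / 3"

definition V :: "(complex \<times> complex) \<times> real \<Rightarrow> real \<Rightarrow> real" where
  "V s y = Im (fst (fst s) * H (Complex (snd s) y) + snd (fst s)) + y"

lemma \<delta>: "\<delta> > 0" using D by (simp add: \<delta>_def)

lemma square_in_ball: "\<bar>x\<bar> \<le> \<delta> \<Longrightarrow> \<bar>y\<bar> \<le> \<delta> \<Longrightarrow> norm (Complex x y) < D"
  using cmod_le[of "Complex x y"] D by (simp add: \<delta>_def)

lemma continuous_on_V:
  assumes "S \<subseteq> {s. \<bar>snd s\<bar> \<le> \<delta>}"
  shows "continuous_on (S \<times> {-\<delta>..\<delta>}) (\<lambda>(s, y). V s y)"
  unfolding V_def case_prod_beta
proof (intro continuous_intros continuous_on_compose2[OF contH])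
  show "(\<lambda>x. Complex (snd (fst x)) (snd x)) ` (S \<times> {-\<delta>..\<delta>}) \<subseteq> ball 0 D"
  proof
    fix z assume "z \<in> (\<lambda>x. Complex (snd (fst x)) (snd x)) ` (S \<times> {-\<delta>..\<delta>})"
    then obtain s y where s: "s \<in> S" "-\<delta> \<le> y" "y \<le> \<delta>" "z = Complex (snd s) y" by auto
    then have "\<bar>snd s\<bar> \<le> \<delta>" using assms by auto
    then show "z \<in> ball 0 D" using square_in_ball[of "snd s" y] s by simp
  qed
qed

text \<open>The conjugation contributes \<open>y2 - y1\<close>, the linear part a nonnegative amount
  since \<open>Re a > 0\<close>, and the error is at most 3/8 of \<open>y2 - y1\<close>, from
  \<open>norm a < 3/2\<close> and the constant 1/4 in \<open>lip\<close>.\<close>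

lemma V_strict_mono:
  assumes a: "norm (fst (fst s) - 1) < 1/2" and x: "\<bar>snd s\<bar> \<le> \<delta>" and y: "-\<delta> \<le> y1" "y1 < y2" "y2 \<le> \<delta>"
  shows "V s y1 < V s y2"
proof -
  define a where "a = fst (fst s)"
  define x where "x = snd s"
  define k where "k = H (Complex x y2) - H (Complex x y1) - of_real A * (Complex x y2 - Complex x y1)"
  have diff: "Complex x y2 - Complex x y1 = \<i> * of_real (y2 - y1)" by (simp add: complex_eq_iff)
  have "norm k \<le> norm (Complex x y2 - Complex x y1) / 4"
    unfolding k_def using x y by (intro lip square_in_ball) (auto simp: x_def)
  then have k: "norm k \<le> (y2 - y1) / 4" using y unfolding diff by (simp add: norm_mult del: of_real_diff)
  have na: "norm a < 3/2" using norm_triangle_sub[of a 1] assms(1) by (simp add: a_def)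
  have "\<bar>Re (a - 1)\<bar> < 1/2" using abs_Re_le_cmod[of "a - 1"] a by (simp add: a_def)
  then have Ra: "Re a > 0" by (simp add: abs_if split: if_splits)
  have "norm (a * k) \<le> 3/2 * ((y2 - y1) / 4)" unfolding norm_mult using na k by (intro mult_mono) auto
  then have "\<bar>Im (a * k)\<bar> \<le> 3/8 * (y2 - y1)" using abs_Im_le_cmod[of "a * k"] by linarith
  moreover have "H (Complex x y2) - H (Complex x y1) = of_real A * (\<i> * of_real (y2 - y1)) + k"
    by (simp add: k_def diff)
  then have eq: "a * H (Complex x y2) - a * H (Complex x y1) = a * (of_real A * (\<i> * of_real (y2 - y1))) + a * k"
    by (simp only: right_diff_distrib[symmetric] distrib_left)
  then have "Im (a * H (Complex x y2)) - Im (a * H (Complex x y1)) = A * (y2 - y1) * Re a + Im (a * k)"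
  proof -
    have "Im (a * (of_real A * (\<i> * of_real (y2 - y1)))) = A * (y2 - y1) * Re a" by simp
    then show ?thesis using arg_cong[where f = Im, OF eq] by (simp only: minus_complex.sel plus_complex.sel)
  qed
  moreover have "A * (y2 - y1) * Re a \<ge> 0" using A y Ra by simp
  moreover have "u1 + y1 < u2 + y2" if "\<bar>j\<bar> \<le> 3/8 * (y2 - y1)" "u2 - u1 = m + j" "m \<ge> 0" for u1 u2 j m
  proof -
    have "- j \<le> 3/8 * (y2 - y1)" using that(1) abs_ge_minus_self order_trans by blast
    then show ?thesis using that(2,3) y(2) by (simp add: field_simps)
  qed
  ultimately have "Im (a * H (Complex x y1)) + y1 < Im (a * H (Complex x y2)) + y2" by blast
  then show ?thesis by (simp only: V_def plus_complex.sel flip: a_def x_def)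
qed

text \<open>The implicit function lives on an open set of pairs of a parameter and an abscissa.
  Shrinking this set to a product gives one interval \<open>{-h..h}\<close> that serves all
  parameters in \<open>T\<close>.\<close>

lemma reduction:
  "\<exists>T h \<phi>. open T \<and> (1, 0) \<in> T \<and> 0 < h \<and> h \<le> \<delta> \<and> (\<forall>t\<in>T. norm (fst t - 1) < 1/2)
     \<and> continuous_on (T \<times> {-h..h}) \<phi>
     \<and> (\<forall>s\<in>T \<times> {-h..h}. -\<delta> < \<phi> s \<and> \<phi> s < \<delta> \<and> V s (\<phi> s) = 0)"
proof -
  define S0 where "S0 = {s::(complex \<times> complex) \<times> real. norm (fst (fst s) - 1) < 1/2 \<and> \<bar>snd s\<bar> < \<delta>}"
  have S0: "open S0"
    unfolding S0_def by (intro open_Collect_conj open_Collect_less continuous_intros)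
  have contV: "continuous_on S0 (\<lambda>s. V s y)" if "y \<in> {-\<delta>..\<delta>}" for y
  proof -
    have "continuous_on S0 (\<lambda>s. (\<lambda>(s, y). V s y) (s, y))"
      using that by (intro continuous_on_compose2[OF continuous_on_V[of S0]] continuous_intros) (auto simp: S0_def)
    then show ?thesis by simp
  qed
  define S where "S = (S0 \<inter> (\<lambda>s. V s (-\<delta>)) -` {..<0}) \<inter> (S0 \<inter> (\<lambda>s. V s \<delta>) -` {0<..})"
  have "open S"
    unfolding S_def using \<delta> by (intro open_Int continuous_open_preimage contV S0) auto
  have SS0: "S \<subseteq> S0" by (auto simp: S_def)
  have "\<exists>\<phi>. continuous_on S \<phi> \<and> (\<forall>s\<in>S. -\<delta> < \<phi> s \<and> \<phi> s < \<delta> \<and> V s (\<phi> s) = 0)"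
  proof (rule implicit_function_mono[OF \<delta> \<open>open S\<close>])
    show "continuous_on (S \<times> {-\<delta>..\<delta>}) (\<lambda>(s, y). V s y)"
      using SS0 by (intro continuous_on_V) (auto simp: S0_def)
    show "V s y1 < V s y2" if "s \<in> S" "-\<delta> \<le> y1" "y1 < y2" "y2 \<le> \<delta>" for s y1 y2
      using that SS0 by (intro V_strict_mono) (auto simp: S0_def)
    show "V s (-\<delta>) < 0 \<and> 0 < V s \<delta>" if "s \<in> S" for s using that by (auto simp: S_def)
  qed
  then obtain \<phi> where \<phi>: "continuous_on S \<phi>" "\<forall>s\<in>S. -\<delta> < \<phi> s \<and> \<phi> s < \<delta> \<and> V s (\<phi> s) = 0" by blast
  have "Complex 0 0 = 0" by (simp add: complex_eq_iff)
  then have "V ((1, 0), 0) 0 = 0" by (simp add: V_def H0)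
  then have inS: "((1, 0), 0) \<in> S"
    using V_strict_mono[of "((1, 0), 0)" "-\<delta>" 0] V_strict_mono[of "((1, 0), 0)" 0 \<delta>] \<delta>
    by (simp add: S_def S0_def)
  obtain T C where TC0: "open T" "open C" "((1, 0), 0) \<in> T \<times> C" "T \<times> C \<subseteq> S"
    by (rule open_prod_elim[OF \<open>open S\<close> inS])
  then have TC: "open T" "open C" "(1, 0) \<in> T" "0 \<in> C" "T \<times> C \<subseteq> S" by auto
  obtain h0 where h0: "h0 > 0" "cball 0 h0 \<subseteq> C" using TC(2,4) open_contains_cball by metis
  define h where "h = min h0 \<delta>"
  have h: "0 < h" "h \<le> \<delta>" using h0 \<delta> by (auto simp: h_def)
  have "{-h..h} \<subseteq> cball 0 h0" by (auto simp: h_def dist_real_def)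
  then have "{-h..h} \<subseteq> C" using h0(2) by (rule order_trans)
  then have "T \<times> {-h..h} \<subseteq> T \<times> C" by (intro Sigma_mono) auto
  then have sub: "T \<times> {-h..h} \<subseteq> S" using TC(5) by (rule order_trans)
  have "norm (fst t - 1) < 1/2" if "t \<in> T" for t
  proof -
    have "(t, 0) \<in> T \<times> C" using that TC(4) by simp
    then have "(t, 0) \<in> S0" using TC(5) SS0 by (meson subsetD)
    then show ?thesis by (simp add: S0_def)
  qed
  then have near: "\<forall>t\<in>T. norm (fst t - 1) < 1/2" by blast
  have zero: "\<forall>s\<in>T \<times> {-h..h}. -\<delta> < \<phi> s \<and> \<phi> s < \<delta> \<and> V s (\<phi> s) = 0"
  proof
    fix s assume "s \<in> T \<times> {-h..h}"
    then have "s \<in> S" by (rule subsetD[OF sub])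
    then show "-\<delta> < \<phi> s \<and> \<phi> s < \<delta> \<and> V s (\<phi> s) = 0" by (rule bspec[OF \<phi>(2)])
  qed
  show ?thesis
    by (intro exI[of _ T] exI[of _ h] exI[of _ \<phi>] conjI TC(1,3) h near zero continuous_on_subset[OF \<phi>(1) sub])
qed

text \<open>The count is demanded on a whole neighbourhood of \<open>t\<close>, so that a parameter
  may later be exchanged for a generic one nearby.\<close>

definition zeros_ge :: "nat \<Rightarrow> complex \<times> complex \<Rightarrow> bool" where
  "zeros_ge k t \<longleftrightarrow> (\<forall>\<^sub>F t' in nhds t. \<exists>X. finite X \<and> card X = k \<and>
      X \<subseteq> {\<zeta>. norm \<zeta> < D \<and> fst t' * H \<zeta> + snd t' = cnj \<zeta>})"

end

section \<open>The remaining real equation\<close>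

locale reduced_model = local_model +
  fixes T :: "(complex \<times> complex) set" and h :: real and \<phi> :: "(complex \<times> complex) \<times> real \<Rightarrow> real"
  assumes T: "open T" "(1, 0) \<in> T" and h: "0 < h" "h \<le> \<delta>"
    and T_near: "\<And>t. t \<in> T \<Longrightarrow> norm (fst t - 1) < 1/2"
    and cont\<phi>: "continuous_on (T \<times> {-h..h}) \<phi>"
    and \<phi>: "\<And>t x. t \<in> T \<Longrightarrow> \<bar>x\<bar> \<le> h \<Longrightarrow> \<bar>\<phi> (t, x)\<bar> < \<delta> \<and> V (t, x) (\<phi> (t, x)) = 0"
begin

definition Z :: "complex \<times> complex \<Rightarrow> real \<Rightarrow> complex" where
  "Z t x = Complex x (\<phi> (t, x))"

text \<open>The imaginary part of the equation vanishes along the curve \<open>Z t\<close>, so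
  \<open>g t x\<close> is all that is left of it. Distinct roots \<open>x\<close> give zeros with
  distinct real parts.\<close>

definition g :: "complex \<times> complex \<Rightarrow> real \<Rightarrow> real" where
  "g t x = Re (fst t * H (Z t x) + snd t) - x"

lemma Z_in_ball: "t \<in> T \<Longrightarrow> \<bar>x\<bar> \<le> h \<Longrightarrow> norm (Z t x) < D"
  unfolding Z_def using h \<phi>[of t x] by (intro square_in_ball) auto

lemma Z_eq:
  assumes "t \<in> T" "\<bar>x\<bar> \<le> h"
  shows "fst t * H (Z t x) + snd t = cnj (Z t x) + of_real (g t x)"
  using \<phi>[OF assms] by (simp add: complex_eq_iff g_def Z_def V_def)

lemma \<phi>_unique:
  assumes "t \<in> T" "\<bar>x\<bar> \<le> h" "\<bar>y\<bar> \<le> \<delta>" "V (t, x) y = 0"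
  shows "\<phi> (t, x) = y"
proof -
  have "norm (fst (fst (t, x)) - 1) < 1/2" "\<bar>snd (t, x)\<bar> \<le> \<delta>" using T_near assms h by auto
  note m = V_strict_mono[OF this]
  define f where "f = \<phi> (t, x)"
  have f: "-\<delta> \<le> f" "f \<le> \<delta>" "V (t, x) f = 0" using \<phi>[OF assms(1,2)] by (auto simp: f_def)
  have y: "-\<delta> \<le> y" "y \<le> \<delta>" using assms(3) by auto
  have "\<not> y < f" using m[of y f] f y assms(4) by auto
  moreover have "\<not> f < y" using m[of f y] f y assms(4) by auto
  ultimately show ?thesis by (simp add: f_def)
qed

lemma continuous_on_g: "continuous_on (T \<times> {-h..h}) (\<lambda>(t, x). g t x)"
  unfolding g_def Z_def case_prod_beta
  by (intro continuous_intros continuous_on_compose2[OF contH] continuous_on_compose2[OF cont\<phi>])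
     (use Z_in_ball in \<open>auto simp: Z_def\<close>)

lemma continuous_on_g_param: "\<bar>x\<bar> \<le> h \<Longrightarrow> continuous_on T (\<lambda>t. g t x)"
proof -
  assume "\<bar>x\<bar> \<le> h"
  then have "continuous_on T (\<lambda>t. (\<lambda>(t, x). g t x) (t, x))"
    by (intro continuous_on_compose2[OF continuous_on_g] continuous_intros) auto
  then show ?thesis by simp
qed

lemma g_tendsto: "t \<in> T \<Longrightarrow> \<bar>x\<bar> \<le> h \<Longrightarrow> ((\<lambda>t. g t x) \<longlongrightarrow> g t x) (nhds t)"
  using continuous_on_g_param[of x] continuous_on_eq_continuous_at[OF T(1)]
  by (metis isCont_def tendsto_at_iff_tendsto_nhds)

lemma continuous_on_g_x: "t \<in> T \<Longrightarrow> continuous_on {-h..h} (g t)"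
proof -
  assume "t \<in> T"
  then have "continuous_on {-h..h} (\<lambda>x. (\<lambda>(t, x). g t x) (t, x))"
    by (intro continuous_on_compose2[OF continuous_on_g] continuous_intros) auto
  then show ?thesis by simp
qed

text \<open>Isolation of the zero gives \<open>g\<close> definite signs at \<open>-h\<close> and
  \<open>h\<close>, which both perturbations inherit.\<close>

lemma g_base_nonzero:
  assumes "x \<noteq> 0" "\<bar>x\<bar> \<le> h"
  shows "g (1, 0) x \<noteq> 0"
proof
  assume "g (1, 0) x = 0"
  then have "H (Z (1, 0) x) = cnj (Z (1, 0) x)" using Z_eq[OF T(2) assms(2)] by simp
  then have "Z (1, 0) x = 0" using isolated Z_in_ball[OF T(2) assms(2)] by blast
  then show False using assms by (simp add: Z_def complex_eq_iff)
qed

lemma eventually_zero_between: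
  assumes t: "t \<in> T" and x: "-h \<le> x1" "x1 < x2" "x2 \<le> h" and sgn: "g t x1 * g t x2 < 0"
  shows "\<forall>\<^sub>F t' in nhds t. \<exists>x. x1 < x \<and> x < x2 \<and> g t' x = 0"
proof -
  have "((\<lambda>t. g t x1 * g t x2) \<longlongrightarrow> g t x1 * g t x2) (nhds t)"
    using x t by (intro tendsto_mult g_tendsto) auto
  then have "\<forall>\<^sub>F t' in nhds t. g t' x1 * g t' x2 < 0" using sgn by (rule order_tendstoD)
  moreover have "\<forall>\<^sub>F t' in nhds t. t' \<in> T" using T(1) t by (rule eventually_nhds_in_open)
  ultimately show ?thesis
  proof eventually_elim
    case (elim t')
    have c: "continuous_on {x1..x2} (g t')" using x by (intro continuous_on_subset[OF continuous_on_g_x[OF elim(2)]]) auto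
    have "\<exists>x. x1 \<le> x \<and> x \<le> x2 \<and> g t' x = 0"
      using elim(1) x c IVT'[of "g t'" x1 0 x2] IVT2'[of "g t'" x2 0 x1] by (auto simp: mult_less_0_iff)
    then obtain y where y: "x1 \<le> y" "y \<le> x2" "g t' y = 0" by blast
    moreover have "y \<noteq> x1" "y \<noteq> x2" using y elim(1) by auto
    ultimately show ?case by (intro exI[of _ y]) auto
  qed
qed

lemma zeros_geI:
  assumes t: "t \<in> T"
    and ev: "\<forall>\<^sub>F t' in nhds t. \<exists>Y. finite Y \<and> card Y = k \<and> (\<forall>x\<in>Y. \<bar>x\<bar> \<le> h \<and> g t' x = 0)"
  shows "zeros_ge k t"
  unfolding zeros_ge_def
  using ev eventually_nhds_in_open[OF T(1) t]
proof eventually_elim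
  case (elim t')
  then obtain Y where Y: "finite Y" "card Y = k" "\<forall>x\<in>Y. \<bar>x\<bar> \<le> h \<and> g t' x = 0" by blast
  have "inj_on (Z t') Y" by (auto simp: inj_on_def Z_def)
  then show ?case
    using Y Z_in_ball[OF elim(2)] Z_eq[OF elim(2)]
    by (intro exI[of _ "Z t' ` Y"]) (auto simp: card_image)
qed

lemma zeros_ge_0: "zeros_ge 0 t"
  unfolding zeros_ge_def by (intro always_eventually allI exI[of _ "{}"]) auto

lemma zeros_ge_1:
  assumes "t \<in> T" "-h \<le> x1" "x1 < x2" "x2 \<le> h" "g t x1 * g t x2 < 0"
  shows "zeros_ge 1 t"
proof (rule zeros_geI[OF assms(1)])
  show "\<forall>\<^sub>F t' in nhds t. \<exists>Y. finite Y \<and> card Y = 1 \<and> (\<forall>x\<in>Y. \<bar>x\<bar> \<le> h \<and> g t' x = 0)"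
    using eventually_zero_between[OF assms]
  proof eventually_elim
    case (elim t')
    then obtain x where "x1 < x" "x < x2" "g t' x = 0" by blast
    then show ?case using assms by (intro exI[of _ "{x}"]) auto
  qed
qed

lemma zeros_ge_2:
  assumes t: "t \<in> T" and x: "-h \<le> x1" "x1 < x2" "x2 \<le> x3" "x3 < x4" "x4 \<le> h"
    and s: "g t x1 * g t x2 < 0" "g t x3 * g t x4 < 0"
  shows "zeros_ge 2 t"
proof (rule zeros_geI[OF t])
  have "\<forall>\<^sub>F t' in nhds t. \<exists>x. x1 < x \<and> x < x2 \<and> g t' x = 0"
    "\<forall>\<^sub>F t' in nhds t. \<exists>x. x3 < x \<and> x < x4 \<and> g t' x = 0"
    using x s by (auto intro!: eventually_zero_between[OF t])
  then show "\<forall>\<^sub>F t' in nhds t. \<exists>Y. finite Y \<and> card Y = 2 \<and> (\<forall>x\<in>Y. \<bar>x\<bar> \<le> h \<and> g t' x = 0)"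
  proof eventually_elim
    case (elim t')
    then obtain u v where "x1 < u" "u < x2" "g t' u = 0" "x3 < v" "v < x4" "g t' v = 0" by blast
    then show ?case using x by (intro exI[of _ "{u, v}"]) auto
  qed
qed

lemma zeros_ge_3:
  assumes t: "t \<in> T" and x: "-h \<le> x1" "x1 < x2" "x2 < x3" "x3 < x4" "x4 \<le> h"
    and s: "g t x1 * g t x2 < 0" "g t x2 * g t x3 < 0" "g t x3 * g t x4 < 0"
  shows "zeros_ge 3 t"
proof (rule zeros_geI[OF t])
  have "\<forall>\<^sub>F t' in nhds t. \<exists>x. x1 < x \<and> x < x2 \<and> g t' x = 0"
    "\<forall>\<^sub>F t' in nhds t. \<exists>x. x2 < x \<and> x < x3 \<and> g t' x = 0"
    "\<forall>\<^sub>F t' in nhds t. \<exists>x. x3 < x \<and> x < x4 \<and> g t' x = 0"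
    using x s by (auto intro!: eventually_zero_between[OF t])
  then show "\<forall>\<^sub>F t' in nhds t. \<exists>Y. finite Y \<and> card Y = 3 \<and> (\<forall>x\<in>Y. \<bar>x\<bar> \<le> h \<and> g t' x = 0)"
  proof eventually_elim
    case (elim t')
    then obtain u v w where "x1 < u" "u < x2" "g t' u = 0" "x2 < v" "v < x3" "g t' v = 0"
      "x3 < w" "w < x4" "g t' w = 0" by blast
    then show ?case using x by (intro exI[of _ "{u, v, w}"]) auto
  qed
qed

end

section \<open>Sign changes under opposite perturbations\<close>

lemma mult_neg_of_signs:
  fixes u v L M :: real
  shows "u * L > 0 \<Longrightarrow> v * M > 0 \<Longrightarrow> L * M < 0 \<Longrightarrow> u * v < 0"
  by (auto simp: zero_less_mult_iff mult_less_0_iff)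

context reduced_model
begin

lemma eventually_along_ray:
  fixes Q :: "complex \<times> complex \<Rightarrow> bool"
  assumes "\<forall>\<^sub>F t in nhds (1, 0). Q t"
  shows "\<exists>\<epsilon>0>0. \<forall>\<epsilon>::real. \<bar>\<epsilon>\<bar> < \<epsilon>0 \<longrightarrow> Q (1 + of_real \<epsilon> * \<alpha>, of_real \<epsilon> * \<beta>)"
proof -
  have "((\<lambda>\<epsilon>::real. (1 + of_real \<epsilon> * \<alpha>, of_real \<epsilon> * \<beta>)) \<longlongrightarrow> (1 + of_real 0 * \<alpha>, of_real 0 * \<beta>)) (nhds 0)"
    by (intro tendsto_intros filterlim_ident)
  then have "filterlim (\<lambda>\<epsilon>::real. (1 + of_real \<epsilon> * \<alpha>, of_real \<epsilon> * \<beta>)) (nhds (1, 0)) (nhds 0)"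
    by simp
  then have "\<forall>\<^sub>F \<epsilon>::real in nhds 0. Q (1 + of_real \<epsilon> * \<alpha>, of_real \<epsilon> * \<beta>)"
    using assms by (rule eventually_compose_filterlim[rotated])
  then show ?thesis by (simp add: eventually_nhds_metric dist_real_def)
qed

lemma eventually_T: "\<forall>\<^sub>F t in nhds (1, 0). t \<in> T"
  using T by (rule eventually_nhds_in_open)

lemma eventually_same_sign:
  assumes "x \<noteq> 0" "\<bar>x\<bar> \<le> h"
  shows "\<forall>\<^sub>F t in nhds (1, 0). g t x * g (1, 0) x > 0"
proof (rule order_tendstoD)
  show "((\<lambda>t. g t x * g (1, 0) x) \<longlongrightarrow> g (1, 0) x * g (1, 0) x) (nhds (1, 0))"
    using T assms by (intro tendsto_intros g_tendsto)
  show "0 < g (1, 0) x * g (1, 0) x"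
    using g_base_nonzero[OF assms] by (auto simp: zero_less_mult_iff neq_iff)
qed

text \<open>To first order \<open>g\<close> at 0 is \<open>\<epsilon> * Re \<beta>\<close>. The
  curve meets the imaginary axis at a height \<open>y\<close> of order \<epsilon>, so the remainder
  of \<open>H\<close> is o(\<epsilon>) and the product of \<open>y\<close> with \<open>Im a\<close>
  is quadratic.\<close>

lemma g_at_0_sign:
  assumes \<beta>: "Re \<beta> \<noteq> 0"
  shows "\<exists>\<epsilon>0>0. \<forall>\<epsilon>::real. \<epsilon> \<noteq> 0 \<longrightarrow> \<bar>\<epsilon>\<bar> < \<epsilon>0 \<longrightarrow>
           g (1 + of_real \<epsilon> * \<alpha>, of_real \<epsilon> * \<beta>) 0 * (\<epsilon> * Re \<beta>) > 0"
proof -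
  define K where "K = norm \<beta>"
  have K: "K > 0" using \<beta> by (auto simp: K_def)
  \<comment> \<open>With \<open>\<bar>y\<bar> \<le> 2 * \<bar>\<epsilon>\<bar> * K\<close> and
    \<open>norm a < 3/2\<close> this makes the remainder at most 3/16 of
    \<open>\<bar>\<epsilon> * Re \<beta>\<bar>\<close>; the last bound in \<open>\<epsilon>0\<close>
    makes the quadratic term at most 1/4 of it. Together they stay below the main term.\<close>
  define \<tau> where "\<tau> = \<bar>Re \<beta>\<bar> / (16 * K)"
  have \<tau>: "\<tau> > 0" using \<beta> K by (simp add: \<tau>_def)
  obtain d where d: "d > 0" "\<And>\<zeta>. norm \<zeta> < d \<Longrightarrow> norm (H \<zeta> - of_real A * \<zeta>) \<le> \<tau> * norm \<zeta>"
    using der[OF \<tau>] by blast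
  obtain \<epsilon>1 where \<epsilon>1: "\<epsilon>1 > 0"
    "\<And>\<epsilon>::real. \<bar>\<epsilon>\<bar> < \<epsilon>1 \<Longrightarrow> (1 + of_real \<epsilon> * \<alpha>, of_real \<epsilon> * \<beta>) \<in> T"
    using eventually_along_ray[OF eventually_T, of \<alpha> \<beta>] by blast
  define \<epsilon>0 where "\<epsilon>0 = min \<epsilon>1 (min (d / (2 * K + 1)) (\<bar>Re \<beta>\<bar> / (8 * A * K * norm \<alpha> + 1)))"
  have den: "8 * A * K * norm \<alpha> + 1 > 0" using A K by (simp add: add_nonneg_pos)
  have pos: "\<epsilon>0 > 0" using \<epsilon>1 d K \<beta> den by (simp add: \<epsilon>0_def)
  have "g (1 + of_real \<epsilon> * \<alpha>, of_real \<epsilon> * \<beta>) 0 * (\<epsilon> * Re \<beta>) > 0" if \<epsilon>: "\<epsilon> \<noteq> 0" "\<bar>\<epsilon>\<bar> < \<epsilon>0" for \<epsilon> :: real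
  proof -
    define t where "t = (1 + of_real \<epsilon> * \<alpha>, of_real \<epsilon> * \<beta>)"
    define a where "a = 1 + of_real \<epsilon> * \<alpha>"
    define y where "y = \<phi> (t, 0)"
    define k where "k = H (Z t 0) - of_real A * Z t 0"
    have t: "t \<in> T" using \<epsilon>1(2)[of \<epsilon>] \<epsilon> by (simp add: t_def \<epsilon>0_def)
    have x0: "\<bar>0::real\<bar> \<le> h" using h by simp
    have Z0: "Z t 0 = \<i> * of_real y" by (simp add: Z_def y_def complex_eq_iff)
    have nZ: "norm (Z t 0) = \<bar>y\<bar>" by (simp add: Z0 norm_mult)
    have a1: "norm (a - 1) < 1/2" using T_near[OF t] by (simp add: t_def a_def)
    have na: "norm a < 3/2" using norm_triangle_sub[of a 1] a1 by simp
    have "\<bar>Re (a - 1)\<bar> < 1/2" using abs_Re_le_cmod[of "a - 1"] a1 by simp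
    then have Ra: "Re a > 0" by (simp add: abs_if split: if_splits)
    have eq: "a * (of_real A * (\<i> * of_real y) + k) + of_real \<epsilon> * \<beta> = - \<i> * of_real y + of_real (g t 0)"
    proof -
      have Hk: "H (Z t 0) = of_real A * (\<i> * of_real y) + k" unfolding k_def Z0[symmetric] by simp
      have cz: "cnj (Z t 0) = - \<i> * of_real y" by (simp add: Z0)
      have ft: "fst t = a" "snd t = of_real \<epsilon> * \<beta>" by (simp_all add: t_def a_def)
      show ?thesis using Z_eq[OF t x0] unfolding Hk cz ft .
    qed
    have im: "A * y * Re a + Im (a * k) + \<epsilon> * Im \<beta> = - y"
      using arg_cong[where f = Im, OF eq] by (simp add: algebra_simps)
    have re: "g t 0 = - (A * y * Im a) + Re (a * k) + \<epsilon> * Re \<beta>"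
      using arg_cong[where f = Re, OF eq] by (simp add: algebra_simps)
    have "norm k \<le> norm (Z t 0 - 0) / 4"
      using lip[OF Z_in_ball[OF t x0], of 0] D by (simp add: k_def H0)
    then have "norm (a * k) \<le> 3/2 * (\<bar>y\<bar> / 4)" unfolding norm_mult using na nZ by (intro mult_mono) auto
    then have ak: "\<bar>Im (a * k)\<bar> \<le> \<bar>y\<bar> / 2" using abs_Im_le_cmod[of "a * k"] by linarith
    have "y * (1 + A * Re a) = - Im (a * k) - \<epsilon> * Im \<beta>" using im by (simp add: algebra_simps)
    moreover have "\<bar>y * (1 + A * Re a)\<bar> = \<bar>y\<bar> * (1 + A * Re a)"
      using A Ra by (simp add: abs_mult)
    ultimately have "\<bar>y\<bar> * (1 + A * Re a) = \<bar>- Im (a * k) - \<epsilon> * Im \<beta>\<bar>" by simp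
    also have "\<dots> \<le> \<bar>y\<bar> / 2 + \<bar>\<epsilon>\<bar> * K"
    proof -
      have "\<bar>\<epsilon> * Im \<beta>\<bar> \<le> \<bar>\<epsilon>\<bar> * K"
        unfolding abs_mult K_def by (intro mult_left_mono abs_Im_le_cmod) auto
      then show ?thesis using ak by linarith
    qed
    finally have "\<bar>y\<bar> * (1 + A * Re a) \<le> \<bar>y\<bar> / 2 + \<bar>\<epsilon>\<bar> * K" .
    moreover have "\<bar>y\<bar> * 1 \<le> \<bar>y\<bar> * (1 + A * Re a)" using A Ra by (intro mult_left_mono) auto
    ultimately have y: "\<bar>y\<bar> \<le> 2 * \<bar>\<epsilon>\<bar> * K" by linarith
    have "\<bar>\<epsilon>\<bar> * (2 * K + 1) < d" using \<epsilon> K by (simp add: \<epsilon>0_def pos_less_divide_eq)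
    moreover have "2 * \<bar>\<epsilon>\<bar> * K \<le> \<bar>\<epsilon>\<bar> * (2 * K + 1)" by (simp add: algebra_simps)
    ultimately have "norm (Z t 0) < d" using y nZ by linarith
    then have "norm k \<le> \<tau> * \<bar>y\<bar>" using d(2)[of "Z t 0"] nZ by (simp add: k_def)
    also have "\<dots> \<le> \<tau> * (2 * \<bar>\<epsilon>\<bar> * K)" using y \<tau> by (intro mult_left_mono) auto
    also have "\<dots> = \<bar>\<epsilon>\<bar> * \<bar>Re \<beta>\<bar> / 8" using K by (simp add: \<tau>_def)
    finally have "norm (a * k) \<le> 3/2 * (\<bar>\<epsilon>\<bar> * \<bar>Re \<beta>\<bar> / 8)"
      unfolding norm_mult using na by (intro mult_mono) auto
    then have r1: "\<bar>Re (a * k)\<bar> \<le> 3/16 * (\<bar>\<epsilon>\<bar> * \<bar>Re \<beta>\<bar>)" using abs_Re_le_cmod[of "a * k"] by linarith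
    have "\<bar>Im a\<bar> \<le> \<bar>\<epsilon>\<bar> * norm \<alpha>"
      using abs_Im_le_cmod[of "of_real \<epsilon> * \<alpha>"] by (simp add: a_def norm_mult)
    then have "\<bar>A * y * Im a\<bar> \<le> A * (2 * \<bar>\<epsilon>\<bar> * K) * (\<bar>\<epsilon>\<bar> * norm \<alpha>)"
      unfolding abs_mult using A y K by (intro mult_mono) auto
    also have "\<dots> = \<bar>\<epsilon>\<bar> * (\<bar>\<epsilon>\<bar> * (8 * A * K * norm \<alpha>)) / 4" by simp
    also have "\<dots> \<le> \<bar>\<epsilon>\<bar> * \<bar>Re \<beta>\<bar> / 4"
    proof -
      have "\<bar>\<epsilon>\<bar> * (8 * A * K * norm \<alpha> + 1) < \<bar>Re \<beta>\<bar>" using \<epsilon> den by (simp add: \<epsilon>0_def pos_less_divide_eq)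
      then have "\<bar>\<epsilon>\<bar> * (8 * A * K * norm \<alpha>) \<le> \<bar>Re \<beta>\<bar>" using abs_ge_zero[of \<epsilon>] by (simp add: distrib_left)
      then show ?thesis by (intro divide_right_mono mult_left_mono) auto
    qed
    finally have r2: "\<bar>A * y * Im a\<bar> \<le> \<bar>\<epsilon>\<bar> * \<bar>Re \<beta>\<bar> / 4" .
    define m where "m = \<epsilon> * Re \<beta>"
    have m: "\<bar>m\<bar> > 0" "\<bar>m\<bar> = \<bar>\<epsilon>\<bar> * \<bar>Re \<beta>\<bar>" using \<epsilon> \<beta> by (auto simp: m_def abs_mult)
    have "\<bar>g t 0 - m\<bar> < \<bar>m\<bar>" using r1 r2 m unfolding re m_def[symmetric] by linarith
    then have "g t 0 * m > 0" using m by (cases "m > 0") (auto simp: zero_less_mult_iff)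
    then show ?thesis by (simp add: t_def m_def)
  qed
  then show ?thesis using pos by blast
qed

text \<open>If \<open>g\<close> has opposite signs at \<open>-h\<close> and \<open>h\<close>, each
  perturbation keeps one zero. If the signs agree, exactly one of the two values of
  \<plusminus>\<epsilon> gives \<open>g\<close> the opposite sign at 0, and that perturbation has
  two zeros. This covers singular zeros too, as long as they are moved with
  \<open>Re \<beta> \<noteq> 0\<close>.\<close>

theorem zeros_ge_transversal:
  assumes \<beta>: "Re \<beta> \<noteq> 0"
  shows "\<exists>\<epsilon>0>0. \<forall>\<epsilon>::real. 0 < \<epsilon> \<longrightarrow> \<epsilon> < \<epsilon>0 \<longrightarrow> (\<exists>k1 k2. k1 + k2 \<ge> 2
           \<and> zeros_ge k1 (1 + of_real \<epsilon> * \<alpha>, of_real \<epsilon> * \<beta>)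
           \<and> zeros_ge k2 (1 + of_real (-\<epsilon>) * \<alpha>, of_real (-\<epsilon>) * \<beta>))"
proof -
  define t where "t = (\<lambda>\<epsilon>::real. (1 + of_real \<epsilon> * \<alpha>, of_real \<epsilon> * \<beta>))"
  define L where "L = g (1, 0) (-h)"
  define R where "R = g (1, 0) h"
  have "\<forall>\<^sub>F t in nhds (1, 0). t \<in> T \<and> g t (-h) * L > 0 \<and> g t h * R > 0"
    unfolding L_def R_def using h by (intro eventually_conj eventually_T eventually_same_sign) auto
  from eventually_along_ray[OF this, of \<alpha> \<beta>] obtain \<epsilon>1 where \<epsilon>1: "\<epsilon>1 > 0"
    "\<And>\<epsilon>. \<bar>\<epsilon>\<bar> < \<epsilon>1 \<Longrightarrow> t \<epsilon> \<in> T \<and> g (t \<epsilon>) (-h) * L > 0 \<and> g (t \<epsilon>) h * R > 0"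
    unfolding t_def by blast
  from g_at_0_sign[OF \<beta>, of \<alpha>] obtain \<epsilon>2 where \<epsilon>2: "\<epsilon>2 > 0"
    "\<And>\<epsilon>. \<epsilon> \<noteq> 0 \<Longrightarrow> \<bar>\<epsilon>\<bar> < \<epsilon>2 \<Longrightarrow> g (t \<epsilon>) 0 * (\<epsilon> * Re \<beta>) > 0"
    unfolding t_def by blast
  have "\<exists>k1 k2. k1 + k2 \<ge> 2 \<and> zeros_ge k1 (t \<epsilon>) \<and> zeros_ge k2 (t (-\<epsilon>))"
    if \<epsilon>: "0 < \<epsilon>" "\<epsilon> < min \<epsilon>1 \<epsilon>2" for \<epsilon>
  proof -
    have p: "t \<epsilon> \<in> T" "g (t \<epsilon>) (-h) * L > 0" "g (t \<epsilon>) h * R > 0" "g (t \<epsilon>) 0 * (\<epsilon> * Re \<beta>) > 0"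
      and m: "t (-\<epsilon>) \<in> T" "g (t (-\<epsilon>)) (-h) * L > 0" "g (t (-\<epsilon>)) h * R > 0" "g (t (-\<epsilon>)) 0 * (- \<epsilon> * Re \<beta>) > 0"
      using \<epsilon>1(2)[of \<epsilon>] \<epsilon>1(2)[of "-\<epsilon>"] \<epsilon>2(2)[of \<epsilon>] \<epsilon>2(2)[of "-\<epsilon>"] \<epsilon> by auto
    have one: "zeros_ge 1 (t e)" if "t e \<in> T" "g (t e) (-h) * g (t e) h < 0" for e
      using zeros_ge_1[OF that(1), of "-h" h] h that(2) by simp
    have two: "zeros_ge 2 (t e)" if "t e \<in> T" "g (t e) (-h) * g (t e) 0 < 0" "g (t e) 0 * g (t e) h < 0" for e
      using zeros_ge_2[OF that(1), of "-h" 0 0 h] h that by simp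
    have LR: "L \<noteq> 0" "R \<noteq> 0" using p(2,3) by auto
    show ?thesis
    proof (cases "L * R < 0")
      case True
      have "zeros_ge 1 (t \<epsilon>)" "zeros_ge 1 (t (-\<epsilon>))"
        by (rule one[OF p(1) mult_neg_of_signs[OF p(2,3) True]], rule one[OF m(1) mult_neg_of_signs[OF m(2,3) True]])
      then show ?thesis by (intro exI[of _ 1]) auto
    next
      case False
      then have *: "b * R < 0" if "L * b < 0" for b
        using that LR by (auto simp: mult_less_0_iff not_less zero_le_mult_iff)
      have "L * (\<epsilon> * Re \<beta>) \<noteq> 0" using LR \<epsilon> \<beta> by simp
      then consider "L * (\<epsilon> * Re \<beta>) < 0" | "L * (- \<epsilon> * Re \<beta>) < 0" by fastforce
      then show ?thesis
      proof cases
        case 1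
        have "zeros_ge 2 (t \<epsilon>)"
          by (rule two[OF p(1) mult_neg_of_signs[OF p(2,4) 1] mult_neg_of_signs[OF p(4,3) *[OF 1]]])
        then show ?thesis using zeros_ge_0 by (intro exI[of _ 2] exI[of _ 0]) auto
      next
        case 2
        have "zeros_ge 2 (t (-\<epsilon>))"
          by (rule two[OF m(1) mult_neg_of_signs[OF m(2,4) 2] mult_neg_of_signs[OF m(4,3) *[OF 2]]])
        then show ?thesis using zeros_ge_0 by (intro exI[of _ 0] exI[of _ 2]) auto
      qed
    qed
  qed
  then show ?thesis
    unfolding t_def using \<epsilon>1(1) \<epsilon>2(1) by (intro exI[of _ "min \<epsilon>1 \<epsilon>2"]) auto
qed

text \<open>With second parameter 0 the zero stays in place and its multiplier has modulus
  \<open>norm a\<close>, no longer 1. So \<open>g\<close> changes sign at 0, in a direction given by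
  the sign of \<open>(norm a)\<^sup>2 - 1\<close>.\<close>

lemma g_fixed_sign:
  assumes A1: "A = 1" and t: "(a, 0) \<in> T" and na: "norm a \<noteq> 1"
  shows "\<exists>x1>0. x1 < h \<and> (\<forall>x. x \<noteq> 0 \<longrightarrow> \<bar>x\<bar> \<le> x1 \<longrightarrow> g (a, 0) x * (((norm a)\<^sup>2 - 1) * x) > 0)"
proof -
  define m where "m = (norm a)\<^sup>2 - 1"
  have m0: "m \<noteq> 0" using na by (auto simp: m_def abs_square_eq_1[of "norm a", simplified])
  \<comment> \<open>This choice gives \<open>norm E \<le> \<bar>m\<bar> * norm \<zeta> / 12\<close>,
    hence \<open>\<bar>m\<bar> * norm \<zeta> \<le> 3 * \<bar>G\<bar>\<close>, and so
    \<open>E\<close> is at most a quarter of \<open>G\<close>.\<close>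
  define \<tau> where "\<tau> = \<bar>m\<bar> / 72"
  have \<tau>: "\<tau> > 0" using m0 by (simp add: \<tau>_def)
  obtain d where d: "d > 0" "\<And>\<zeta>. norm \<zeta> < d \<Longrightarrow> norm (H \<zeta> - of_real A * \<zeta>) \<le> \<tau> * norm \<zeta>"
    using der[OF \<tau>] by blast
  have a1: "norm (a - 1) < 1/2" using T_near[OF t] by simp
  have na2: "norm a < 3/2" using norm_triangle_sub[of a 1] a1 by simp
  have "\<bar>Re (a - 1)\<bar> < 1/2" using abs_Re_le_cmod[of "a - 1"] a1 by simp
  then have Ra: "Re a > 0" by (simp add: abs_if split: if_splits)
  have "\<phi> ((a, 0), 0) = 0"
  proof (rule \<phi>_unique[OF t])
    have "Complex 0 0 = 0" by (simp add: complex_eq_iff)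
    then show "V ((a, 0), 0) 0 = 0" by (simp add: V_def H0)
  qed (use h \<delta> in auto)
  then have Z0: "Z (a, 0) 0 = 0" by (simp add: Z_def complex_eq_iff)
  have "continuous_on {-h..h} (Z (a, 0))"
  proof -
    have "continuous_on {-h..h} (\<lambda>x. Complex x (\<phi> ((a, 0), x)))"
      using t by (intro continuous_intros continuous_on_compose2[OF cont\<phi>]) auto
    then show ?thesis by (simp add: Z_def)
  qed
  then have "continuous (at 0 within {-h..h}) (Z (a, 0))" using h by (auto simp: continuous_on_eq_continuous_within)
  then obtain \<eta> where \<eta>: "\<eta> > 0" "\<And>x. x \<in> {-h..h} \<Longrightarrow> dist x 0 < \<eta> \<Longrightarrow> dist (Z (a, 0) x) (Z (a, 0) 0) < d"
    using d(1) unfolding continuous_within_eps_delta by blast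
  define x1 where "x1 = min h \<eta> / 2"
  have x1: "x1 > 0" "x1 < h" "x1 < \<eta>" using h \<eta> by (auto simp: x1_def)
  have "g (a, 0) x * (m * x) > 0" if x: "x \<noteq> 0" "\<bar>x\<bar> \<le> x1" for x
  proof -
    define \<zeta> where "\<zeta> = Z (a, 0) x"
    define G where "G = g (a, 0) x"
    define k where "k = a * (H \<zeta> - \<zeta>)"
    have xh: "\<bar>x\<bar> \<le> h" using x x1 by simp
    have "norm \<zeta> < d" using \<eta>(2)[of x] x x1 xh by (auto simp: \<zeta>_def Z0 abs_le_iff)
    then have "norm (H \<zeta> - \<zeta>) \<le> \<tau> * norm \<zeta>" using d(2)[of \<zeta>] A1 by simp
    then have k: "norm k \<le> 3/2 * (\<tau> * norm \<zeta>)" unfolding k_def norm_mult using na2 by (intro mult_mono) auto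
    have w: "a * \<zeta> - cnj \<zeta> = of_real G - k"
      using Z_eq[OF t xh] by (simp add: \<zeta>_def G_def k_def algebra_simps)
    define E where "E = cnj k + cnj a * k"
    \<comment> \<open>Adding \<open>cnj a\<close> times the relation \<open>w\<close> to its
      conjugate eliminates \<open>cnj \<zeta>\<close>.\<close>
    have "of_real m * \<zeta> = cnj (a * \<zeta> - cnj \<zeta>) + cnj a * (a * \<zeta> - cnj \<zeta>)"
      using complex_norm_square[of a] by (simp add: m_def algebra_simps)
    also have "\<dots> = (1 + cnj a) * of_real G - E"
      unfolding w by (simp add: E_def algebra_simps)
    finally have id: "of_real m * \<zeta> = (1 + cnj a) * of_real G - E" .
    have "norm E \<le> norm k + norm a * norm k"
      unfolding E_def using norm_triangle_ineq[of "cnj k" "cnj a * k"] by (simp add: norm_mult)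
    also have "\<dots> \<le> norm k + 3/2 * norm k" using na2 by (intro add_left_mono mult_right_mono) auto
    also have "\<dots> \<le> 6 * (\<tau> * norm \<zeta>)"
      using k mult_nonneg_nonneg[OF less_imp_le[OF \<tau>] norm_ge_zero[of \<zeta>]] by linarith
    also have "\<dots> = \<bar>m\<bar> * norm \<zeta> / 12" by (simp add: \<tau>_def)
    finally have E: "norm E \<le> \<bar>m\<bar> * norm \<zeta> / 12" .
    have "\<bar>m\<bar> * norm \<zeta> = norm (of_real m * \<zeta>)" by (simp add: norm_mult)
    also have "\<dots> \<le> norm ((1 + cnj a) * of_real G) + norm E" unfolding id by (rule norm_triangle_ineq4)
    also have "norm ((1 + cnj a) * of_real G) \<le> 5/2 * \<bar>G\<bar>"
      unfolding norm_mult using norm_triangle_ineq[of 1 "cnj a"] na2 by (intro mult_mono) auto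
    finally have "\<bar>m\<bar> * norm \<zeta> \<le> 3 * \<bar>G\<bar>" using E by linarith
    then have E2: "norm E \<le> \<bar>G\<bar> / 4" using E by linarith
    have reZ: "Re \<zeta> = x" by (simp add: \<zeta>_def Z_def)
    have mx: "m * x = (1 + Re a) * G - Re E"
      using arg_cong[where f = Re, OF id] by (simp add: reZ)
    have RE: "\<bar>Re E\<bar> \<le> \<bar>G\<bar> / 4" using E2 abs_Re_le_cmod[of E] by linarith
    have "G \<noteq> 0" using mx RE m0 x(1) by auto
    then have G: "\<bar>Re E\<bar> < \<bar>G\<bar>" using RE by simp
    have "G * (m * x) = Re a * (G * G) + G * (G - Re E)" unfolding mx by (simp add: algebra_simps)
    moreover have "G * (G - Re E) > 0" using G by (cases "G > 0") (auto simp: zero_less_mult_iff abs_if split: if_splits)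
    moreover have "Re a * (G * G) \<ge> 0" using Ra by simp
    ultimately show ?thesis by (simp add: G_def)
  qed
  then show ?thesis using x1 by (auto simp: m_def)
qed

text \<open>For \<epsilon> the function \<open>g\<close> crosses 0 upwards at the fixed zero, for
  -\<epsilon> downwards, while the signs at \<open>-h\<close> and \<open>h\<close> are common to
  both. According to these signs the counts, including the fixed zero, are 2 + 2, 1 + 3, 3 + 1 and 2
  + 2.\<close>

theorem zeros_ge_singular:
  assumes A1: "A = 1" and \<alpha>: "Re \<alpha> > 0"
  shows "\<exists>\<epsilon>0>0. \<forall>\<epsilon>::real. 0 < \<epsilon> \<longrightarrow> \<epsilon> < \<epsilon>0 \<longrightarrow> (\<exists>k1 k2. k1 + k2 \<ge> 4
           \<and> zeros_ge k1 (1 + of_real \<epsilon> * \<alpha>, 0) \<and> zeros_ge k2 (1 + of_real (-\<epsilon>) * \<alpha>, 0))"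
proof -
  define a where "a = (\<lambda>\<epsilon>::real. 1 + of_real \<epsilon> * \<alpha>)"
  define L where "L = g (1, 0) (-h)"
  define R where "R = g (1, 0) h"
  have "\<forall>\<^sub>F t in nhds (1, 0). t \<in> T \<and> g t (-h) * L > 0 \<and> g t h * R > 0"
    unfolding L_def R_def using h by (intro eventually_conj eventually_T eventually_same_sign) auto
  from eventually_along_ray[OF this, of \<alpha> 0] obtain \<epsilon>1 where \<epsilon>1: "\<epsilon>1 > 0"
    "\<And>\<epsilon>. \<bar>\<epsilon>\<bar> < \<epsilon>1 \<Longrightarrow> (a \<epsilon>, 0) \<in> T \<and> g (a \<epsilon>, 0) (-h) * L > 0 \<and> g (a \<epsilon>, 0) h * R > 0"
    unfolding a_def by auto
  \<comment> \<open>Below this bound the quadratic term in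
    \<open>(norm (a (-\<epsilon>)))\<^sup>2 - 1\<close> cannot outweigh the linear one, so the
    modulus does drop below 1.\<close>
  define \<epsilon>2 where "\<epsilon>2 = 2 * Re \<alpha> / (norm \<alpha>)\<^sup>2"
  have \<alpha>0: "\<alpha> \<noteq> 0" using \<alpha> by auto
  have \<epsilon>2: "\<epsilon>2 > 0" using \<alpha> \<alpha>0 by (simp add: \<epsilon>2_def)
  have na: "(norm (a \<epsilon>))\<^sup>2 - 1 = \<epsilon> * (2 * Re \<alpha> + \<epsilon> * (norm \<alpha>)\<^sup>2)" for \<epsilon>
    unfolding cmod_power2 by (simp add: a_def power2_eq_square algebra_simps)
  have "\<exists>k1 k2. k1 + k2 \<ge> 4 \<and> zeros_ge k1 (a \<epsilon>, 0) \<and> zeros_ge k2 (a (-\<epsilon>), 0)"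
    if \<epsilon>: "0 < \<epsilon>" "\<epsilon> < min \<epsilon>1 \<epsilon>2" for \<epsilon>
  proof -
    have p: "(a \<epsilon>, 0) \<in> T" "g (a \<epsilon>, 0) (-h) * L > 0" "g (a \<epsilon>, 0) h * R > 0"
      and m: "(a (-\<epsilon>), 0) \<in> T" "g (a (-\<epsilon>), 0) (-h) * L > 0" "g (a (-\<epsilon>), 0) h * R > 0"
      using \<epsilon>1(2)[of \<epsilon>] \<epsilon>1(2)[of "-\<epsilon>"] \<epsilon> by auto
    have "2 * Re \<alpha> + \<epsilon> * (norm \<alpha>)\<^sup>2 > 0" using \<alpha> \<epsilon> by (simp add: add_pos_nonneg)
    then have pos: "(norm (a \<epsilon>))\<^sup>2 - 1 > 0" unfolding na using \<epsilon> by simp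
    have "\<epsilon> * (norm \<alpha>)\<^sup>2 < 2 * Re \<alpha>" using \<epsilon> \<alpha>0 by (simp add: \<epsilon>2_def pos_less_divide_eq)
    then have neg: "(norm (a (-\<epsilon>)))\<^sup>2 - 1 < 0" unfolding na using \<epsilon> by (simp add: mult_neg_pos)
    obtain u where u: "u > 0" "u < h" "\<And>x. x \<noteq> 0 \<Longrightarrow> \<bar>x\<bar> \<le> u \<Longrightarrow> g (a \<epsilon>, 0) x * (((norm (a \<epsilon>))\<^sup>2 - 1) * x) > 0"
      using g_fixed_sign[OF A1 p(1)] pos by force
    obtain v where v: "v > 0" "v < h" "\<And>x. x \<noteq> 0 \<Longrightarrow> \<bar>x\<bar> \<le> v \<Longrightarrow> g (a (-\<epsilon>), 0) x * (((norm (a (-\<epsilon>)))\<^sup>2 - 1) * x) > 0"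
      using g_fixed_sign[OF A1 m(1)] neg by force
    have gu: "g (a \<epsilon>, 0) u > 0" "g (a \<epsilon>, 0) (-u) < 0"
      using u(3)[of u] u(3)[of "-u"] u(1) pos by (auto simp: zero_less_mult_iff mult_less_0_iff)
    have gv: "g (a (-\<epsilon>), 0) v < 0" "g (a (-\<epsilon>), 0) (-v) > 0"
      using v(3)[of v] v(3)[of "-v"] v(1) neg by (auto simp: zero_less_mult_iff mult_less_0_iff)
    have neg_of: "u * l > 0 \<Longrightarrow> l < 0 \<Longrightarrow> u < 0" and pos_of: "u * l > 0 \<Longrightarrow> l > 0 \<Longrightarrow> u > 0" for u l :: real
      by (auto simp: zero_less_mult_iff)
    note signs = gu gv mult_neg_pos mult_pos_neg
    consider "L < 0" "R < 0" | "L < 0" "R > 0" | "L > 0" "R < 0" | "L > 0" "R > 0"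
      using p(2,3) by (auto simp: zero_less_mult_iff)
    then show ?thesis
    proof cases
      case 1
      note gL = neg_of[OF p(2) 1(1)] neg_of[OF p(3) 1(2)] neg_of[OF m(2) 1(1)] neg_of[OF m(3) 1(2)]
      have "zeros_ge 2 (a \<epsilon>, 0)"
        by (rule zeros_ge_2[OF p(1), of "-u" u u h]) (use u in \<open>simp_all add: signs gL\<close>)
      moreover have "zeros_ge 2 (a (-\<epsilon>), 0)"
        by (rule zeros_ge_2[OF m(1), of "-h" "-v" "-v" v]) (use v in \<open>simp_all add: signs gL\<close>)
      ultimately show ?thesis by (intro exI[of _ 2]) auto
    next
      case 2
      note gL = neg_of[OF p(2) 2(1)] pos_of[OF p(3) 2(2)] neg_of[OF m(2) 2(1)] pos_of[OF m(3) 2(2)]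
      have "zeros_ge 1 (a \<epsilon>, 0)"
        by (rule zeros_ge_1[OF p(1), of "-h" h]) (use h in \<open>simp_all add: signs gL\<close>)
      moreover have "zeros_ge 3 (a (-\<epsilon>), 0)"
        by (rule zeros_ge_3[OF m(1), of "-h" "-v" v h]) (use v in \<open>simp_all add: signs gL\<close>)
      ultimately show ?thesis by (intro exI[of _ 1] exI[of _ 3]) auto
    next
      case 3
      note gL = pos_of[OF p(2) 3(1)] neg_of[OF p(3) 3(2)] pos_of[OF m(2) 3(1)] neg_of[OF m(3) 3(2)]
      have "zeros_ge 3 (a \<epsilon>, 0)"
        by (rule zeros_ge_3[OF p(1), of "-h" "-u" u h]) (use u in \<open>simp_all add: signs gL\<close>)
      moreover have "zeros_ge 1 (a (-\<epsilon>), 0)"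
        by (rule zeros_ge_1[OF m(1), of "-h" h]) (use h in \<open>simp_all add: signs gL\<close>)
      ultimately show ?thesis by (intro exI[of _ 3] exI[of _ 1]) auto
    next
      case 4
      note gL = pos_of[OF p(2) 4(1)] pos_of[OF p(3) 4(2)] pos_of[OF m(2) 4(1)] pos_of[OF m(3) 4(2)]
      have "zeros_ge 2 (a \<epsilon>, 0)"
        by (rule zeros_ge_2[OF p(1), of "-h" "-u" "-u" u]) (use u in \<open>simp_all add: signs gL\<close>)
      moreover have "zeros_ge 2 (a (-\<epsilon>), 0)"
        by (rule zeros_ge_2[OF m(1), of "-v" v v h]) (use v in \<open>simp_all add: signs gL\<close>)
      ultimately show ?thesis by (intro exI[of _ 2]) auto
    qed
  qed
  then show ?thesis
    unfolding a_def using \<epsilon>1(1) \<epsilon>2 by (intro exI[of _ "min \<epsilon>1 \<epsilon>2"]) auto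
qed

end

subsection \<open>Perturbing a singular map\<close>

text \<open>The substitution \<open>z = z\<^sub>0 + \<omega> \<zeta>\<close> turns \<open>cnj z\<close> into \<open>cnj \<zeta> / \<omega>\<close>, so it multiplies the derivative by \<open>\<omega>\<^sup>2\<close>.\<close>

definition half_turn :: "complex \<Rightarrow> complex" where
  "half_turn d = cis (- Arg d / 2)"

lemma norm_half_turn: "norm (half_turn d) = 1"
  by (simp add: half_turn_def)

lemma half_turn_mult: "half_turn d * half_turn d * d = of_real (norm d)"
proof -
  have "d = of_real (norm d) * cis (Arg d)" by (metis rcis_cmod_Arg rcis_def)
  moreover have "half_turn d * half_turn d = cis (- Arg d)" by (simp add: half_turn_def cis_mult)
  moreover have "cis (- x) * (r * cis x) = r" for x r
    by (metis cis_mult cis_zero mult.commute mult.left_commute mult.right_neutral add.left_inverse)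
  ultimately show ?thesis by metis
qed

definition zeros_near :: "complex poly \<Rightarrow> complex poly \<Rightarrow> complex \<Rightarrow> real \<Rightarrow> nat \<Rightarrow> complex \<times> complex \<Rightarrow> bool" where
  "zeros_near p q z0 r k t \<longleftrightarrow> (\<forall>\<^sub>F t' in nhds t. \<exists>X. finite X \<and> card X = k \<and>
      X \<subseteq> {z \<in> ball z0 r. poly q z \<noteq> 0 \<and> fst t' * rat_fun p q z + snd t' = cnj z})"

definition model_map :: "complex poly \<Rightarrow> complex poly \<Rightarrow> complex \<Rightarrow> complex \<Rightarrow> complex" where
  "model_map p q z0 \<zeta> = (let \<omega> = half_turn (rat_deriv p q z0) in \<omega> * (rat_fun p q (z0 + \<omega> * \<zeta>) - cnj z0))"

lemma isCont_rat_deriv: "poly q z \<noteq> 0 \<Longrightarrow> isCont (rat_deriv p q) z"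
  unfolding rat_deriv_def by (intro continuous_intros) auto

lemma local_model_exists:
  assumes z0: "z0 \<in> cnj_fixed p q" and r: "r > 0"
    and iso: "\<And>z. z \<in> ball z0 r \<Longrightarrow> z \<in> cnj_fixed p q \<Longrightarrow> z = z0"
  shows "\<exists>D. D \<le> r \<and> (\<forall>z\<in>ball z0 D. poly q z \<noteq> 0)
    \<and> local_model (model_map p q z0) (norm (rat_deriv p q z0)) D"
proof -
  have qz0: "poly q z0 \<noteq> 0" and rz0: "rat_fun p q z0 = cnj z0" using z0 by (auto simp: cnj_fixed_def)
  define d where "d = rat_deriv p q z0"
  define \<omega> where "\<omega> = half_turn d"
  define H where "H = model_map p q z0"
  have H: "H \<zeta> = \<omega> * (rat_fun p q (z0 + \<omega> * \<zeta>) - cnj z0)" for \<zeta>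
    by (simp add: H_def model_map_def Let_def \<omega>_def d_def)
  have n\<omega>: "norm \<omega> = 1" by (simp add: \<omega>_def norm_half_turn)
  have \<omega>d: "\<omega> * \<omega> * d = of_real (norm d)" by (simp add: \<omega>_def half_turn_mult)
  define A where "A = norm d"
  have derH: "(H has_field_derivative \<omega> * \<omega> * rat_deriv p q (z0 + \<omega> * \<zeta>)) (at \<zeta> within S)"
    if "poly q (z0 + \<omega> * \<zeta>) \<noteq> 0" for \<zeta> S
  proof -
    have "((\<lambda>\<zeta>. rat_fun p q (z0 + \<omega> * \<zeta>)) has_field_derivative rat_deriv p q (z0 + \<omega> * \<zeta>) * \<omega>) (at \<zeta>)"
      by (rule DERIV_chain2[where g = "\<lambda>\<zeta>. z0 + \<omega> * \<zeta>" and x = \<zeta>, OF rat_fun_has_field_derivative[OF that]])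
         (auto intro!: derivative_eq_intros)
    then have "((\<lambda>\<zeta>. \<omega> * (rat_fun p q (z0 + \<omega> * \<zeta>) - cnj z0)) has_field_derivative
        \<omega> * (rat_deriv p q (z0 + \<omega> * \<zeta>) * \<omega> - 0)) (at \<zeta>)"
      by (intro DERIV_cmult DERIV_diff DERIV_const)
    moreover have "H = (\<lambda>\<zeta>. \<omega> * (rat_fun p q (z0 + \<omega> * \<zeta>) - cnj z0))" by (simp add: H fun_eq_iff)
    ultimately have "(H has_field_derivative \<omega> * \<omega> * rat_deriv p q (z0 + \<omega> * \<zeta>)) (at \<zeta>)"
      by (simp add: mult_ac)
    then show ?thesis by (rule has_field_derivative_at_within)
  qed
  have "((\<lambda>z. norm (\<omega> * \<omega> * rat_deriv p q z - of_real A)) \<longlongrightarrow> norm (\<omega> * \<omega> * d - of_real A)) (nhds z0)"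
    using isCont_rat_deriv[OF qz0, of p] unfolding d_def isCont_def
    by (intro tendsto_intros) (metis tendsto_at_iff_tendsto_nhds)
  then have "((\<lambda>z. norm (\<omega> * \<omega> * rat_deriv p q z - of_real A)) \<longlongrightarrow> 0) (nhds z0)" by (simp add: \<omega>d A_def)
  then have "\<forall>\<^sub>F z in nhds z0. norm (\<omega> * \<omega> * rat_deriv p q z - of_real A) < 1/4"
    by (rule order_tendstoD) simp
  moreover have "\<forall>\<^sub>F z in nhds z0. z \<in> {z. poly q z \<noteq> 0}"
    using open_poly_nonzero qz0 by (intro eventually_nhds_in_open) auto
  ultimately have "\<forall>\<^sub>F z in nhds z0. norm (\<omega> * \<omega> * rat_deriv p q z - of_real A) < 1/4 \<and> poly q z \<noteq> 0"
    by eventually_elim auto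
  then obtain D1 where D1: "D1 > 0"
    "\<And>z. dist z z0 < D1 \<Longrightarrow> norm (\<omega> * \<omega> * rat_deriv p q z - of_real A) < 1/4 \<and> poly q z \<noteq> 0"
    by (auto simp: eventually_nhds_metric)
  define D where "D = min D1 r"
  have D: "D > 0" "D \<le> r" "D \<le> D1" using D1 r by (auto simp: D_def)
  have dz: "dist (z0 + \<omega> * \<zeta>) z0 = norm \<zeta>" for \<zeta> by (simp add: dist_norm norm_mult n\<omega>)
  have q\<zeta>: "poly q (z0 + \<omega> * \<zeta>) \<noteq> 0" if "norm \<zeta> < D" for \<zeta>
    using D1(2)[of "z0 + \<omega> * \<zeta>"] that D by (simp add: dz)
  have "local_model H A D"
  proof
    show "D > 0" "A \<ge> 0" by (simp_all add: D A_def)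
    show "H 0 = 0" by (simp add: H rz0)
    show "continuous_on (ball 0 D) H"
      by (rule DERIV_continuous_on[where D = "\<lambda>\<zeta>. \<omega> * \<omega> * rat_deriv p q (z0 + \<omega> * \<zeta>)"])
         (auto intro!: derH q\<zeta>)
    show "norm (H \<zeta> - H \<xi> - of_real A * (\<zeta> - \<xi>)) \<le> norm (\<zeta> - \<xi>) / 4" if "norm \<zeta> < D" "norm \<xi> < D" for \<zeta> \<xi>
    proof -
      have "norm ((H \<zeta> - of_real A * \<zeta>) - (H \<xi> - of_real A * \<xi>)) \<le> 1/4 * norm (\<zeta> - \<xi>)"
      proof (rule field_differentiable_bound[of "ball 0 D" _ "\<lambda>\<zeta>. \<omega> * \<omega> * rat_deriv p q (z0 + \<omega> * \<zeta>) - of_real A"])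
        fix u :: complex assume u: "u \<in> ball 0 D"
        then show "((\<lambda>\<zeta>. H \<zeta> - of_real A * \<zeta>) has_field_derivative \<omega> * \<omega> * rat_deriv p q (z0 + \<omega> * u) - of_real A) (at u within ball 0 D)"
          by (intro DERIV_diff derH q\<zeta>) (auto intro!: derivative_eq_intros)
        have "dist (z0 + \<omega> * u) z0 < D1" using u D unfolding dz by simp
        then show "norm (\<omega> * \<omega> * rat_deriv p q (z0 + \<omega> * u) - of_real A) \<le> 1/4" using D1(2) by (simp add: less_imp_le)
      qed (use that in auto)
      then show ?thesis by (simp add: algebra_simps)
    qed
    show "\<exists>e>0. \<forall>\<zeta>. norm \<zeta> < e \<longrightarrow> norm (H \<zeta> - of_real A * \<zeta>) \<le> \<tau> * norm \<zeta>" if \<tau>: "\<tau> > 0" for \<tau>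
    proof -
      have "(H has_field_derivative of_real A) (at 0)"
        using derH[of 0 UNIV] qz0 \<omega>d by (simp add: d_def A_def)
      then have "((\<lambda>\<zeta>. H \<zeta> / \<zeta>) \<longlongrightarrow> of_real A) (at 0)"
        by (simp add: has_field_derivative_iff H rz0)
      then have "\<forall>\<^sub>F \<zeta> in at 0. dist (H \<zeta> / \<zeta>) (of_real A) < \<tau>" using \<tau> by (rule tendstoD)
      then obtain e where e: "e > 0" "\<And>\<zeta>. \<zeta> \<noteq> 0 \<Longrightarrow> norm \<zeta> < e \<Longrightarrow> dist (H \<zeta> / \<zeta>) (of_real A) < \<tau>"
        by (auto simp: eventually_at)
      have "norm (H \<zeta> - of_real A * \<zeta>) \<le> \<tau> * norm \<zeta>" if "norm \<zeta> < e" for \<zeta>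
      proof (cases "\<zeta> = 0")
        case True
        then show ?thesis by (simp add: H rz0)
      next
        case False
        have "H \<zeta> - of_real A * \<zeta> = (H \<zeta> / \<zeta> - of_real A) * \<zeta>" using False by (simp add: field_simps)
        then have "norm (H \<zeta> - of_real A * \<zeta>) = dist (H \<zeta> / \<zeta>) (of_real A) * norm \<zeta>"
          by (simp only: norm_mult dist_norm)
        also have "\<dots> \<le> \<tau> * norm \<zeta>" using e(2)[OF False that] by (intro mult_right_mono) auto
        finally show ?thesis .
      qed
      then show ?thesis using e(1) by blast
    qed
    show "\<zeta> = 0" if "norm \<zeta> < D" "H \<zeta> = cnj \<zeta>" for \<zeta>
    proof -
      have "cnj \<omega> * \<omega> = 1" using complex_norm_square[of \<omega>] n\<omega> by (simp add: mult.commute)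
      then have "rat_fun p q (z0 + \<omega> * \<zeta>) - cnj z0 = cnj \<omega> * cnj \<zeta>"
        using that(2) unfolding H by (metis mult.assoc mult_1)
      then have "rat_fun p q (z0 + \<omega> * \<zeta>) = cnj (z0 + \<omega> * \<zeta>)" by (simp add: algebra_simps)
      then have "z0 + \<omega> * \<zeta> \<in> cnj_fixed p q" using q\<zeta>[OF that(1)] by (simp add: cnj_fixed_def)
      moreover have "z0 + \<omega> * \<zeta> \<in> ball z0 r" using dz[of \<zeta>] that(1) D by (simp add: dist_commute)
      ultimately have "\<omega> * \<zeta> = 0" using iso by fastforce
      then show ?thesis using n\<omega> by auto
    qed
  qed
  then show ?thesis
    using D D1(2) by (intro exI[of _ D]) (auto simp: H_def A_def d_def dist_commute)
qed

text \<open>Writing a r + b - cnj z0 as a (r - cnj z0) + (a - 1) cnj z0 + b and rotating gives the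
  constant term \<open>e\<close> of the model. It depends continuously on \<open>(a, b)\<close>, so
  neighbourhoods of parameters pull back.\<close>

lemma zeros_near_from_model:
  assumes lm: "local_model (model_map p q z0) A D" and Dr: "D \<le> r" "\<And>z. z \<in> ball z0 D \<Longrightarrow> poly q z \<noteq> 0"
    and e: "e = half_turn (rat_deriv p q z0) * ((a - 1) * cnj z0 + b)"
    and z: "local_model.zeros_ge (model_map p q z0) D k (a, e)"
  shows "zeros_near p q z0 r k (a, b)"
proof -
  interpret local_model "model_map p q z0" A D by (rule lm)
  define \<omega> where "\<omega> = half_turn (rat_deriv p q z0)"
  have n\<omega>: "norm \<omega> = 1" by (simp add: \<omega>_def norm_half_turn)
  then have \<omega>\<omega>: "cnj \<omega> * \<omega> = 1" using complex_norm_square[of \<omega>] by (simp add: mult.commute)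
  have \<omega>0: "\<omega> \<noteq> 0" using n\<omega> by auto
  define F where "F = (\<lambda>t::complex \<times> complex. (fst t, \<omega> * ((fst t - 1) * cnj z0 + snd t)))"
  have "(F \<longlongrightarrow> F (a, b)) (nhds (a, b))"
    unfolding F_def by (intro tendsto_intros filterlim_ident tendsto_fst tendsto_snd)
  then have "filterlim F (nhds (a, e)) (nhds (a, b))" by (simp add: F_def e \<omega>_def)
  with z[unfolded zeros_ge_def] have "\<forall>\<^sub>F t' in nhds (a, b). \<exists>X. finite X \<and> card X = k \<and>
      X \<subseteq> {\<zeta>. norm \<zeta> < D \<and> fst (F t') * model_map p q z0 \<zeta> + snd (F t') = cnj \<zeta>}"
    by (rule eventually_compose_filterlim)
  then show ?thesis
    unfolding zeros_near_def
  proof eventually_elim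
    case (elim t')
    then obtain X where X: "finite X" "card X = k"
      "\<And>\<zeta>. \<zeta> \<in> X \<Longrightarrow> norm \<zeta> < D \<and> fst (F t') * model_map p q z0 \<zeta> + snd (F t') = cnj \<zeta>" by blast
    define Y where "Y = (\<lambda>\<zeta>. z0 + \<omega> * \<zeta>) ` X"
    have "card Y = k" unfolding Y_def using X(2) \<omega>0 by (subst card_image) (auto simp: inj_on_def)
    moreover have "Y \<subseteq> {z \<in> ball z0 r. poly q z \<noteq> 0 \<and> fst t' * rat_fun p q z + snd t' = cnj z}"
    proof
      fix z assume "z \<in> Y"
      then obtain \<zeta> where \<zeta>: "\<zeta> \<in> X" "z = z0 + \<omega> * \<zeta>" by (auto simp: Y_def)
      have dz: "dist z0 z = norm \<zeta>" by (simp add: \<zeta> dist_norm norm_mult n\<omega>)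
      have "z \<in> ball z0 D" using X(3)[OF \<zeta>(1)] dz by simp
      have "\<omega> * (fst t' * rat_fun p q z + snd t' - cnj z0) = fst (F t') * model_map p q z0 \<zeta> + snd (F t')"
        by (simp add: F_def model_map_def Let_def \<omega>_def[symmetric] \<zeta> algebra_simps)
      then have "\<omega> * (fst t' * rat_fun p q z + snd t' - cnj z0) = cnj \<zeta>" using X(3)[OF \<zeta>(1)] by simp
      then have "fst t' * rat_fun p q z + snd t' - cnj z0 = cnj \<omega> * cnj \<zeta>"
        using \<omega>\<omega> by (metis mult.assoc mult_1)
      then have "fst t' * rat_fun p q z + snd t' = cnj z" by (simp add: \<zeta> algebra_simps)
      then show "z \<in> {z \<in> ball z0 r. poly q z \<noteq> 0 \<and> fst t' * rat_fun p q z + snd t' = cnj z}"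
        using \<open>z \<in> ball z0 D\<close> Dr by auto
    qed
    ultimately show ?case using X(1) by (intro exI[of _ Y]) (auto simp: Y_def)
  qed
qed

lemma reduced_model_exists:
  assumes "local_model H A D"
  shows "\<exists>T h \<phi>. reduced_model H A D T h \<phi>"
proof -
  interpret local_model H A D by (rule assms)
  obtain T h \<phi> where T: "open T" "(1, 0) \<in> T" "0 < h" "h \<le> \<delta>" "\<forall>t\<in>T. norm (fst t - 1) < 1/2"
    "continuous_on (T \<times> {-h..h}) \<phi>"
    "\<forall>s\<in>T \<times> {-h..h}. -\<delta> < \<phi> s \<and> \<phi> s < \<delta> \<and> V s (\<phi> s) = 0"
    using reduction by (elim exE conjE) blast
  have "reduced_model H A D T h \<phi>"
  proof
    show "\<bar>\<phi> (t, x)\<bar> < \<delta> \<and> V (t, x) (\<phi> (t, x)) = 0" if "t \<in> T" "\<bar>x\<bar> \<le> h" for t x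
      using bspec[OF T(7), of "(t, x)"] that by (simp add: abs_le_iff abs_less_iff)
  qed (use T in simp_all)
  then show ?thesis by blast
qed

lemma zeros_near_transversal:
  assumes z0: "z0 \<in> cnj_fixed p q" "r > 0" "\<And>z. z \<in> ball z0 r \<Longrightarrow> z \<in> cnj_fixed p q \<Longrightarrow> z = z0"
    and \<beta>: "Re (half_turn (rat_deriv p q z0) * (\<alpha> * cnj z0 + \<gamma>)) \<noteq> 0"
  shows "\<exists>\<epsilon>0>0. \<forall>\<epsilon>::real. 0 < \<epsilon> \<longrightarrow> \<epsilon> < \<epsilon>0 \<longrightarrow> (\<exists>k1 k2. k1 + k2 \<ge> 2
           \<and> zeros_near p q z0 r k1 (1 + of_real \<epsilon> * \<alpha>, of_real \<epsilon> * \<gamma>)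
           \<and> zeros_near p q z0 r k2 (1 + of_real (-\<epsilon>) * \<alpha>, of_real (-\<epsilon>) * \<gamma>))"
proof -
  obtain D where D: "D \<le> r" "\<And>z. z \<in> ball z0 D \<Longrightarrow> poly q z \<noteq> 0"
    and lm: "local_model (model_map p q z0) (norm (rat_deriv p q z0)) D"
    using local_model_exists[OF z0] by blast
  obtain T h \<phi> where rm: "reduced_model (model_map p q z0) (norm (rat_deriv p q z0)) D T h \<phi>"
    using reduced_model_exists[OF lm] by blast
  define \<beta> where "\<beta> = half_turn (rat_deriv p q z0) * (\<alpha> * cnj z0 + \<gamma>)"
  have e: "of_real \<epsilon> * \<beta> = half_turn (rat_deriv p q z0) * (((1 + of_real \<epsilon> * \<alpha>) - 1) * cnj z0 + of_real \<epsilon> * \<gamma>)"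
    for \<epsilon> :: real by (simp add: \<beta>_def algebra_simps)
  note tr = zeros_near_from_model[OF lm D e]
  show ?thesis
    using reduced_model.zeros_ge_transversal[OF rm \<beta>[folded \<beta>_def], of \<alpha>] tr by meson
qed

text \<open>The second parameter is chosen to make the constant term of the model vanish, so that
  \<open>z0\<close> itself remains a zero.\<close>

lemma zeros_near_singular:
  assumes z0: "z0 \<in> cnj_fixed p q" "r > 0" "\<And>z. z \<in> ball z0 r \<Longrightarrow> z \<in> cnj_fixed p q \<Longrightarrow> z = z0"
    and sing: "norm (rat_deriv p q z0) = 1" and \<alpha>: "Re \<alpha> > 0"
  shows "\<exists>\<epsilon>0>0. \<forall>\<epsilon>::real. 0 < \<epsilon> \<longrightarrow> \<epsilon> < \<epsilon>0 \<longrightarrow> (\<exists>k1 k2. k1 + k2 \<ge> 4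
           \<and> zeros_near p q z0 r k1 (1 + of_real \<epsilon> * \<alpha>, of_real \<epsilon> * - (\<alpha> * cnj z0))
           \<and> zeros_near p q z0 r k2 (1 + of_real (-\<epsilon>) * \<alpha>, of_real (-\<epsilon>) * - (\<alpha> * cnj z0)))"
proof -
  obtain D where D: "D \<le> r" "\<And>z. z \<in> ball z0 D \<Longrightarrow> poly q z \<noteq> 0"
    and lm: "local_model (model_map p q z0) (norm (rat_deriv p q z0)) D"
    using local_model_exists[OF z0] by blast
  obtain T h \<phi> where rm: "reduced_model (model_map p q z0) (norm (rat_deriv p q z0)) D T h \<phi>"
    using reduced_model_exists[OF lm] by blast
  have e: "0 = half_turn (rat_deriv p q z0) * (((1 + of_real \<epsilon> * \<alpha>) - 1) * cnj z0 + of_real \<epsilon> * - (\<alpha> * cnj z0))"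
    for \<epsilon> :: real by (simp add: algebra_simps)
  note tr = zeros_near_from_model[OF lm D e]
  show ?thesis
    using reduced_model.zeros_ge_singular[OF rm sing \<alpha>] tr by meson
qed

text \<open>The parameters with a singular zero form a smooth image of a three-dimensional set: the
  point \<open>z\<close> and the argument of \<open>a * r'(z)\<close> determine them.\<close>

lemma generic_parameter:
  fixes U :: "(complex \<times> complex) set"
  assumes "open U" "t \<in> U"
  shows "\<exists>(a, b)\<in>U. \<forall>z. poly q z \<noteq> 0 \<longrightarrow> a * rat_fun p q z + b = cnj z \<longrightarrow> norm (a * rat_deriv p q z) \<noteq> 1"
proof (rule ccontr)
  assume none: "\<not> ?thesis"
  define W where "W = wronskian p q"
  define S where "S = {x :: complex \<times> real. poly q (fst x) \<noteq> 0 \<and> poly W (fst x) \<noteq> 0}"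
  \<comment> \<open>The equation \<open>a * rat_deriv p q z = cis \<theta>\<close> is solved for
    \<open>a\<close> as \<open>cis \<theta>\<close> times q^2 / W, and then
    \<open>a * rat_fun p q z + b = cnj z\<close> for \<open>b\<close>. Nothing is lost by requiring
    W to be nonzero, as a derivative of modulus 1 / |a| does not vanish.\<close>
  define \<Psi> where "\<Psi> = (\<lambda>x::complex \<times> real. (cis (snd x) * rat_fun (q\<^sup>2) W (fst x),
      cnj (fst x) - cis (snd x) * rat_fun (q\<^sup>2) W (fst x) * rat_fun p q (fst x)))"
  have rat: "(\<lambda>x::complex \<times> real. rat_fun P Q (fst x)) differentiable (at x within S)"
    if "poly Q (fst x) \<noteq> 0" for P Q x
  proof -
    have "(rat_fun P Q has_derivative (*) (rat_deriv P Q (fst x))) (at (fst x))"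
      using rat_fun_has_field_derivative[OF that] by (simp add: has_field_derivative_def)
    then show ?thesis
      using has_derivative_compose[OF has_derivative_fst[OF has_derivative_ident]] differentiableI by blast
  qed
  have cis: "(\<lambda>x::complex \<times> real. cis (snd x)) differentiable (at x within S)" for x
    using has_derivative_cis[OF has_derivative_snd[OF has_derivative_ident]] differentiableI by blast
  have cnj: "(\<lambda>x::complex \<times> real. cnj (fst x)) differentiable (at x within S)" for x
    unfolding differentiable_def by (rule exI, (rule derivative_intros)+)
  have "\<Psi> differentiable_on S"
    unfolding differentiable_on_def
  proof
    fix x assume "x \<in> S"
    then have q: "poly q (fst x) \<noteq> 0" "poly W (fst x) \<noteq> 0" by (auto simp: S_def)
    show "\<Psi> differentiable (at x within S)"
      unfolding \<Psi>_def
      by (intro differentiable_Pair differentiable_mult differentiable_diff rat cis cnj q)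
  qed
  then have "negligible (\<Psi> ` S)"
    by (intro negligible_differentiable_image_lowdim) auto
  moreover have "U \<subseteq> \<Psi> ` S"
  proof
    fix ab assume ab: "ab \<in> U"
    obtain a b where [simp]: "ab = (a, b)" by (cases ab)
    obtain z where z: "poly q z \<noteq> 0" "a * rat_fun p q z + b = cnj z" "norm (a * rat_deriv p q z) = 1"
      using none ab by fastforce
    define \<theta> where "\<theta> = Arg (a * rat_deriv p q z)"
    have \<theta>: "a * rat_deriv p q z = cis \<theta>"
      using z(3) by (metis \<theta>_def mult_1 of_real_1 rcis_cmod_Arg rcis_def)
    then have d0: "rat_deriv p q z \<noteq> 0" using z(3) by auto
    then have W0: "poly W z \<noteq> 0" using rat_deriv_eq_0_iff[OF z(1)] by (simp add: W_def)
    have a: "a = cis \<theta> * rat_fun (q\<^sup>2) W z"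
      using \<theta> d0 W0 z(1) by (simp add: rat_fun_def rat_deriv_def W_def field_simps)
    have "b = cnj z - a * rat_fun p q z" using z(2) by (simp add: algebra_simps)
    then have "\<Psi> (z, \<theta>) = (a, b)" by (simp add: \<Psi>_def flip: a)
    moreover have "(z, \<theta>) \<in> S" using z(1) W0 by (simp add: S_def)
    ultimately show "ab \<in> \<Psi> ` S" by (metis \<open>ab = (a, b)\<close> imageI)
  qed
  ultimately have "negligible U" by (rule negligible_subset)
  moreover obtain u v where "cbox u v \<subseteq> U" "t \<in> box u v"
    using open_contains_cbox[OF assms] by metis
  ultimately have "negligible (box u v)" using box_subset_cbox negligible_subset by blast
  then show False using \<open>t \<in> box u v\<close> by (auto simp: negligible_interval)
qed

section \<open>Perturbing all zeros at once\<close>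

lemma rat_fun_affine: "poly q z \<noteq> 0 \<Longrightarrow> rat_fun (smult a p + smult b q) q z = a * rat_fun p q z + b"
  by (simp add: rat_fun_def field_simps)

lemma rat_deriv_affine: "rat_deriv (smult a p + smult b q) q z = a * rat_deriv p q z"
  by (simp add: rat_deriv_def wronskian_def pderiv_add pderiv_smult algebra_simps diff_divide_distrib)

text \<open>For \<alpha> = 1 + \<i> s the real part is \<open>Re (c i) - Im (c i) * s\<close>, which
  vanishes for at most one s.\<close>

lemma generic_direction:
  fixes c :: "'a \<Rightarrow> complex"
  assumes "finite I" "\<And>i. i \<in> I \<Longrightarrow> c i \<noteq> 0"
  shows "\<exists>\<alpha>. Re \<alpha> = 1 \<and> (\<forall>i\<in>I. Re (c i * \<alpha>) \<noteq> 0)"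
proof -
  obtain s where s: "s \<notin> (\<lambda>i. Re (c i) / Im (c i)) ` I"
    using ex_new_if_finite[OF infinite_UNIV_char_0 finite_imageI[OF assms(1)]] by blast
  have "Re (c i * Complex 1 s) \<noteq> 0" if i: "i \<in> I" for i
  proof
    assume "Re (c i * Complex 1 s) = 0"
    then have eq: "Re (c i) = Im (c i) * s" by simp
    show False
    proof (cases "Im (c i) = 0")
      case True
      then show ?thesis using eq assms(2)[OF i] by (simp add: complex_eq_iff)
    next
      case False
      then have "s = Re (c i) / Im (c i)" using eq by simp
      then show ?thesis using s i by blast
    qed
  qed
  then show ?thesis by (intro exI[of _ "Complex 1 s"]) simp
qed

text \<open>In disjoint balls the two perturbations have together at least 2 card Z + 2 zeros: four
  near \<open>z1\<close> and two near every other zero. So one of them has at least card Z + 1, and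
  this persists on an open set of parameters, which contains a generic one.\<close>

theorem perturbation_more_zeros:
  assumes ncr: "no_common_root p q" and deg: "degree p \<le> degree q" and q0: "q \<noteq> 0"
    and fin: "finite (cnj_fixed p q)" and z1: "z1 \<in> cnj_fixed p q" "norm (rat_deriv p q z1) = 1"
  shows "\<exists>a b. a \<noteq> 0 \<and> (\<forall>z\<in>cnj_fixed (smult a p + smult b q) q. norm (rat_deriv (smult a p + smult b q) q z) \<noteq> 1)
           \<and> card (cnj_fixed (smult a p + smult b q) q) \<ge> card (cnj_fixed p q) + 1"
proof -
  define Z where "Z = cnj_fixed p q"
  have finZ: "finite Z" using fin by (simp add: Z_def)
  have "\<forall>z\<in>Z. \<exists>d>0. \<forall>z'\<in>Z. z' \<noteq> z \<longrightarrow> d \<le> dist z z'"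
    using finite_set_avoid[OF finZ] by blast
  then obtain d where d: "\<And>z. z \<in> Z \<Longrightarrow> d z > 0" "\<And>z z'. z \<in> Z \<Longrightarrow> z' \<in> Z \<Longrightarrow> z' \<noteq> z \<Longrightarrow> d z \<le> dist z z'"
    by metis
  define r where "r = (\<lambda>z. d z / 2)"
  have r: "r z > 0" if "z \<in> Z" for z using d(1)[OF that] by (simp add: r_def)
  have disj: "ball z (r z) \<inter> ball z' (r z') = {}" if "z \<in> Z" "z' \<in> Z" "z \<noteq> z'" for z z'
  proof (rule ccontr)
    assume "\<not> ?thesis"
    then obtain w where "dist z w < d z / 2" "dist z' w < d z' / 2" by (auto simp: r_def)
    then have "dist z z' < d z / 2 + d z' / 2" using dist_triangle2[of z z' w] by linarith
    moreover have "d z \<le> dist z z'" "d z' \<le> dist z z'"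
      using d(2)[of z z'] d(2)[of z' z] that by (simp_all add: dist_commute)
    ultimately show False by linarith
  qed
  have iso: "w = z" if "z \<in> Z" "w \<in> ball z (r z)" "w \<in> Z" for z w
    using disj[OF that(1,3)] that r[OF that(3)] centre_in_ball by blast
  \<comment> \<open>With \<gamma> = -\<alpha> cnj z1 the rotated displacement at \<open>z\<close> is
    \<open>c z * \<alpha>\<close>. It must have nonzero real part at every zero except
    \<open>z1\<close>, where it vanishes.\<close>
  define c where "c = (\<lambda>z. half_turn (rat_deriv p q z) * cnj (z - z1))"
  have "c z \<noteq> 0" if "z \<in> Z - {z1}" for z
  proof -
    have "half_turn (rat_deriv p q z) \<noteq> 0" using norm_half_turn by (metis norm_zero zero_neq_one)
    then show ?thesis using that by (simp add: c_def del: complex_cnj_diff)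
  qed
  then obtain \<alpha> where \<alpha>: "Re \<alpha> = 1" "\<And>z. z \<in> Z - {z1} \<Longrightarrow> Re (c z * \<alpha>) \<noteq> 0"
    using generic_direction[of "Z - {z1}" c] finZ by auto
  define \<gamma> where "\<gamma> = - (\<alpha> * cnj z1)"
  define t where "t = (\<lambda>\<epsilon>::real. (1 + of_real \<epsilon> * \<alpha>, of_real \<epsilon> * \<gamma>))"
  define m where "m = (\<lambda>z. if z = z1 then 4 else 2 :: nat)"
  have "\<exists>\<epsilon>0>0. \<forall>\<epsilon>. 0 < \<epsilon> \<longrightarrow> \<epsilon> < \<epsilon>0 \<longrightarrow> (\<exists>k1 k2. k1 + k2 \<ge> m z
       \<and> zeros_near p q z (r z) k1 (t \<epsilon>) \<and> zeros_near p q z (r z) k2 (t (-\<epsilon>)))" if z: "z \<in> Z" for z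
  proof (cases "z = z1")
    case True
    then show ?thesis
      using zeros_near_singular[OF z1(1) r[OF z, unfolded True] iso[OF z, unfolded True Z_def] z1(2), of \<alpha>] \<alpha>(1)
      by (simp add: t_def m_def \<gamma>_def)
  next
    case False
    have "half_turn (rat_deriv p q z) * (\<alpha> * cnj z + \<gamma>) = c z * \<alpha>"
      by (simp add: c_def \<gamma>_def algebra_simps)
    then have "Re (half_turn (rat_deriv p q z) * (\<alpha> * cnj z + \<gamma>)) \<noteq> 0" using \<alpha>(2)[of z] z False by simp
    from zeros_near_transversal[OF z[unfolded Z_def] r[OF z] iso[OF z, unfolded Z_def] this] False
    show ?thesis by (simp add: t_def m_def)
  qed
  then obtain \<epsilon>0 where \<epsilon>0: "\<And>z. z \<in> Z \<Longrightarrow> \<epsilon>0 z > 0"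
    "\<And>z \<epsilon>. z \<in> Z \<Longrightarrow> 0 < \<epsilon> \<Longrightarrow> \<epsilon> < \<epsilon>0 z \<Longrightarrow> \<exists>k1 k2. k1 + k2 \<ge> m z
       \<and> zeros_near p q z (r z) k1 (t \<epsilon>) \<and> zeros_near p q z (r z) k2 (t (-\<epsilon>))"
    by metis
  \<comment> \<open>Inserting 1 ensures \<epsilon> < 1, so that 1 \<plusminus> \<epsilon> \<alpha>
    has nonzero real part; a nonzero first parameter preserves
    \<open>no_common_root\<close>.\<close>
  define \<epsilon> where "\<epsilon> = Min (insert 1 (\<epsilon>0 ` Z)) / 2"
  have "Min (insert 1 (\<epsilon>0 ` Z)) > 0" using finZ \<epsilon>0(1) by (subst Min_gr_iff) auto
  then have \<epsilon>: "\<epsilon> > 0" "\<epsilon> < Min (insert 1 (\<epsilon>0 ` Z))" by (simp_all add: \<epsilon>_def)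
  then have \<epsilon>1: "\<epsilon> < 1" "\<And>z. z \<in> Z \<Longrightarrow> \<epsilon> < \<epsilon>0 z" using finZ by (auto simp: Min_gr_iff)
  have "\<forall>z\<in>Z. \<exists>k1 k2. k1 + k2 \<ge> m z \<and> zeros_near p q z (r z) k1 (t \<epsilon>) \<and> zeros_near p q z (r z) k2 (t (-\<epsilon>))"
    using \<epsilon>0(2) \<epsilon>(1) \<epsilon>1(2) by blast
  then obtain k1 k2 where k: "\<And>z. z \<in> Z \<Longrightarrow> k1 z + k2 z \<ge> m z"
    "\<And>z. z \<in> Z \<Longrightarrow> zeros_near p q z (r z) (k1 z) (t \<epsilon>)"
    "\<And>z. z \<in> Z \<Longrightarrow> zeros_near p q z (r z) (k2 z) (t (-\<epsilon>))"
    by metis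
  have z1Z: "z1 \<in> Z" using z1 by (simp add: Z_def)
  have "sum m Z = 4 + sum m (Z - {z1})" using finZ z1Z by (simp add: sum.remove m_def)
  also have "sum m (Z - {z1}) = (\<Sum>z\<in>Z - {z1}. 2)" by (intro sum.cong) (auto simp: m_def)
  finally have "sum m Z = 2 * card Z + 2"
    using finZ z1Z card_Suc_Diff1[OF finZ z1Z] by simp
  moreover have "sum m Z \<le> sum k1 Z + sum k2 Z" unfolding sum.distrib[symmetric] by (intro sum_mono k(1))
  ultimately have "sum k1 Z \<ge> card Z + 1 \<or> sum k2 Z \<ge> card Z + 1" by linarith
  then obtain s k where s: "s = t \<epsilon> \<or> s = t (-\<epsilon>)" and ks: "sum k Z \<ge> card Z + 1"
    and zn: "\<And>z. z \<in> Z \<Longrightarrow> zeros_near p q z (r z) (k z) s"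
    using k(2,3) by blast
  have "Re (fst s) \<noteq> 0" using s \<alpha>(1) \<epsilon>(1) \<epsilon>1(1) by (auto simp: t_def)
  then have "fst s \<noteq> 0" by auto
  then have "\<forall>\<^sub>F t' in nhds s. t' \<in> {t'. fst t' \<noteq> 0}"
    by (intro eventually_nhds_in_open open_Collect_neq continuous_intros) auto
  moreover have "\<forall>\<^sub>F t' in nhds s. \<forall>z\<in>Z. \<exists>X. finite X \<and> card X = k z \<and>
      X \<subseteq> {w \<in> ball z (r z). poly q w \<noteq> 0 \<and> fst t' * rat_fun p q w + snd t' = cnj w}"
    using zn finZ unfolding zeros_near_def by (intro eventually_ball_finite) auto
  ultimately have "\<forall>\<^sub>F t' in nhds s. fst t' \<noteq> 0 \<and> (\<forall>z\<in>Z. \<exists>X. finite X \<and> card X = k z \<and>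
      X \<subseteq> {w \<in> ball z (r z). poly q w \<noteq> 0 \<and> fst t' * rat_fun p q w + snd t' = cnj w})"
    by eventually_elim auto
  then obtain U where U: "open U" "s \<in> U" "\<And>t'. t' \<in> U \<Longrightarrow> fst t' \<noteq> 0 \<and> (\<forall>z\<in>Z. \<exists>X. finite X \<and> card X = k z \<and>
      X \<subseteq> {w \<in> ball z (r z). poly q w \<noteq> 0 \<and> fst t' * rat_fun p q w + snd t' = cnj w})"
    unfolding eventually_nhds by blast
  obtain a b where ab: "(a, b) \<in> U"
    "\<And>z. poly q z \<noteq> 0 \<Longrightarrow> a * rat_fun p q z + b = cnj z \<Longrightarrow> norm (a * rat_deriv p q z) \<noteq> 1"
    using generic_parameter[OF U(1,2)] by fast
  define p' where "p' = smult a p + smult b q"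
  have a0: "a \<noteq> 0" using U(3)[OF ab(1)] by simp
  have fixed': "cnj_fixed p' q = {w. poly q w \<noteq> 0 \<and> a * rat_fun p q w + b = cnj w}"
    by (auto simp: cnj_fixed_def p'_def rat_fun_affine)
  have reg: "norm (rat_deriv p' q z) \<noteq> 1" if "z \<in> cnj_fixed p' q" for z
  proof -
    have "poly q z \<noteq> 0" "a * rat_fun p q z + b = cnj z" using that by (simp_all add: fixed')
    then show ?thesis unfolding p'_def rat_deriv_affine by (rule ab(2))
  qed
  have "\<forall>z\<in>Z. \<exists>X. finite X \<and> card X = k z \<and>
      X \<subseteq> {w \<in> ball z (r z). poly q w \<noteq> 0 \<and> a * rat_fun p q w + b = cnj w}"
    using U(3)[OF ab(1)] unfolding fst_conv snd_conv by (rule conjunct2)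
  from bchoice[OF this] obtain X where "\<forall>z\<in>Z. finite (X z) \<and> card (X z) = k z \<and>
      X z \<subseteq> {w \<in> ball z (r z). poly q w \<noteq> 0 \<and> a * rat_fun p q w + b = cnj w}" ..
  then have X: "finite (X z)" "card (X z) = k z"
    "X z \<subseteq> {w \<in> ball z (r z). poly q w \<noteq> 0 \<and> a * rat_fun p q w + b = cnj w}" if "z \<in> Z" for z
    using that by simp_all
  have "card (\<Union>z\<in>Z. X z) = (\<Sum>z\<in>Z. card (X z))"
  proof (rule card_UN_disjoint[OF finZ])
    show "\<forall>z\<in>Z. finite (X z)" using X(1) by blast
    show "\<forall>z\<in>Z. \<forall>z'\<in>Z. z \<noteq> z' \<longrightarrow> X z \<inter> X z' = {}"
    proof (intro ballI impI)
      fix z z' assume zz: "z \<in> Z" "z' \<in> Z" "z \<noteq> z'"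
      have "X z \<inter> X z' \<subseteq> ball z (r z) \<inter> ball z' (r z')" using X(3)[OF zz(1)] X(3)[OF zz(2)] by blast
      then show "X z \<inter> X z' = {}" using disj[OF zz] by simp
    qed
  qed
  then have "card (\<Union>z\<in>Z. X z) \<ge> card Z + 1" using ks X(2) by simp
  moreover have "(\<Union>z\<in>Z. X z) \<subseteq> cnj_fixed p' q" using X(3) unfolding fixed' by blast
  moreover have "finite (cnj_fixed p' q)"
  proof (rule cnj_fixed_finite[OF _ _ q0 reg])
    show "no_common_root p' q" using ncr a0 by (auto simp: no_common_root_def p'_def)
    show "degree p' \<le> degree q"
      unfolding p'_def using deg by (intro degree_add_le) (auto intro: order_trans[OF degree_smult_le])
  qed
  ultimately have "card (cnj_fixed p' q) \<ge> card Z + 1" using card_mono order_trans by metis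
  then show ?thesis
    using a0 reg unfolding p'_def Z_def by blast
qed

text \<open>The perturbed map has the same denominator, so the regular bound applies with the same
  \<open>n\<close>. Finiteness is assumed because \<open>cnj_fixed_finite\<close> covers regular
  maps alone.\<close>

theorem card_cnj_fixed_singular_less:
  assumes ncr: "no_common_root p q" and deg: "degree p \<le> degree q" "degree q = n" "n \<ge> 2"
    and fin: "finite (cnj_fixed p q)" and z1: "z1 \<in> cnj_fixed p q" "norm (rat_deriv p q z1) = 1"
  shows "card (cnj_fixed p q) < 5 * n - 5"
proof -
  have q0: "q \<noteq> 0" using deg by auto
  obtain a b where ab: "a \<noteq> 0"
    "\<And>z. z \<in> cnj_fixed (smult a p + smult b q) q \<Longrightarrow> norm (rat_deriv (smult a p + smult b q) q z) \<noteq> 1"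
    "card (cnj_fixed (smult a p + smult b q) q) \<ge> card (cnj_fixed p q) + 1"
    using perturbation_more_zeros[OF ncr deg(1) q0 fin z1] by blast
  have "no_common_root (smult a p + smult b q) q" using ncr ab(1) by (auto simp: no_common_root_def)
  moreover have "degree (smult a p + smult b q) \<le> degree q"
    using deg by (intro degree_add_le) (auto intro: order_trans[OF degree_smult_le])
  ultimately have "card (cnj_fixed (smult a p + smult b q) q) \<le> 5 * n - 5"
    using card_cnj_fixed_regular_le deg(2,3) ab(2) by blast
  then show ?thesis using ab(3) by linarith
qed

section \<open>Poles, and the two degree cases\<close>

lemma harmonic_zeros_eq:
  assumes "q \<noteq> 0" "no_common_root p q"
  shows "harmonic_zeros (rat_fun p q) = cnj_fixed p q"
proof -
  have "is_pole (rat_fun p q) z \<longleftrightarrow> poly q z = 0" for z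
  proof
    assume pole: "is_pole (rat_fun p q) z"
    show "poly q z = 0"
    proof (rule ccontr)
      assume "poly q z \<noteq> 0"
      then have "rat_fun p q \<midarrow>z\<rightarrow> rat_fun p q z"
        using DERIV_isCont[OF rat_fun_has_field_derivative] by (simp add: isCont_def)
      then show False using pole not_tendsto_and_filterlim_at_infinity[of "at z" "rat_fun p q"]
        by (auto simp: is_pole_def)
    qed
  next
    assume q: "poly q z = 0"
    then have p: "poly p z \<noteq> 0" using assms(2) by (auto simp: no_common_root_def)
    have "filterlim (poly q) (at 0) (at z)"
      unfolding filterlim_at
    proof
      show "\<forall>\<^sub>F x in at z. poly q x \<in> UNIV \<and> poly q x \<noteq> 0"
      proof -
        have "open (- ({w. poly q w = 0} - {z}))"
          using poly_roots_finite[OF assms(1)] by (intro open_Compl finite_imp_closed) auto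
        then have "\<forall>\<^sub>F x in at z. x \<in> - ({w. poly q w = 0} - {z})" by (rule eventually_at_in_open') auto
        then show ?thesis using eventually_neq_at_within[of z z] by eventually_elim auto
      qed
      show "poly q \<midarrow>z\<rightarrow> 0" using q by (metis isCont_def poly_isCont)
    qed
    then have "filterlim (\<lambda>w. poly p w / poly q w) at_infinity (at z)"
      using p by (intro filterlim_divide_at_infinity[of _ "poly p z"]) (auto intro: poly_isCont[unfolded isCont_def])
    then show "is_pole (rat_fun p q) z" by (simp add: is_pole_def rat_fun_def)
  qed
  then show ?thesis by (auto simp: harmonic_zeros_def cnj_fixed_def)
qed

theorem theorem3p1:
  fixes p q :: "complex poly" and n :: nat
  assumes "q \<noteq> 0" and "coprime p q"
    and "rat_degree p q = n" and "n \<ge> 2"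
    and "card (harmonic_zeros (rat_fun p q)) = 5 * (n - 1) \<or>
         (degree p > degree q \<and> card (harmonic_zeros (rat_fun p q)) = 5 * (n - 1) - 1)"
  shows "\<forall>z \<in> harmonic_zeros (rat_fun p q). \<not> singular_zero (rat_fun p q) z"
proof (intro ballI notI)
  fix z0 assume "z0 \<in> harmonic_zeros (rat_fun p q)" and sing: "singular_zero (rat_fun p q) z0"
  have ncr: "no_common_root p q" using coprime_poly_0[OF assms(2)] by (auto simp: no_common_root_def)
  note hz = harmonic_zeros_eq[OF assms(1) ncr]
  define Z where "Z = cnj_fixed p q"
  have z0: "z0 \<in> Z" using \<open>z0 \<in> _\<close> by (simp add: hz Z_def)
  then have qz0: "poly q z0 \<noteq> 0" by (simp add: Z_def cnj_fixed_def)
  have d0: "norm (rat_deriv p q z0) = 1"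
    using sing DERIV_imp_deriv[OF rat_fun_has_field_derivative[OF qz0]] by (simp add: singular_zero_def)
  have card: "card Z = 5 * (n - 1) \<or> (degree p > degree q \<and> card Z = 5 * (n - 1) - 1)"
    using assms(5) by (simp add: hz Z_def)
  \<comment> \<open>An infinite set has \<open>card\<close> 0, while both prescribed numbers are
    positive for \<open>n \<ge> 2\<close>.\<close>
  then have fin: "finite Z" using assms(4) by (intro card_ge_0_finite) auto
  have degs: "degree p \<le> n" "degree q \<le> n" "degree p = n \<or> degree q = n"
    using assms(3) by (auto simp: rat_degree_def)
  show False
  proof (cases "degree q < degree p")
    case False
    then have "degree p \<le> degree q" "degree q = n" using degs by auto
    from card_cnj_fixed_singular_less[OF ncr this assms(4) fin[unfolded Z_def] z0[unfolded Z_def] d0]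
    show False using card False by (simp add: Z_def)
  next
    case True
    then have dq_less: "degree q < n" using degs by auto
    \<comment> \<open>Taking \<open>c\<close> to be neither a zero nor a pole gives \<open>Q\<close>
      full degree, so infinity is not fixed in the new coordinate, and no old zero is moved away to
      it.\<close>
    have "finite (Z \<union> {z. poly q z = 0})" using fin poly_roots_finite[OF assms(1)] by simp
    then obtain c where c: "c \<notin> Z" "poly q c \<noteq> 0"
      using ex_new_if_finite[OF infinite_UNIV_char_0] by blast
    interpret moebius p q n c
      using ncr degs c(2) assms(4) by unfold_locales auto
    define f where "f = (\<lambda>z. inverse (z - c))"
    have rc: "rat_fun p q c \<noteq> cnj c" using c by (auto simp: Z_def cnj_fixed_def)
    have zc: "z \<noteq> c" if "z \<in> Z" for z using c that by auto
    have img: "cnj_fixed P Q = insert 0 (f ` Z)"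
    proof (intro set_eqI iffI)
      fix w assume w: "w \<in> cnj_fixed P Q"
      show "w \<in> insert 0 (f ` Z)"
      proof (cases "w = 0")
        case False
        then have "c + inverse w \<in> Z" using w fixed_iff by (simp add: Z_def)
        moreover have "w = f (c + inverse w)" by (simp add: f_def)
        ultimately show ?thesis by blast
      qed simp
    next
      fix w assume "w \<in> insert 0 (f ` Z)"
      then show "w \<in> cnj_fixed P Q"
      proof
        assume "w = 0"
        then show ?thesis using fixed_0_iff dq_less by (simp add: coeff_eq_0)
      next
        assume "w \<in> f ` Z"
        then obtain z where z: "z \<in> Z" "w = f z" by auto
        then have "w \<noteq> 0" "c + inverse w = z" using zc by (auto simp: f_def)
        then show ?thesis using fixed_iff z by (simp add: Z_def)
      qed
    qed
    have "inj_on f Z" by (auto simp: inj_on_def f_def)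
    moreover have "0 \<notin> f ` Z" using zc by (auto simp: f_def)
    ultimately have cardPQ: "card (cnj_fixed P Q) = card Z + 1"
      unfolding img using fin by (simp add: card_image)
    have finPQ: "finite (cnj_fixed P Q)" unfolding img using fin by simp
    have w0: "f z0 \<noteq> 0" "c + inverse (f z0) = z0" using zc[OF z0] by (auto simp: f_def)
    have w1: "f z0 \<in> cnj_fixed P Q" unfolding img using z0 by simp
    have "norm (rat_deriv P Q (f z0)) = 1" using norm_deriv[OF w0(1) w1] w0(2) d0 by simp
    moreover have "degree P \<le> degree Q" "degree Q = n"
      using degree_Q_eq[OF rc] degree_P by auto
    \<comment> \<open>As the old infinity contributes one more zero, \<open>card Z + 1\<close> is
      below 5 n - 5; this contradicts even the smaller of the two prescribed numbers.\<close>
    ultimately have "card (cnj_fixed P Q) < 5 * n - 5"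
      using card_cnj_fixed_singular_less[OF no_common_root_PQ _ _ assms(4) finPQ w1] by blast
    then show False using card cardPQ assms(4) by auto
  qed
qed

end
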